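(* Assume $\mathbb V^1$ is rank-regular. Suppose that $t_{**}^1\in\mathbb V^1$ is a zero of $\mathcal K_{\mathrm{KP}}(\cdot,0)$. Then $t_{**}^1$ is non-degenerate (i.e. the derivative of $\mathcal K_{\mathrm{KP}}(\cdot,0)$ at $t_{**}^1$ is invertible) if and only if the conditions (I) $\mathcal E_{\mathrm{CC}}(t_{**}^0)\notin\sigma(\mathcal H_K(t_{**}^0)_{\mathfrak V^0})$, (II) $\mathcal E_{\mathrm{CC}}(t_{**}^1)\notin\sigma(\widehat{\mathcal H_K}(t_{**}^1)_{\mathfrak V^\angle})$ both hold true, and in this case the topological index of $\mathcal K_{\mathrm{KP}}(\cdot,0)$ at $t_{**}^1$ is $i(\mathcal K_{\mathrm{KP}}(\cdot,0),t_{**}^1)=(-1)^{\nu^0+\nu^\angle}$, where $$\nu^0=|\{j:\mathcal E_j(\mathcal H_K(t_{**}^0)_{\mathfrak V^0})\in\mathbb R,\ \mathcal E_j(\mathcal H_K(t_{**}^0)_{\mathfrak V^0})<\mathcal E_{\mathrm{CC}}(t_{**}^0)\}|,$$ $$\nu^\angle=|\{j:\mathcal E_j(\widehat{\mathcal H_K}(t_{**}^1)_{\mathfrak V^\angle})\in\mathbb R,\ \mathcal E_j(\widehat{\mathcal H_K}(t_{**}^1)_{\mathfrak V^\angle})<\mathcal E_{\mathrm{CC}}(t_{**}^1)\}|.$$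
   Context: Setting. Fix $1\le N\le K<\infty$. Let $\mathfrak L^2=\bigwedge^N L^2(\mathbb R^3)$ with inner product $\langle\cdot,\cdot\rangle$, $\mathfrak H^1=\mathfrak L^2\cap H^1(\mathbb R^{3N})$. Let $\phi_1,\dots,\phi_K\in H^1(\mathbb R^3)$ be $L^2$-orthonormal; $\phi_1,\dots,\phi_N$ are called occupied, the others virtual. For a multiindex $\alpha=(\alpha_1<\dots<\alpha_N)$ in $\{1,\dots,K\}$, $\Phi_\alpha=\phi_{\alpha_1}\wedge\dots\wedge\phi_{\alpha_N}$ is the ($\mathfrak L^2$-normalized) Slater determinant; these form an orthonormal basis of $\mathfrak H^1_K:=\mathrm{Span}\{\Phi_\alpha\}$. The index $0$ means $(1,\dots,N)$, and $\Phi_0=\phi_1\wedge\dots\wedge\phi_N$ is the reference. The Hamiltonian is $\mathcal H=\sum_i[-\tfrac12\Delta_{x_i}+V(x_i)]+\sum_{i<j}w(x_i-x_j)$ with real-valued $V,w\in L^{3/2}(\mathbb R^3)+L^\infty_\varepsilon(\mathbb R^3)$ (the $L^\infty$ part can be chosen arbitrarily small), $w$ even; $\mathcal H_K:\mathfrak H^1_K\to(\mathfrak H^1_K)^*$ is defined by $\langle\mathcal H_K\Phi,\Psi\rangle=\langle\mathcal H\Phi,\Psi\rangle$ (in the form sense) and is regarded as an operator on $\mathfrak H_K^1$ via $\langle\cdot,\cdot\rangle$. Everything is over $\mathbb R$ (the matrix elements $\langle\mathcal H_K\Phi_\alpha,\Phi_\beta\rangle$ are real). Excitation and cluster operators. The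 rank of $\alpha$ is its number of virtual indices. For $\alpha\ne0$ with virtual indices $A_1<\dots<A_r$ and with $I_1<\dots<I_r$ the occupied indices missing from $\alpha$, $X_\alpha=a_{A_1}^\dagger a_{I_1}\cdots a_{A_r}^\dagger a_{I_r}$, where $a_p^\dagger,a_p$ are the fermionic creation/annihilation operators of $\phi_p$; the sign of $\Phi_\alpha$ is chosen so that $\Phi_\alpha=X_\alpha\Phi_0$. Amplitude spaces. Let $\Xi^1$ be the set of (nonzero) excitation multiindices retained by a truncation (possibly all), $\mathbb V^1=\{t=(t_\alpha)_{\alpha\in\Xi^1}:t_\alpha\in\mathbb R\}$; the cluster operator of $t$ is $T=\sum t_\alpha X_\alpha$ (capital letters, with the same superscripts, denote cluster operators of lower-case amplitudes). $\mathbb V^1$ is rank-regular if $\langle X_\alpha\Phi_\beta,\Phi_\gamma\rangle=0$ for all $\beta,\gamma\in\Xi^1$ and all nonzero multiindices $\alpha\notin\Xi^1$. Fix $\rho\ge1$; $\Xi^0=\{\alpha\in\Xi^1:\mathrm{rk}\,\alpha\le\rho\}$, $\mathbb V^0$ is the subspace of amplitudes supported on $\Xi^0$, $\mathbb V^\angle$ that of amplitudes supported on $\{\alpha\in\Xi^1:\mathrm{rk}\,\alpha>\rho\}$; write $t^1=t^0+t^\angle$. $\mathfrak V^0=\{T\Phi_0:t\in\mathbb V^0\}$, $\mathfrak V^\angle=\{T\Phi_0:t\in\mathbb V^\angle\}$. Objects. $\mathcal H_K(t)=e^{-T}\mathcal H_Ke^T$; $\mathcal E_{\mathrm{CC}}(t)=\langle\mathcal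 H_K(t)\Phi_0,\Phi_0\rangle$; $\widehat{\mathcal H_K}(t^1)=\mathcal H_K(t^1)-\sum_{\alpha\in\Xi^0}\langle\mathcal H_K(t^1)\Phi_0,\Phi_\alpha\rangle X_\alpha$. For an operator $\mathcal T$ on $\mathfrak H_K^1$ and a subspace $\mathfrak W\subset\mathfrak H^1_K$, $\mathcal T_{\mathfrak W}:\mathfrak W\to\mathfrak W$ is the compression, $\langle\mathcal T_{\mathfrak W}\Psi,\Psi'\rangle=\langle\mathcal T\Psi,\Psi'\rangle$ for $\Psi,\Psi'\in\mathfrak W$. $\mathcal E_j(\cdot)$ denote the (complex) eigenvalues, listed with algebraic multiplicity. The Kowalski--Piecuch homotopy $\mathcal K_{\mathrm{KP}}:\mathbb V^1\times[0,1]\to(\mathbb V^1)^*$ is $$\langle\mathcal K_{\mathrm{KP}}(t^1,\lambda),s^1\rangle=\langle\mathcal H_K(t^0)\Phi_0,S^0\Phi_0\rangle+\langle\mathcal H_K(t^1)\Phi_0,S^\angle\Phi_0\rangle+\lambda\langle\mathcal H_K(t^0)(e^{T^\angle}-I)\Phi_0,S^0\Phi_0\rangle .$$ Index. For an isolated zero $u$ of a map $\mathcal F$, $i(\mathcal F,u)=\deg(\mathcal F,B(u,r),0)$ (Brouwer degree, $r>0$ small), where $\mathbb V^1,(\mathbb V^1)^*$ are compatibly oriented (the dual basis of a positive basis is positive). *)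

theory Defs
  imports
    "HOL-Analysis.Analysis"
    "HOL-Homology.Homology"
    "Jordan_Normal_Form.Spectral_Radius"
begin

no_notation Matrix.vec_index (infixl "$" 100)
unbundle inner_syntax

section \<open>Sobolev functions and potentials\<close>

text \<open>Functions are Borel representatives of the \<open>L\<^sup>p\<close> classes of the mathematics;
  everything is real-valued.\<close>

fun iterated_partial :: "'a::euclidean_space list \<Rightarrow> ('a \<Rightarrow> real) \<Rightarrow> 'a \<Rightarrow> real" where
  "iterated_partial [] f = f"
| "iterated_partial (b # bs) f = (\<lambda>x. frechet_derivative (iterated_partial bs f) (at x) b)"

text \<open>The class of smooth compactly supported functions: a function is smooth iff all its
  iterated partial derivatives exist and are (totally) differentiable.\<close>

definition test_function :: "('a::euclidean_space \<Rightarrow> real) \<Rightarrow> bool" where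
  "test_function \<eta> \<longleftrightarrow>
     (\<forall>bs. set bs \<subseteq> Basis \<longrightarrow> (\<forall>x. iterated_partial bs \<eta> differentiable (at x))) \<and>
     compact (closure {x. \<eta> x \<noteq> 0})"

definition square_integrable :: "('a::euclidean_space \<Rightarrow> 'b::euclidean_space) \<Rightarrow> bool" where
  "square_integrable u \<longleftrightarrow>
     u \<in> borel_measurable lborel \<and> integrable lborel (\<lambda>x. (norm (u x))\<^sup>2)"

definition is_weak_gradient :: "('a::euclidean_space \<Rightarrow> real) \<Rightarrow> ('a \<Rightarrow> 'a) \<Rightarrow> bool" where
  "is_weak_gradient u g \<longleftrightarrow> square_integrable g \<and>
     (\<forall>\<eta>. test_function \<eta> \<longrightarrow> (\<forall>b\<in>Basis.
        (LINT x|lborel. u x * frechet_derivative \<eta> (at x) b) = - (LINT x|lborel. (g x \<bullet> b) * \<eta> x)))"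

definition H1 :: "('a::euclidean_space \<Rightarrow> real) set" where
  "H1 = {u. square_integrable u \<and> (\<exists>g. is_weak_gradient u g)}"

text \<open>Unique up to null sets, so integrals involving it do not depend on the choice.\<close>

definition weak_gradient :: "('a::euclidean_space \<Rightarrow> real) \<Rightarrow> 'a \<Rightarrow> 'a" where
  "weak_gradient u = (SOME g. is_weak_gradient u g)"

definition L32_plus_Linf_eps :: "(real^3 \<Rightarrow> real) set" where
  "L32_plus_Linf_eps = {V. V \<in> borel_measurable lborel \<and>
     (\<forall>\<epsilon>>0. \<exists>V1 V2.
        V1 \<in> borel_measurable lborel \<and> integrable lborel (\<lambda>x. \<bar>V1 x\<bar> powr (3/2)) \<and>
        V2 \<in> borel_measurable lborel \<and> (AE x in lborel. \<bar>V2 x\<bar> \<le> \<epsilon>) \<and>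
        (AE x in lborel. V x = V1 x + V2 x))}"


section \<open>Slater determinants and the Hamiltonian form\<close>

text \<open>The particles are indexed by a finite linear order \<open>'n\<close> with \<open>N = CARD('n)\<close> elements and the
  orbitals by a finite linear order \<open>'k\<close> with \<open>K = CARD('k)\<close> elements.  A multiindex
  \<open>\<alpha>\<^sub>1 < \<dots> < \<alpha>\<^sub>N\<close> is represented by its set of entries, a subset of \<open>'k\<close> of cardinality \<open>N\<close>.
\<close>

type_synonym 'n config = "real^3^'n"

definition entry :: "'k::linorder set \<Rightarrow> 'n::{finite,linorder} \<Rightarrow> 'k" where
  "entry \<alpha> i = sorted_list_of_set \<alpha> ! card {j. j < i}"

definition slater ::
  "('k::{finite,linorder} \<Rightarrow> real^3 \<Rightarrow> real) \<Rightarrow> 'k set \<Rightarrow> 'n::{finite,linorder} config \<Rightarrow> real" where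
  "slater \<phi> \<alpha> x =
     Determinants.det (\<chi> i j. \<phi> (entry \<alpha> i) (x $ (j::'n))) / sqrt (fact CARD('n))"

definition orthonormal_orbitals :: "('k \<Rightarrow> real^3 \<Rightarrow> real) \<Rightarrow> bool" where
  "orthonormal_orbitals \<phi> \<longleftrightarrow>
     (\<forall>p q. (LINT x|lborel. \<phi> p x * \<phi> q x) = (if p = q then 1 else 0))"

text \<open>The quadratic form of
  \<open>\<Sum>\<^sub>i [-1/2 \<Delta>\<^sub>i + V(x\<^sub>i)] + \<Sum>\<^sub>i\<^sub><\<^sub>j w(x\<^sub>i - x\<^sub>j)\<close>; the kinetic part is integrated by parts.\<close>

definition hamiltonian_form ::
  "(real^3 \<Rightarrow> real) \<Rightarrow> (real^3 \<Rightarrow> real) \<Rightarrow>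
   ('n::{finite,linorder} config \<Rightarrow> real) \<Rightarrow> ('n config \<Rightarrow> real) \<Rightarrow> real" where
  "hamiltonian_form V w \<Phi> \<Psi> =
     1/2 * (LINT x|lborel. weak_gradient \<Phi> x \<bullet> weak_gradient \<Psi> x) +
     (\<Sum>i\<in>UNIV. LINT x|lborel. V (x $ i) * \<Phi> x * \<Psi> x) +
     (\<Sum>(i, j)\<in>{(i, j). i < j}. LINT x|lborel. w (x $ i - x $ j) * \<Phi> x * \<Psi> x)"


text \<open>The Slater determinants are orthonormal in \<open>L\<^sup>2\<close>.\<close>

lemma lborel_vec:
  "(lborel :: ('a::euclidean_space^'n) measure) =
     distr (\<Pi>\<^sub>M i\<in>UNIV. lborel) borel vec_lambda"
proof (rule lborel_eqI)
  interpret product_sigma_finite "\<lambda>_::'n. lborel :: 'a measure"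
    by (rule product_sigma_finite.intro) (rule lborel.sigma_finite_measure_axioms)
  let ?M = "\<Pi>\<^sub>M i\<in>(UNIV::'n set). (lborel :: 'a measure)"
  have meas: "vec_lambda \<in> ?M \<rightarrow>\<^sub>M (borel :: ('a^'n) measure)"
  proof (rule borel_measurable_euclidean_space[THEN iffD2], rule ballI)
    fix b :: "'a^'n" assume "b \<in> Basis"
    then obtain i u where b: "b = axis i u" "u \<in> Basis" by (auto simp: Basis_vec_def)
    have "(\<lambda>f. f i \<bullet> u) \<in> borel_measurable ?M" by measurable
    then show "(\<lambda>f. vec_lambda f \<bullet> b) \<in> borel_measurable ?M"
      by (simp add: b inner_axis)
  qed
  fix l u :: "'a^'n" assume le: "\<And>b. b \<in> Basis \<Longrightarrow> l \<bullet> b \<le> u \<bullet> b"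
  have le': "l $ i \<bullet> b \<le> u $ i \<bullet> b" if "b \<in> Basis" for i b
    using le[of "axis i b"] that by (simp add: inner_axis axis_in_Basis_iff)
  have vimage: "vec_lambda -` box l u \<inter> space ?M = (\<Pi>\<^sub>E i\<in>UNIV. box (l $ i) (u $ i))"
    by (auto simp: space_PiM mem_box Basis_vec_def inner_axis PiE_def Pi_iff)
  have "emeasure (distr ?M borel vec_lambda) (box l u) = emeasure ?M (\<Pi>\<^sub>E i\<in>UNIV. box (l $ i) (u $ i))"
    by (subst emeasure_distr[OF meas]) (simp_all add: vimage)
  also have "\<dots> = (\<Prod>i\<in>UNIV. emeasure lborel (box (l $ i) (u $ i)))"
    by (rule emeasure_PiM) auto
  also have "\<dots> = (\<Prod>i\<in>UNIV. ennreal (\<Prod>b\<in>Basis. (u $ i - l $ i) \<bullet> b))"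
    by (intro prod.cong refl emeasure_lborel_box le')
  also have "\<dots> = ennreal (\<Prod>i\<in>UNIV. \<Prod>b\<in>Basis. (u $ i - l $ i) \<bullet> b)"
    by (intro prod_ennreal prod_nonneg) (auto simp: inner_diff_left le')
  also have "(\<Prod>i\<in>UNIV. \<Prod>b\<in>Basis. (u $ i - l $ i) \<bullet> b) =
      (\<Prod>(i, b)\<in>UNIV \<times> Basis. (u - l) \<bullet> axis i b)"
    by (subst prod.cartesian_product) (simp add: inner_axis)
  also have "\<dots> = (\<Prod>b\<in>Basis. (u - l) \<bullet> b)"
    by (rule prod.reindex_cong[of "\<lambda>(i, b). axis i b" _ _, symmetric, rotated -1])
       (auto simp: Basis_vec_def inj_on_def axis_eq_axis intro: nonzero_Basis)
  finally show "emeasure (distr ?M borel vec_lambda) (box l u) = ennreal (\<Prod>b\<in>Basis. (u - l) \<bullet> b)" .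
qed simp

lemma integral_vec_prod:
  fixes f :: "'n::finite \<Rightarrow> 'a::euclidean_space \<Rightarrow> real"
  assumes "\<And>i. integrable lborel (f i)"
  shows "(LINT x|lborel. (\<Prod>i\<in>UNIV. f i (x $ i))) = (\<Prod>i\<in>UNIV. LINT y|lborel. f i y)"
    and "integrable lborel (\<lambda>x::'a^'n. \<Prod>i\<in>UNIV. f i (x $ i))"
proof -
  interpret product_sigma_finite "\<lambda>_::'n. lborel :: 'a measure"
    by (rule product_sigma_finite.intro) (rule lborel.sigma_finite_measure_axioms)
  let ?M = "\<Pi>\<^sub>M i\<in>(UNIV::'n set). (lborel :: 'a measure)"
  have meas: "vec_lambda \<in> ?M \<rightarrow>\<^sub>M (borel :: ('a^'n) measure)"
  proof (rule borel_measurable_euclidean_space[THEN iffD2], rule ballI)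
    fix b :: "'a^'n" assume "b \<in> Basis"
    then obtain i u where b: "b = axis i u" "u \<in> Basis" by (auto simp: Basis_vec_def)
    have "(\<lambda>f. f i \<bullet> u) \<in> borel_measurable ?M" by measurable
    then show "(\<lambda>f. vec_lambda f \<bullet> b) \<in> borel_measurable ?M"
      by (simp add: b inner_axis)
  qed
  have [measurable]: "f i \<in> borel_measurable borel" for i
    using borel_measurable_integrable[OF assms[of i]] by simp
  have [measurable]: "(\<lambda>x::'a^'n. x $ i) \<in> borel_measurable borel" for i
    by (intro borel_measurable_continuous_onI continuous_intros)
  have m: "(\<lambda>x::'a^'n. \<Prod>i\<in>UNIV. f i (x $ i)) \<in> borel_measurable borel"
    by measurable
  show "(LINT x|lborel. (\<Prod>i\<in>UNIV. f i (x $ i))) = (\<Prod>i\<in>UNIV. LINT y|lborel. f i y)"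
    using product_integral_prod[of UNIV f] assms
    by (simp add: lborel_vec integral_distr[OF meas m])
  show "integrable lborel (\<lambda>x::'a^'n. \<Prod>i\<in>UNIV. f i (x $ i))"
    using product_integrable_prod[of UNIV f] assms
    by (simp add: lborel_vec integrable_distr_eq[OF meas m])
qed

lemma bij_betw_entry:
  assumes "card (\<alpha>::'k::{finite,linorder} set) = CARD('n::{finite,linorder})"
  shows "bij_betw (entry \<alpha> :: 'n \<Rightarrow> 'k) UNIV \<alpha>"
proof -
  let ?pos = "\<lambda>i::'n. card {j. j < i}"
  have mono: "?pos i < ?pos j" if "i < j" for i j
    by (rule psubset_card_mono) (use that in \<open>auto dest: less_trans\<close>)
  have "inj ?pos"
    by (rule linorder_injI) (use mono in \<open>fastforce\<close>)
  moreover have "?pos i < CARD('n)" for i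
    by (rule psubset_card_mono) auto
  ultimately have "bij_betw ?pos UNIV {..<CARD('n)}"
    unfolding bij_betw_def by (intro conjI card_subset_eq) (auto simp: card_image)
  moreover have "bij_betw ((!) (sorted_list_of_set \<alpha>)) {..<CARD('n)} \<alpha>"
    by (rule bij_betw_nth) (use assms in auto)
  ultimately have "bij_betw ((!) (sorted_list_of_set \<alpha>) \<circ> ?pos) UNIV \<alpha>"
    by (rule bij_betw_trans)
  then show ?thesis
    by (simp add: entry_def[abs_def] o_def)
qed

theorem slater_orthonormal:
  fixes \<phi> :: "'k::{finite,linorder} \<Rightarrow> real^3 \<Rightarrow> real"
  assumes H1: "\<And>p. \<phi> p \<in> H1" and on: "orthonormal_orbitals \<phi>"
    and \<alpha>: "card \<alpha> = CARD('n::{finite,linorder})" and \<beta>: "card \<beta> = CARD('n)"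
  shows "(LINT x|lborel. slater \<phi> \<alpha> (x :: 'n config) * slater \<phi> \<beta> x) = (if \<alpha> = \<beta> then 1 else 0)"
proof -
  let ?P = "{p. p permutes (UNIV::'n set)}"
  define ea where "ea = (entry \<alpha> :: 'n \<Rightarrow> 'k)"
  define eb where "eb = (entry \<beta> :: 'n \<Rightarrow> 'k)"
  have ea: "inj ea" "range ea = \<alpha>" and eb: "inj eb" "range eb = \<beta>"
    using bij_betw_entry[OF \<alpha>] bij_betw_entry[OF \<beta>] by (auto simp: ea_def eb_def bij_betw_def)
  have integrable: "integrable lborel (\<lambda>x. \<phi> p x * \<phi> q x)" for p q
  proof (rule Bochner_Integration.integrable_bound)
    have "square_integrable (\<phi> p)" for p using H1[of p] by (simp add: H1_def)
    then have m[measurable]: "\<phi> p \<in> borel_measurable borel" and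
      i: "integrable lborel (\<lambda>x. (\<phi> p x)\<^sup>2)" for p
      by (auto simp: square_integrable_def)
    show "integrable lborel (\<lambda>x. (\<phi> p x)\<^sup>2 + (\<phi> q x)\<^sup>2)" using i by simp
    show "(\<lambda>x. \<phi> p x * \<phi> q x) \<in> borel_measurable lborel" by measurable
    have "\<bar>a * b\<bar> \<le> a\<^sup>2 + b\<^sup>2" for a b :: real
    proof -
      have "2 * \<bar>a\<bar> * \<bar>b\<bar> \<le> a\<^sup>2 + b\<^sup>2"
        using sum_squares_bound[of "\<bar>a\<bar>" "\<bar>b\<bar>"] by simp
      moreover have "0 \<le> \<bar>a\<bar> * \<bar>b\<bar>" by simp
      ultimately show ?thesis unfolding abs_mult by linarith
    qed
    then show "AE x in lborel. norm (\<phi> p x * \<phi> q x) \<le> norm ((\<phi> p x)\<^sup>2 + (\<phi> q x)\<^sup>2)"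
      by simp
  qed
  have det: "slater \<phi> \<gamma> x = (\<Sum>p\<in>?P. of_int (sign p) * (\<Prod>j\<in>UNIV. \<phi> (entry \<gamma> (p j)) (x $ j))) / sqrt (fact CARD('n))"
    for \<gamma> and x :: "'n config"
    unfolding slater_def by (subst Determinants.det_transpose[symmetric]) (simp add: Determinants.det_def Finite_Cartesian_Product.transpose_def)
  have eq: "slater \<phi> \<alpha> x * slater \<phi> \<beta> x =
      (\<Sum>p\<in>?P. \<Sum>q\<in>?P. of_int (sign p) * of_int (sign q) *
         (\<Prod>j\<in>UNIV. \<phi> (ea (p j)) (x $ j) * \<phi> (eb (q j)) (x $ j))) / fact CARD('n)" for x :: "'n config"
  proof -
    have "(u / sqrt (fact CARD('n))) * (v / sqrt (fact CARD('n))) = (u * v) / fact CARD('n)"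
      for u v :: real
      by simp
    then show ?thesis
      unfolding det sum_product ea_def eb_def prod.distrib
      by (simp only: sum_product mult.assoc mult.left_commute)
  qed
  have int: "(LINT x|lborel. (\<Prod>j\<in>UNIV. \<phi> (ea (p j)) (x $ j) * \<phi> (eb (q j)) (x $ j))) =
      (\<Prod>j\<in>UNIV. if ea (p j) = eb (q j) then 1 else 0)" for p q
    using integral_vec_prod(1)[of "\<lambda>j y. \<phi> (ea (p j)) y * \<phi> (eb (q j)) y"] integrable on
    by (simp add: orthonormal_orbitals_def)
  have "(LINT x|lborel. slater \<phi> \<alpha> (x :: 'n config) * slater \<phi> \<beta> x) =
      (\<Sum>p\<in>?P. \<Sum>q\<in>?P. of_int (sign p) * of_int (sign q) *
         (\<Prod>j\<in>UNIV. if ea (p j) = eb (q j) then 1 else 0)) / fact CARD('n)"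
  proof -
    have ii: "integrable lborel (\<lambda>x::'n config. of_int (sign p) * of_int (sign q) *
        (\<Prod>j\<in>UNIV. \<phi> (ea (p j)) (x $ j) * \<phi> (eb (q j)) (x $ j)))" for p q
      by (intro integrable_mult_right integral_vec_prod(2)[where f = "\<lambda>j y. \<phi> (ea (p j)) y * \<phi> (eb (q j)) y"]
          integrable)
    have "(LINT x|lborel. slater \<phi> \<alpha> (x :: 'n config) * slater \<phi> \<beta> x) =
        (\<Sum>p\<in>?P. \<Sum>q\<in>?P. LINT x::'n config|lborel. of_int (sign p) * of_int (sign q) *
           (\<Prod>j\<in>UNIV. \<phi> (ea (p j)) (x $ j) * \<phi> (eb (q j)) (x $ j))) / fact CARD('n)"
      unfolding eq integral_divide_zero
      by (subst Bochner_Integration.integral_sum, intro Bochner_Integration.integrable_sum ii)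
         (intro arg_cong2[where f = "(/)"] sum.cong refl Bochner_Integration.integral_sum ii)
    then show ?thesis
      by (simp only: integral_mult_right_zero int)
  qed
  also have "(\<Sum>p\<in>?P. \<Sum>q\<in>?P. real_of_int (sign p) * of_int (sign q) *
         (\<Prod>j\<in>UNIV. if ea (p j) = eb (q j) then 1 else 0)) =
      (\<Sum>p\<in>?P. \<Sum>q\<in>?P. if \<alpha> = \<beta> \<and> p = q then 1 else 0)"
  proof (intro sum.cong refl)
    fix p q assume p: "p \<in> ?P" and q: "q \<in> ?P"
    show "real_of_int (sign p) * of_int (sign q) * (\<Prod>j\<in>UNIV. if ea (p j) = eb (q j) then 1 else 0) =
        (if \<alpha> = \<beta> \<and> p = q then 1 else 0)"
    proof (cases "\<forall>j. ea (p j) = eb (q j)")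
      case True
      have "range (ea \<circ> p) = \<alpha>" "range (eb \<circ> q) = \<beta>"
        using p q ea(2) eb(2) by (simp_all only: image_comp[symmetric] permutes_image mem_Collect_eq)
      moreover have "ea \<circ> p = eb \<circ> q" using True by auto
      ultimately have ab: "\<alpha> = \<beta>" by simp
      then have "ea = eb" by (simp add: ea_def eb_def)
      then have "p = q" using True ea(1) by (auto simp: inj_def)
      then show ?thesis using ab True by (simp flip: of_int_mult)
    next
      case False
      then have "\<not> (\<alpha> = \<beta> \<and> p = q)" by (auto simp: ea_def eb_def)
      moreover have "(\<Prod>j\<in>UNIV. if ea (p j) = eb (q j) then 1 else 0) = (0::real)"
        using False by (auto simp: prod_zero_iff)
      ultimately show ?thesis by (simp only: if_False mult_zero_right)
    qed
  qed
  also have "\<dots> = (if \<alpha> = \<beta> then fact CARD('n) else 0)"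
    by (simp add: card_permutations)
  finally show ?thesis by (simp split: if_splits)
qed


section \<open>Fock space over the span of the orbitals\<close>

text \<open>Occupation number representation: the unit vector \<open>axis \<alpha> 1\<close> of \<open>real^('k set)\<close> stands for
  the Slater determinant of the increasingly ordered orbitals in \<open>\<alpha>\<close>.  The \<open>N\<close>-particle space
  spanned by the Slater determinants is the span of the \<open>axis \<alpha> 1\<close> with \<open>card \<alpha> = N\<close>; by theorem
  \<open>slater_orthonormal\<close> below, the Euclidean inner product of \<open>real^('k set)\<close> is there
  the \<open>L\<^sup>2\<close> inner product.\<close>

type_synonym 'k fock = "real^('k set)"

definition create :: "'k::{finite,linorder} \<Rightarrow> 'k fock \<Rightarrow> 'k fock" where
  "create p \<psi> = (\<chi> S. if p \<in> S then (-1) ^ card {q\<in>S. q < p} * \<psi> $ (S - {p}) else 0)"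

definition annihilate :: "'k::{finite,linorder} \<Rightarrow> 'k fock \<Rightarrow> 'k fock" where
  "annihilate p \<psi> = (\<chi> S. if p \<notin> S then (-1) ^ card {q\<in>S. q < p} * \<psi> $ (insert p S) else 0)"

definition multiindices :: "nat \<Rightarrow> 'k::finite set set" where
  "multiindices N = {\<alpha>. card \<alpha> = N}"

text \<open>The first \<open>N\<close> orbitals; this is also the multiindex 0.\<close>

definition occupied :: "nat \<Rightarrow> 'k::{finite,linorder} set" where
  "occupied N = {p. card {q. q < p} < N}"

definition excitations :: "nat \<Rightarrow> 'k::{finite,linorder} set set" where
  "excitations N = multiindices N - {occupied N}"

definition excitation_rank :: "nat \<Rightarrow> 'k::{finite,linorder} set \<Rightarrow> nat" where
  "excitation_rank N \<alpha> = card (\<alpha> - occupied N)"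

definition excitation_op :: "nat \<Rightarrow> 'k::{finite,linorder} set \<Rightarrow> 'k fock \<Rightarrow> 'k fock" where
  "excitation_op N \<alpha> =
     foldr (\<lambda>(A, I) X. create A \<circ> annihilate I \<circ> X)
       (zip (sorted_list_of_set (\<alpha> - occupied N)) (sorted_list_of_set (occupied N - \<alpha>))) id"

definition ref_state :: "nat \<Rightarrow> 'k::{finite,linorder} fock" where
  "ref_state N = axis (occupied N) 1"

text \<open>The Slater determinant of \<open>\<alpha>\<close> with its sign fixed by the excitation operator.\<close>

definition excited_state :: "nat \<Rightarrow> 'k::{finite,linorder} set \<Rightarrow> 'k fock" where
  "excited_state N \<alpha> = excitation_op N \<alpha> (ref_state N)"

text \<open>The operator on the \<open>N\<close>-particle space with
  \<open>\<langle>H\<^sub>K \<Phi>, \<Psi>\<rangle> = \<langle>H \<Phi>, \<Psi>\<rangle>\<close>, given by the bilinear extension of its matrix elements between Slater determinants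
  (and 0 on the other particle numbers).\<close>

definition hamiltonian ::
  "'n::{finite,linorder} itself \<Rightarrow> ('k::{finite,linorder} \<Rightarrow> real^3 \<Rightarrow> real) \<Rightarrow>
   (real^3 \<Rightarrow> real) \<Rightarrow> (real^3 \<Rightarrow> real) \<Rightarrow> 'k fock \<Rightarrow> 'k fock" where
  "hamiltonian _ \<phi> V w \<psi> =
     (\<Sum>\<alpha>\<in>multiindices CARD('n). \<Sum>\<beta>\<in>multiindices CARD('n).
        (\<psi> $ \<alpha> * hamiltonian_form V w (slater \<phi> \<alpha> :: 'n config \<Rightarrow> real) (slater \<phi> \<beta>)) *\<^sub>R axis \<beta> 1)"


section \<open>Coupled-cluster objects\<close>

text \<open>Amplitudes are families indexed by excitation multiindices, extended by 0 to all sets.\<close>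

type_synonym 'k amps = "real^('k set)"

definition amp_space :: "'k::finite set set \<Rightarrow> 'k amps set" where
  "amp_space \<Xi> = {t. \<forall>\<alpha>. \<alpha> \<notin> \<Xi> \<longrightarrow> t $ \<alpha> = 0}"

definition amp_part :: "'k::finite set set \<Rightarrow> 'k amps \<Rightarrow> 'k amps" where
  "amp_part \<Xi> t = (\<chi> \<alpha>. if \<alpha> \<in> \<Xi> then t $ \<alpha> else 0)"

definition rank_regular :: "nat \<Rightarrow> 'k::{finite,linorder} set set \<Rightarrow> bool" where
  "rank_regular N \<Xi> \<longleftrightarrow>
     (\<forall>\<beta>\<in>\<Xi>. \<forall>\<gamma>\<in>\<Xi>. \<forall>\<alpha>\<in>excitations N - \<Xi>.
        excitation_op N \<alpha> (excited_state N \<beta>) \<bullet> excited_state N \<gamma> = 0)"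

definition low_rank :: "nat \<Rightarrow> 'k::{finite,linorder} set set \<Rightarrow> nat \<Rightarrow> 'k set set" where
  "low_rank N \<Xi> \<rho> = {\<alpha>\<in>\<Xi>. excitation_rank N \<alpha> \<le> \<rho>}"

definition high_rank :: "nat \<Rightarrow> 'k::{finite,linorder} set set \<Rightarrow> nat \<Rightarrow> 'k set set" where
  "high_rank N \<Xi> \<rho> = {\<alpha>\<in>\<Xi>. excitation_rank N \<alpha> > \<rho>}"

definition cluster_op :: "nat \<Rightarrow> 'k::{finite,linorder} amps \<Rightarrow> 'k fock \<Rightarrow> 'k fock" where
  "cluster_op N t \<psi> = (\<Sum>\<alpha>\<in>excitations N. (t $ \<alpha>) *\<^sub>R excitation_op N \<alpha> \<psi>)"

definition cluster_states :: "nat \<Rightarrow> 'k::{finite,linorder} set set \<Rightarrow> 'k fock set" where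
  "cluster_states N \<Xi> = {cluster_op N t (ref_state N) | t. t \<in> amp_space \<Xi>}"

definition exp_op :: "('a::real_normed_vector \<Rightarrow> 'a) \<Rightarrow> 'a \<Rightarrow> 'a" where
  "exp_op T \<psi> = suminf (\<lambda>k. (T ^^ k) \<psi> /\<^sub>R fact k)"

text \<open>In the following, \<open>H\<close> is the Hamiltonian operator on the Fock space.\<close>

definition similarity :: "nat \<Rightarrow> ('k fock \<Rightarrow> 'k fock) \<Rightarrow> 'k::{finite,linorder} amps \<Rightarrow> 'k fock \<Rightarrow> 'k fock" where
  "similarity N H t = exp_op (\<lambda>\<psi>. - cluster_op N t \<psi>) \<circ> H \<circ> exp_op (cluster_op N t)"

definition cc_energy :: "nat \<Rightarrow> ('k fock \<Rightarrow> 'k fock) \<Rightarrow> 'k::{finite,linorder} amps \<Rightarrow> real" where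
  "cc_energy N H t = similarity N H t (ref_state N) \<bullet> ref_state N"

definition similarity_hat ::
  "nat \<Rightarrow> ('k fock \<Rightarrow> 'k fock) \<Rightarrow> 'k::{finite,linorder} set set \<Rightarrow> nat \<Rightarrow> 'k amps \<Rightarrow> 'k fock \<Rightarrow> 'k fock" where
  "similarity_hat N H \<Xi> \<rho> t \<psi> =
     similarity N H t \<psi> -
     (\<Sum>\<alpha>\<in>low_rank N \<Xi> \<rho>.
        (similarity N H t (ref_state N) \<bullet> excited_state N \<alpha>) *\<^sub>R excitation_op N \<alpha> \<psi>)"

text \<open>\<open>kp_homotopy N H \<Xi> \<rho> t l\<close> is the functional \<open>K\<^sub>K\<^sub>P(t, l)\<close> on the amplitude space.\<close>

definition kp_homotopy ::
  "nat \<Rightarrow> ('k fock \<Rightarrow> 'k fock) \<Rightarrow> 'k::{finite,linorder} set set \<Rightarrow> nat \<Rightarrow> 'k amps \<Rightarrow> real \<Rightarrow> 'k amps \<Rightarrow> real" where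
  "kp_homotopy N H \<Xi> \<rho> t l s =
     (let t0 = amp_part (low_rank N \<Xi> \<rho>) t; t' = amp_part (high_rank N \<Xi> \<rho>) t;
          s0 = amp_part (low_rank N \<Xi> \<rho>) s; s' = amp_part (high_rank N \<Xi> \<rho>) s;
          \<Phi>0 = ref_state N
      in similarity N H t0 \<Phi>0 \<bullet> cluster_op N s0 \<Phi>0
       + similarity N H t \<Phi>0 \<bullet> cluster_op N s' \<Phi>0
       + l * (similarity N H t0 (exp_op (cluster_op N t') \<Phi>0 - \<Phi>0) \<bullet> cluster_op N s0 \<Phi>0))"


section \<open>Compressions, spectra, eigenvalues\<close>

definition compression :: "'a::euclidean_space set \<Rightarrow> ('a \<Rightarrow> 'a) \<Rightarrow> 'a \<Rightarrow> 'a" where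
  "compression W A \<psi> = (THE \<psi>'. \<psi>' \<in> W \<and> (\<forall>\<omega>\<in>W. \<psi>' \<bullet> \<omega> = A \<psi> \<bullet> \<omega>))"

definition onb_list :: "'a::euclidean_space set \<Rightarrow> 'a list" where
  "onb_list W = (SOME bs. distinct bs \<and> span (set bs) = W \<and>
     (\<forall>b\<in>set bs. \<forall>b'\<in>set bs. b \<bullet> b' = (if b = b' then 1 else 0)))"

text \<open>The matrix of a linear operator \<open>A\<close> on the subspace \<open>W\<close>, with complex entries; spectrum and
  characteristic polynomial do not depend on the chosen basis.\<close>

definition operator_matrix :: "'a::euclidean_space set \<Rightarrow> ('a \<Rightarrow> 'a) \<Rightarrow> complex Matrix.mat" where
  "operator_matrix W A = (let bs = onb_list W in
     Matrix.mat (length bs) (length bs) (\<lambda>(i, j). complex_of_real (A (bs ! j) \<bullet> bs ! i)))"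

definition op_spectrum :: "'a::euclidean_space set \<Rightarrow> ('a \<Rightarrow> 'a) \<Rightarrow> complex set" where
  "op_spectrum W A = spectrum (operator_matrix W A)"

text \<open>Eigenvalues with algebraic multiplicity.\<close>

definition op_eigenvalues :: "'a::euclidean_space set \<Rightarrow> ('a \<Rightarrow> 'a) \<Rightarrow> complex multiset" where
  "op_eigenvalues W A = proots (char_poly (operator_matrix W A))"

definition eigenvalues_below :: "'a::euclidean_space set \<Rightarrow> ('a \<Rightarrow> 'a) \<Rightarrow> real \<Rightarrow> nat" where
  "eigenvalues_below W A E = size {# z \<in># op_eigenvalues W A. z \<in> \<real> \<and> Re z < E #}"


section \<open>Non-degenerate zeros and the topological index\<close>

text \<open>A map from the amplitude space of \<open>\<Xi>\<close> to its dual is written in coordinates with respect to the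
  basis \<open>axis \<alpha> 1\<close> (\<open>\<alpha> \<in> \<Xi>\<close>) and its dual basis.\<close>

definition dual_coords :: "'k::finite set set \<Rightarrow> ('k amps \<Rightarrow> real) \<Rightarrow> 'k amps" where
  "dual_coords \<Xi> f = (\<chi> \<alpha>. if \<alpha> \<in> \<Xi> then f (axis \<alpha> 1) else 0)"

definition is_zero_on :: "'k::finite set set \<Rightarrow> ('k amps \<Rightarrow> 'k amps \<Rightarrow> real) \<Rightarrow> 'k amps \<Rightarrow> bool" where
  "is_zero_on \<Xi> F u \<longleftrightarrow> u \<in> amp_space \<Xi> \<and> (\<forall>s\<in>amp_space \<Xi>. F u s = 0)"

definition nondegenerate :: "'k::finite set set \<Rightarrow> ('k amps \<Rightarrow> 'k amps \<Rightarrow> real) \<Rightarrow> 'k amps \<Rightarrow> bool" where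
  "nondegenerate \<Xi> F u \<longleftrightarrow>
     (\<exists>D. ((\<lambda>t. dual_coords \<Xi> (F t)) has_derivative D) (at u within amp_space \<Xi>) \<and>
          bij_betw D (amp_space \<Xi>) (amp_space \<Xi>))"

definition isolated_zero :: "'k::finite set set \<Rightarrow> ('k amps \<Rightarrow> 'k amps \<Rightarrow> real) \<Rightarrow> 'k amps \<Rightarrow> bool" where
  "isolated_zero \<Xi> F u \<longleftrightarrow> is_zero_on \<Xi> F u \<and>
     (\<exists>R>0. \<forall>x\<in>amp_space \<Xi>. 0 < dist x u \<and> dist x u < R \<longrightarrow> \<not> is_zero_on \<Xi> F x)"

text \<open>The Brouwer degree \<open>deg(F, B(u,r), 0)\<close>, for \<open>F\<close> without zeros on the boundary of the ball: with
  \<open>n = card \<Xi>\<close>, it is the degree of the self-map \<open>x \<mapsto> F(u + r x) / \<parallel>F(u + r x)\<parallel>\<close> of the sphere of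
  dimension \<open>n - 1\<close>.  The same enumeration \<open>e\<close> of \<open>\<Xi>\<close> is used for the basis and for the dual basis,
  so the orientations are compatible and the degree does not depend on \<open>e\<close>.  For \<open>n = 0\<close> the
  ball is the single point \<open>u\<close>.\<close>

definition ball_degree ::
  "'k::finite set set \<Rightarrow> ('k amps \<Rightarrow> 'k amps \<Rightarrow> real) \<Rightarrow> 'k amps \<Rightarrow> real \<Rightarrow> int" where
  "ball_degree \<Xi> F u r =
     (if \<Xi> = {} then (if is_zero_on \<Xi> F u then 1 else 0)
      else
        let n = card \<Xi>;
            e = (SOME e. bij_betw e {..<n} \<Xi>);
            g = (\<lambda>x::nat \<Rightarrow> real. dual_coords \<Xi> (F (u + r *\<^sub>R (\<Sum>i<n. x i *\<^sub>R axis (e i) 1))))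
        in Brouwer_degree2 (n - 1) (\<lambda>x i. if i < n then g x $ e i / norm (g x) else 0))"

definition topological_index ::
  "'k::finite set set \<Rightarrow> ('k amps \<Rightarrow> 'k amps \<Rightarrow> real) \<Rightarrow> 'k amps \<Rightarrow> int" where
  "topological_index \<Xi> F u = (THE d. \<forall>\<^sub>F r in at_right 0. ball_degree \<Xi> F u r = d)"

end

theory Submission
  imports Defs
begin

text \<open>
  At \<open>\<lambda> = 0\<close> the low-rank equations contain only the low-rank amplitudes, so the derivative of
  the homotopy at a zero is block triangular and its determinant is the product of the determinants
  of two diagonal blocks.  Everything rests on identifying these blocks.

  Differentiating \<open>e\<^sup>-\<^sup>T H e\<^sup>T \<Phi>\<^sub>0\<close> in the direction \<open>U\<close> gives the commutator
  \<open>[H(t), U] \<Phi>\<^sub>0\<close>, since cluster operators commute.  The term \<open>H(t) U \<Phi>\<^sub>0\<close> is an operator applied to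
  a vector of the cluster space.  In the other term, \<open>G = H(t) \<Phi>\<^sub>0\<close> is expanded in Slater determinants
  and \<open>U X\<^sub>\<beta> \<Phi>\<^sub>0 = X\<^sub>\<beta> U \<Phi>\<^sub>0\<close> is used (\<open>cluster_op_inner_excited_state\<close>): the component along
  \<open>\<Phi>\<^sub>0\<close> contributes the energy times \<open>U \<Phi>\<^sub>0\<close>, the components outside the truncation drop out by rank
  regularity, and the components along retained determinants vanish because \<open>t\<close> is a zero, or do not
  matter because they raise the rank above \<open>\<rho>\<close>.  The only survivors are the low-rank components in
  the high-rank block, and these are exactly the correction in the definition of the
  operator \<open>similarity_hat\<close>.  So the blocks are compressions of
  operators minus the corresponding energy (\<open>det_kp0_derivative\<close>), they are
  invertible iff the energies avoid the spectra, and the sign of the determinant of \<open>A - E\<close> is the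
  parity of the number of real eigenvalues below \<open>E\<close>, because real eigenvalues above \<open>E\<close> and pairs of
  conjugate eigenvalues contribute positive factors (\<open>sgn_monic_poly_roots_below\<close>).

  It remains to see that the index of a zero with invertible derivative is the sign of the Jacobian
  determinant.  On a small sphere the map is homotopic to its linearization
  (\<open>ball_degree_eventually\<close>), and the degree of an invertible linear map of the sphere is the sign of
  its determinant (\<open>linear_degree_eq_sgn_det\<close>): both are multiplicative, and every invertible matrix is
  a product of matrices which differ from the identity in one column, for which an explicit
  deformation leads to the identity or to a reflection.
\<close>

section \<open>The degree of an invertible linear map of the sphere\<close>

text \<open>The radial projection onto the sphere of dimension \<open>p\<close>; the coordinates beyond \<open>p\<close>
  are set to 0, as membership in that sphere demands.\<close>

definition sphere_normalize :: "nat \<Rightarrow> (nat \<Rightarrow> real) \<Rightarrow> nat \<Rightarrow> real" where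
  "sphere_normalize p v = (\<lambda>i. if i \<le> p then v i / sqrt (\<Sum>j\<le>p. (v j)\<^sup>2) else 0)"

lemma topspace_nsphere_iff:
  "x \<in> topspace (nsphere p) \<longleftrightarrow> (\<Sum>i\<le>p. (x i)\<^sup>2) = 1 \<and> (\<forall>i>p. x i = 0)"
  by (auto simp: nsphere)

text \<open>A deformation through nowhere vanishing maps survives radial projection, so that degrees can be
  compared by writing down unnormalized homotopies.\<close>

lemma sphere_normalize_homotopic:
  fixes G :: "real \<Rightarrow> (nat \<Rightarrow> real) \<Rightarrow> nat \<Rightarrow> real"
  assumes cont: "\<And>i. i \<le> p \<Longrightarrow>
      continuous_map (prod_topology (top_of_set {0..1}) (nsphere p)) euclideanreal (\<lambda>(s, x). G s x i)"
    and nonzero: "\<And>s x. s \<in> {0..1} \<Longrightarrow> x \<in> topspace (nsphere p) \<Longrightarrow> \<exists>i\<le>p. G s x i \<noteq> 0"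
  shows "homotopic_with (\<lambda>_. True) (nsphere p) (nsphere p)
    (\<lambda>x. sphere_normalize p (G 0 x)) (\<lambda>x. sphere_normalize p (G 1 x))"
proof -
  let ?X = "prod_topology (top_of_set {0..1::real}) (nsphere p)"
  let ?h = "\<lambda>(s, x). sphere_normalize p (G s x)"
  have pos: "(\<Sum>j\<le>p. (G s x j)\<^sup>2) > 0" if "s \<in> {0..1}" "x \<in> topspace (nsphere p)" for s x
  proof -
    obtain i where "i \<le> p" "G s x i \<noteq> 0" using nonzero[OF \<open>s \<in> {0..1}\<close> \<open>x \<in> topspace (nsphere p)\<close>] by blast
    then show ?thesis by (intro sum_pos2[of _ i]) auto
  qed
  have "continuous_map ?X (nsphere p) ?h"
    unfolding nsphere continuous_map_in_subtopology
  proof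
    have "continuous_map ?X euclideanreal (\<lambda>z. ?h z i)" for i
    proof (cases "i \<le> p")
      case True
      have sum: "continuous_map ?X euclideanreal (\<lambda>z. \<Sum>j\<le>p. (G (fst z) (snd z) j)\<^sup>2)"
        using cont by (intro continuous_map_sum continuous_map_real_pow) (auto simp: case_prod_beta')
      have "continuous_map euclideanreal euclideanreal sqrt"
        by (auto intro: continuous_on_real_sqrt)
      from continuous_map_compose[OF sum this]
      have sq: "continuous_map ?X euclideanreal (\<lambda>z. sqrt (\<Sum>j\<le>p. (G (fst z) (snd z) j)\<^sup>2))"
        by (simp add: o_def)
      have "continuous_map ?X euclideanreal (\<lambda>z. G (fst z) (snd z) i / sqrt (\<Sum>j\<le>p. (G (fst z) (snd z) j)\<^sup>2))"
      proof (rule continuous_map_real_divide[OF _ sq])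
        fix z assume "z \<in> topspace ?X"
        then have "(\<Sum>j\<le>p. (G (fst z) (snd z) j)\<^sup>2) > 0" by (intro pos) auto
        then show "sqrt (\<Sum>j\<le>p. (G (fst z) (snd z) j)\<^sup>2) \<noteq> 0" by simp
      qed (use cont[OF True] in \<open>simp add: case_prod_beta'\<close>)
      then show ?thesis
        using True by (simp add: sphere_normalize_def case_prod_beta')
    qed (simp add: sphere_normalize_def case_prod_beta')
    then show "continuous_map (prod_topology (top_of_set {0..1}) (subtopology (powertop_real UNIV)
            {x. (\<Sum>i\<le>p. (x i)\<^sup>2) = 1 \<and> (\<forall>i>p. x i = 0)})) (powertop_real UNIV) ?h"
      by (simp add: continuous_map_componentwise_UNIV nsphere)
    have "(\<Sum>i\<le>p. (sphere_normalize p (G s x) i)\<^sup>2) = 1"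
      if "s \<in> {0..1}" "x \<in> topspace (nsphere p)" for s x
      using pos[OF that] by (simp add: sphere_normalize_def power_divide flip: sum_divide_distrib)
    then show "?h \<in> topspace (prod_topology (top_of_set {0..1}) (subtopology (powertop_real UNIV)
            {x. (\<Sum>i\<le>p. (x i)\<^sup>2) = 1 \<and> (\<forall>i>p. x i = 0)})) \<rightarrow>
       {x. (\<Sum>i\<le>p. (x i)\<^sup>2) = 1 \<and> (\<forall>i>p. x i = 0)}"
      unfolding nsphere[symmetric] by (auto simp: sphere_normalize_def)
  qed
  then show ?thesis
    unfolding homotopic_with_def by (intro exI[of _ ?h]) auto
qed

text \<open>Vectors are functions on the natural numbers, the points of the topological spheres to which the
  Brouwer degree applies.\<close>

definition matrix_map :: "real mat \<Rightarrow> (nat \<Rightarrow> real) \<Rightarrow> nat \<Rightarrow> real" where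
  "matrix_map M x = (\<lambda>i. \<Sum>j<dim_col M. M $$ (i, j) * x j)"

definition linear_degree :: "nat \<Rightarrow> real mat \<Rightarrow> int" where
  "linear_degree p M = Brouwer_degree2 p (\<lambda>x. sphere_normalize p (matrix_map M x))"

lemma matrix_map_nonzero:
  assumes M: "M \<in> carrier_mat (Suc p) (Suc p)" and det: "det M \<noteq> 0"
    and x: "x \<in> topspace (nsphere p)"
  shows "\<exists>i\<le>p. matrix_map M x i \<noteq> 0"
proof (rule ccontr)
  assume "\<not> ?thesis"
  then have zero: "matrix_map M x i = 0" if "i \<le> p" for i using that by auto
  let ?v = "vec (Suc p) x"
  have "M *\<^sub>v ?v = 0\<^sub>v (Suc p)"
  proof (rule eq_vecI)
    fix i assume "i < dim_vec (0\<^sub>v (Suc p) :: real Matrix.vec)"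
    then show "vec_index (M *\<^sub>v ?v) i = vec_index (0\<^sub>v (Suc p)) i"
      using zero[of i] M by (simp add: matrix_map_def scalar_prod_def lessThan_atLeast0)
  qed (use M in auto)
  moreover have "?v \<noteq> 0\<^sub>v (Suc p)"
  proof
    assume "?v = 0\<^sub>v (Suc p)"
    then have "x i = 0" if "i \<le> p" for i
      using that by (metis index_vec index_zero_vec(1) less_Suc_eq_le)
    then show False using x by (simp add: topspace_nsphere_iff)
  qed
  ultimately show False
    using det det_0_iff_vec_prod_zero[OF M] by (metis vec_carrier)
qed

lemma linear_degree_homotopy:
  fixes M :: "real \<Rightarrow> real mat"
  assumes M: "\<And>s. M s \<in> carrier_mat (Suc p) (Suc p)"
    and cont: "\<And>i j. i \<le> p \<Longrightarrow> j \<le> p \<Longrightarrow> continuous_on {0..1} (\<lambda>s. M s $$ (i, j))"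
    and det: "\<And>s. s \<in> {0..1} \<Longrightarrow> det (M s) \<noteq> 0"
  shows "linear_degree p (M 0) = linear_degree p (M 1)"
  unfolding linear_degree_def
proof (rule Brouwer_degree2_homotopic, rule sphere_normalize_homotopic)
  let ?X = "prod_topology (top_of_set {0..1::real}) (nsphere p)"
  fix i assume i: "i \<le> p"
  have "continuous_map ?X euclideanreal (\<lambda>z. M (fst z) $$ (i, j) * snd z j)" if "j \<le> p" for j
  proof (rule continuous_map_real_mult)
    have "continuous_map (top_of_set {0..1}) euclideanreal (\<lambda>s. M s $$ (i, j))"
      using cont[OF i that] by simp
    from continuous_map_compose[OF continuous_map_fst this]
    show "continuous_map ?X euclideanreal (\<lambda>z. M (fst z) $$ (i, j))" by (simp add: o_def)
    from continuous_map_compose[OF continuous_map_snd continuous_map_nsphere_projection]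
    show "continuous_map ?X euclideanreal (\<lambda>z. snd z j)" by (simp add: o_def)
  qed
  then have "continuous_map ?X euclideanreal (\<lambda>z. \<Sum>j<Suc p. M (fst z) $$ (i, j) * snd z j)"
    by (intro continuous_map_sum) auto
  then show "continuous_map ?X euclideanreal (\<lambda>(s, x). matrix_map (M s) x i)"
    using M[THEN carrier_matD(2)] by (simp add: matrix_map_def case_prod_beta' del: sum.lessThan_Suc)
next
  fix s :: real and x assume "s \<in> {0..1}" "x \<in> topspace (nsphere p)"
  then show "\<exists>i\<le>p. matrix_map (M s) x i \<noteq> 0" by (intro matrix_map_nonzero M det)
qed

lemma continuous_map_normalized_matrix:
  assumes M: "M \<in> carrier_mat (Suc p) (Suc p)" and det: "det M \<noteq> 0"
  shows "continuous_map (nsphere p) (nsphere p) (\<lambda>x. sphere_normalize p (matrix_map M x))"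
proof -
  have "homotopic_with (\<lambda>_. True) (nsphere p) (nsphere p)
     (\<lambda>x. sphere_normalize p (matrix_map M x)) (\<lambda>x. sphere_normalize p (matrix_map M x))"
  proof (rule sphere_normalize_homotopic)
    fix i assume "i \<le> p"
    show "continuous_map (prod_topology (top_of_set {0..1::real}) (nsphere p)) euclideanreal
        (\<lambda>(s, x). matrix_map M x i)"
      unfolding matrix_map_def case_prod_beta'
    proof (intro continuous_map_sum continuous_map_real_mult_left)
      fix j
      from continuous_map_compose[OF continuous_map_snd continuous_map_nsphere_projection]
      show "continuous_map (prod_topology (top_of_set {0..1::real}) (nsphere p)) euclideanreal (\<lambda>z. snd z j)"
        by (simp add: o_def)
    qed simp
  qed (rule matrix_map_nonzero[OF M det])
  then show ?thesis
    using homotopic_with_imp_continuous_maps by blast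
qed

lemma sphere_normalize_cong:
  "(\<And>i. i \<le> p \<Longrightarrow> v i = w i) \<Longrightarrow> sphere_normalize p v = sphere_normalize p w"
  unfolding sphere_normalize_def
  by (intro ext if_cong refl arg_cong2[where f = "(/)"] arg_cong[where f = sqrt] sum.cong) auto

lemma sphere_normalize_scale:
  assumes "c > 0"
  shows "sphere_normalize p (\<lambda>i. v i / c) = sphere_normalize p v"
proof -
  have "sqrt (\<Sum>j\<le>p. (v j / c)\<^sup>2) = sqrt (\<Sum>j\<le>p. (v j)\<^sup>2) / c"
    using assms by (simp add: power_divide real_sqrt_divide flip: sum_divide_distrib)
  then show ?thesis using assms by (simp add: sphere_normalize_def fun_eq_iff)
qed

text \<open>Radial projection between two linear maps only rescales the intermediate vector by a positive
  factor, which the final projection forgets; hence the projected maps compose like the matrices.\<close>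

lemma linear_degree_mult:
  assumes A: "A \<in> carrier_mat (Suc p) (Suc p)" and B: "B \<in> carrier_mat (Suc p) (Suc p)"
    and dets: "det A \<noteq> 0" "det B \<noteq> 0"
  shows "linear_degree p (A * B) = linear_degree p A * linear_degree p B"
proof -
  have "sphere_normalize p (matrix_map (A * B) x) =
      sphere_normalize p (matrix_map A (sphere_normalize p (matrix_map B x)))"
    if x: "x \<in> topspace (nsphere p)" for x
  proof -
    define c where "c = sqrt (\<Sum>j\<le>p. (matrix_map B x j)\<^sup>2)"
    obtain i where "i \<le> p" "matrix_map B x i \<noteq> 0" using matrix_map_nonzero[OF B dets(2) x] by blast
    then have "c > 0" unfolding c_def by (intro real_sqrt_gt_zero sum_pos2[of _ i]) auto
    have "matrix_map A (sphere_normalize p (matrix_map B x)) i = matrix_map (A * B) x i / c"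
      if i: "i \<le> p" for i
    proof -
      have "matrix_map A (sphere_normalize p (matrix_map B x)) i
        = (\<Sum>j\<le>p. A $$ (i, j) * (\<Sum>k\<le>p. B $$ (j, k) * x k)) / c"
        unfolding sum_divide_distrib using A B
        by (auto simp: matrix_map_def sphere_normalize_def c_def lessThan_Suc_atMost intro!: sum.cong)
      also have "(\<Sum>j\<le>p. A $$ (i, j) * (\<Sum>k\<le>p. B $$ (j, k) * x k)) =
          (\<Sum>k\<le>p. \<Sum>j\<le>p. A $$ (i, j) * (B $$ (j, k) * x k))"
        by (subst sum.swap) (simp add: sum_distrib_left)
      also have "\<dots> = (\<Sum>k\<le>p. (A * B) $$ (i, k) * x k)"
        using A B i by (intro sum.cong refl)
          (simp add: scalar_prod_def sum_distrib_right mult.assoc atLeast0LessThan lessThan_Suc_atMost del: sum.lessThan_Suc)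
      finally show ?thesis
        using B by (simp add: matrix_map_def lessThan_Suc_atMost)
    qed
    then have "sphere_normalize p (matrix_map A (sphere_normalize p (matrix_map B x))) =
        sphere_normalize p (\<lambda>i. matrix_map (A * B) x i / c)"
      by (rule sphere_normalize_cong)
    then show ?thesis using sphere_normalize_scale[OF \<open>c > 0\<close>] by simp
  qed
  then have "linear_degree p (A * B) = Brouwer_degree2 p
      ((\<lambda>x. sphere_normalize p (matrix_map A x)) \<circ> (\<lambda>x. sphere_normalize p (matrix_map B x)))"
    unfolding linear_degree_def by (intro Brouwer_degree2_eq) simp
  also have "\<dots> = linear_degree p A * linear_degree p B"
    unfolding linear_degree_def
    by (intro Brouwer_degree2_compose continuous_map_normalized_matrix A B dets)
  finally show ?thesis .
qed

lemma linear_degree_one: "linear_degree p (1\<^sub>m (Suc p)) = 1"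
proof -
  have "sphere_normalize p (matrix_map (1\<^sub>m (Suc p)) x) = id x" if "x \<in> topspace (nsphere p)" for x
  proof -
    have m: "matrix_map (1\<^sub>m (Suc p)) x i = x i" if "i \<le> p" for i
    proof -
      have "matrix_map (1\<^sub>m (Suc p)) x i = (\<Sum>j<Suc p. if j = i then x i else 0)"
        unfolding matrix_map_def by (rule sum.cong) (use that in auto)
      then show ?thesis using that by (simp del: sum.lessThan_Suc)
    qed
    then show ?thesis using that
      by (auto simp: sphere_normalize_def topspace_nsphere_iff m)
  qed
  then have "linear_degree p (1\<^sub>m (Suc p)) = Brouwer_degree2 p id"
    unfolding linear_degree_def by (rule Brouwer_degree2_eq)
  then show ?thesis by simp
qed

text \<open>The identity matrix with column \<open>k\<close> replaced by \<open>c\<close>.  One such matrix clears a whole column in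
  Gaussian elimination, and it can be deformed explicitly.\<close>

definition col_replace :: "nat \<Rightarrow> nat \<Rightarrow> (nat \<Rightarrow> 'a::comm_ring_1) \<Rightarrow> 'a mat" where
  "col_replace n k c = mat n n (\<lambda>(i, j). if j = k then c i else if i = j then 1 else 0)"

lemma col_replace_carrier [simp]: "col_replace n k c \<in> carrier_mat n n"
  by (simp add: col_replace_def)

lemma det_col_replace:
  assumes k: "k < n"
  shows "det (col_replace n k c) = c k"
proof -
  let ?C = "col_replace n k c"
  have "det ?C = (\<Sum>j<n. ?C $$ (k, j) * cofactor ?C k j)"
    by (rule laplace_expansion_row) (use k in auto)
  also have "\<dots> = (\<Sum>j<n. if j = k then c k * cofactor ?C k k else 0)"
    by (rule sum.cong) (use k in \<open>auto simp: col_replace_def\<close>)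
  also have "\<dots> = c k * cofactor ?C k k" using k by simp
  also have "mat_delete ?C k k = 1\<^sub>m (n - 1)"
    by (rule eq_matI) (use k in \<open>auto simp: mat_delete_def col_replace_def\<close>)
  then have "cofactor ?C k k = 1" by (simp add: cofactor_def)
  finally show ?thesis by simp
qed

text \<open>Gaussian elimination as an induction principle.  The columns are turned into unit vectors from left
  to right: with a nonzero pivot in place, the matrix factors as a column replacement times a
  matrix with one more unit column; a vanishing pivot is first repaired by adding a lower row, which
  is again a column replacement.\<close>

lemma invertible_matrix_induct [consumes 2, case_names mult one col_replace]:
  fixes A :: "'a::field mat"
  assumes A: "A \<in> carrier_mat n n" and detA: "det A \<noteq> 0"
    and mult: "\<And>A B. A \<in> carrier_mat n n \<Longrightarrow> B \<in> carrier_mat n n \<Longrightarrow> det A \<noteq> 0 \<Longrightarrow> det B \<noteq> 0 \<Longrightarrow>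
        P A \<Longrightarrow> P B \<Longrightarrow> P (A * B)"
    and one: "P (1\<^sub>m n)"
    and col_replace: "\<And>k c. k < n \<Longrightarrow> c k \<noteq> 0 \<Longrightarrow> P (col_replace n k c)"
  shows "P A"
proof -
  define unit_cols where "unit_cols m A \<longleftrightarrow>
     (\<forall>i<n. \<forall>j<m. A $$ (i, j) = (if i = j then 1 else 0))" for m and A :: "'a mat"
  have "\<forall>A\<in>carrier_mat n n. det A \<noteq> 0 \<longrightarrow> unit_cols m A \<longrightarrow> P A" if "m \<le> n" for m
    using that
  proof (induction rule: inc_induct)
    case base
    have "A = 1\<^sub>m n" if "A \<in> carrier_mat n n" "unit_cols n A" for A
      by (rule eq_matI) (use that in \<open>auto simp: unit_cols_def\<close>)
    then show ?case using one by auto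
  next
    case (step m)
    have mn: "m < n" using step.hyps by simp
    \<comment> \<open>the case of a nonzero pivot, to which the other one is reduced below\<close>
    have pivot: "P A" if A: "A \<in> carrier_mat n n" and det: "det A \<noteq> 0" and u: "unit_cols m A"
      and a: "A $$ (m, m) \<noteq> 0" for A
    proof -
      define C where "C = col_replace n m (\<lambda>i. A $$ (i, m))"
      define B where "B = mat n n (\<lambda>(i, j). if i = m then A $$ (m, j) / A $$ (m, m)
         else A $$ (i, j) - A $$ (i, m) * (A $$ (m, j) / A $$ (m, m)))"
      have B: "B \<in> carrier_mat n n" and C: "C \<in> carrier_mat n n" by (simp_all add: B_def C_def)
      have "A = C * B"
      proof (rule eq_matI)
        fix i j assume "i < dim_row (C * B)" "j < dim_col (C * B)"
        then have ij: "i < n" "j < n" by (auto simp: C_def B_def col_replace_def)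
        have "(C * B) $$ (i, j) = (\<Sum>l<n. C $$ (i, l) * B $$ (l, j))"
          using ij by (simp add: C_def B_def col_replace_def scalar_prod_def atLeast0LessThan)
        also have "\<dots> = (\<Sum>l<n. (if l = m then A $$ (i, m) * B $$ (m, j) else 0) +
             (if l = i then (if i = m then 0 else B $$ (i, j)) else 0))"
          by (rule sum.cong) (use ij mn in \<open>auto simp: C_def col_replace_def simp del: index_mult_mat\<close>)
        also have "\<dots> = A $$ (i, m) * B $$ (m, j) + (if i = m then 0 else B $$ (i, j))"
          using ij step.hyps by (simp add: sum.distrib)
        also have "\<dots> = A $$ (i, j)" using ij step.hyps a by (simp add: B_def)
        finally show "A $$ (i, j) = (C * B) $$ (i, j)" by simp
      qed (use A in \<open>auto simp: C_def B_def col_replace_def\<close>)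
      moreover have "det C \<noteq> 0" using a step.hyps by (simp add: C_def det_col_replace)
      moreover have "det B \<noteq> 0"
        using det det_mult[OF C B] \<open>A = C * B\<close> by (metis mult_zero_right)
      moreover have "unit_cols (Suc m) B"
        using u a step.hyps by (auto simp: unit_cols_def B_def less_Suc_eq)
      then have "P B" using step.IH B \<open>det B \<noteq> 0\<close> by blast
      moreover have "P C" unfolding C_def by (rule col_replace) (use a step.hyps in auto)
      ultimately show ?thesis using mult[OF C B] by metis
    qed
    show ?case
    proof (intro ballI impI)
      fix A assume A: "A \<in> carrier_mat n n" and det: "det A \<noteq> 0" and u: "unit_cols m A"
      show "P A"
      proof (cases "A $$ (m, m) = 0")
        case False
        then show ?thesis by (rule pivot[OF A det u])
      next
        case zero: True
        have "\<exists>i. m < i \<and> i < n \<and> A $$ (i, m) \<noteq> 0"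
        proof (rule ccontr)
          assume "\<not> ?thesis"
          then have low: "A $$ (i, m) = 0" if "m \<le> i" "i < n" for i
            using that zero by (cases "i = m") auto
          \<comment> \<open>otherwise column \<open>m\<close> is a combination of the columns before it\<close>
          define v where "v = vec n (\<lambda>j. if j < m then A $$ (j, m) else if j = m then -1 else 0)"
          have "A *\<^sub>v v = 0\<^sub>v n"
          proof (rule eq_vecI)
            fix i assume "i < dim_vec (0\<^sub>v n :: 'a Matrix.vec)"
            then have i: "i < n" by simp
            have "vec_index (A *\<^sub>v v) i = (\<Sum>j<n. A $$ (i, j) * vec_index v j)"
              using i A by (simp add: scalar_prod_def v_def atLeast0LessThan)
            also have "\<dots> = (\<Sum>j<n. (if j = i then (if i < m then A $$ (i, m) else 0) else 0) +
                (if j = m then - A $$ (i, m) else 0))"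
              by (rule sum.cong) (use i u in \<open>auto simp: v_def unit_cols_def\<close>)
            also have "\<dots> = (if i < m then A $$ (i, m) else 0) - A $$ (i, m)"
              using i step.hyps by (simp add: sum.distrib)
            also have "\<dots> = 0" using low[of i] i by auto
            finally show "vec_index (A *\<^sub>v v) i = vec_index (0\<^sub>v n) i" using i by simp
          qed (use A in auto)
          moreover have "v \<noteq> 0\<^sub>v n"
          proof
            assume "v = 0\<^sub>v n"
            then have "vec_index v m = 0" using step.hyps by simp
            then show False using step.hyps by (simp add: v_def)
          qed
          ultimately show False
            using det det_0_iff_vec_prod_zero[OF A] by (metis v_def vec_carrier)
        qed
        then obtain r where r: "m < r" "r < n" "A $$ (r, m) \<noteq> 0" by blast
        define C where "C = col_replace n r (\<lambda>i. if i = r then 1 else if i = m then - 1 else 0 :: 'a)"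
        define B where "B = mat n n (\<lambda>(i, j). if i = m then A $$ (m, j) + A $$ (r, j) else A $$ (i, j))"
        have B: "B \<in> carrier_mat n n" and C: "C \<in> carrier_mat n n" by (simp_all add: B_def C_def)
        have "A = C * B"
        proof (rule eq_matI)
          fix i j assume "i < dim_row (C * B)" "j < dim_col (C * B)"
          then have ij: "i < n" "j < n" by (auto simp: C_def B_def col_replace_def)
          have "(C * B) $$ (i, j) = (\<Sum>l<n. C $$ (i, l) * B $$ (l, j))"
            using ij by (simp add: C_def B_def col_replace_def scalar_prod_def atLeast0LessThan)
          also have "\<dots> = (\<Sum>l<n. (if l = r then (if i = m then - B $$ (r, j) else 0) else 0) +
               (if l = i then B $$ (i, j) else 0))"
            by (rule sum.cong) (use ij r in \<open>auto simp: C_def col_replace_def\<close>)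
          also have "\<dots> = (if i = m then - B $$ (r, j) else 0) + B $$ (i, j)"
            using ij r by (simp add: sum.distrib)
          also have "\<dots> = A $$ (i, j)" using ij r by (simp add: B_def)
          finally show "A $$ (i, j) = (C * B) $$ (i, j)" by simp
        qed (use A in \<open>auto simp: C_def B_def col_replace_def\<close>)
        moreover have "det C \<noteq> 0" using r by (simp add: C_def det_col_replace)
        moreover have "det B \<noteq> 0"
          using det det_mult[OF C B] \<open>A = C * B\<close> by (metis mult_zero_right)
        moreover have "unit_cols m B" using u r by (auto simp: unit_cols_def B_def)
        then have "P B"
          using pivot[OF B \<open>det B \<noteq> 0\<close>] zero r by (simp add: B_def)
        moreover have "P C" unfolding C_def by (rule col_replace) (use r in auto)
        ultimately show ?thesis using mult[OF C B] by metis
      qed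
    qed
  qed
  from this[of 0] show ?thesis using A detA by (simp add: unit_cols_def)
qed

lemma linear_degree_reflection:
  assumes k: "k \<le> p"
  shows "linear_degree p (multrow_mat (Suc p) k (- 1)) = - 1"
proof -
  let ?n = "Suc p"
  let ?R = "\<lambda>k. multrow_mat ?n k (- 1 :: real)"
  let ?S = "swaprows_mat ?n 0 k :: real mat"
  have "sphere_normalize p (matrix_map (?R 0) x) = (\<lambda>i. if i = 0 then - x i else x i)"
    if x: "x \<in> topspace (nsphere p)" for x
  proof -
    have m: "matrix_map (?R 0) x i = (if i = 0 then - x i else x i)" if "i \<le> p" for i
    proof -
      have "matrix_map (?R 0) x i = (\<Sum>j<?n. if j = i then (if i = 0 then - x i else x i) else 0)"
        unfolding matrix_map_def by (rule sum.cong) (use that in auto)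
      then show ?thesis using that by (simp del: sum.lessThan_Suc)
    qed
    have "(\<Sum>j\<le>p. (matrix_map (?R 0) x j)\<^sup>2) = (\<Sum>j\<le>p. (x j)\<^sup>2)"
      by (rule sum.cong) (auto simp: m)
    then show ?thesis using x
      by (auto simp: sphere_normalize_def topspace_nsphere_iff m fun_eq_iff)
  qed
  then have R0: "linear_degree p (?R 0) = - 1"
    using Brouwer_degree2_eq[of p _ "\<lambda>x i. if i = 0 then - x i else x i"]
    by (simp add: linear_degree_def Brouwer_degree2_reflection)
  \<comment> \<open>the other reflections are conjugate to this one\<close>
  have SS: "?S * ?S = 1\<^sub>m ?n" by (rule swaprows_mat_inv) (use k in auto)
  have "det ?S * det ?S = 1"
    using det_mult[of ?S ?n ?S] SS by simp
  then have detS: "det ?S \<noteq> 0" by auto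
  have conj: "?S * ?R k * ?S = ?R 0"
  proof -
    have "?S * ?R k = swaprows 0 k (?R k)"
      using k by (subst swaprows_mat[of _ ?n ?n]) auto
    then have "?S * ?R k * ?S = swapcols 0 k (swaprows 0 k (?R k))"
      using k by (subst swapcols_mat[of _ ?n ?n]) auto
    also have "\<dots> = ?R 0"
      by (rule eq_matI) (use k in auto)
    finally show ?thesis .
  qed
  have "linear_degree p ?S * linear_degree p ?S = 1"
    using linear_degree_mult[of ?S p ?S] detS SS linear_degree_one by simp
  moreover have "linear_degree p (?R 0) = linear_degree p ?S * linear_degree p (?R k) * linear_degree p ?S"
  proof -
    have detR: "det (?R k) = - 1" using k by (simp add: det_multrow_mat)
    have "det (?S * ?R k) \<noteq> 0" using detS detR det_mult[of ?S ?n "?R k"] by simp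
    then have "linear_degree p (?S * ?R k * ?S) = linear_degree p (?S * ?R k) * linear_degree p ?S"
      using detS by (intro linear_degree_mult) auto
    also have "linear_degree p (?S * ?R k) = linear_degree p ?S * linear_degree p (?R k)"
      using detS detR by (intro linear_degree_mult) auto
    finally show ?thesis unfolding conj .
  qed
  ultimately have "linear_degree p (?R 0) = linear_degree p (?R k)"
    by (simp add: mult.commute mult.left_commute)
  then show ?thesis using R0 by simp
qed

text \<open>Straight-line deformation kills the off-diagonal entries of a column replacement and brings the
  diagonal entry to its sign, with a determinant that never changes sign on the way.\<close>

theorem linear_degree_eq_sgn_det:
  assumes "A \<in> carrier_mat (Suc p) (Suc p)" "det A \<noteq> 0"
  shows "real_of_int (linear_degree p A) = sgn (det A)"
  using assms
proof (induction rule: invertible_matrix_induct)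
  case (mult A B)
  then show ?case by (simp add: linear_degree_mult det_mult[of _ "Suc p"] sgn_mult)
next
  case one
  then show ?case by (simp add: linear_degree_one)
next
  case (col_replace k c)
  define M where "M s = col_replace (Suc p) k
     (\<lambda>i. if i = k then (1 - s) * c k + s * sgn (c k) else (1 - s) * c i)" for s :: real
  have det: "det (M s) \<noteq> 0" if "s \<in> {0..1}" for s
  proof -
    have "det (M s) = (1 - s) * c k + s * sgn (c k)"
      using col_replace by (simp add: M_def det_col_replace)
    also have "\<dots> = sgn (c k) * ((1 - s) * \<bar>c k\<bar> + s)"
      by (simp add: sgn_if algebra_simps)
    also have "(1 - s) * \<bar>c k\<bar> + s > 0"
      using that col_replace(2) by (cases "s = 1") (auto intro: add_pos_nonneg)
    ultimately show ?thesis using col_replace(2) by (auto simp: sgn_zero_iff)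
  qed
  have "linear_degree p (M 0) = linear_degree p (M 1)"
  proof (rule linear_degree_homotopy[OF _ _ det])
    fix i j assume ij: "i \<le> p" "j \<le> p"
    show "continuous_on {0..1} (\<lambda>s. M s $$ (i, j))"
      by (cases "j = k"; cases "i = k")
         (use ij in \<open>auto simp: M_def col_replace_def intro!: continuous_on_add continuous_on_mult
            continuous_on_diff continuous_on_const continuous_on_id\<close>)
  qed (auto simp: M_def)
  moreover have "M 0 = col_replace (Suc p) k c"
    unfolding M_def by (rule arg_cong[of _ _ "col_replace (Suc p) k"]) auto
  moreover have "M 1 = multrow_mat (Suc p) k (sgn (c k))"
    by (rule eq_matI) (auto simp: M_def col_replace_def)
  ultimately have deg: "linear_degree p (col_replace (Suc p) k c) =
      linear_degree p (multrow_mat (Suc p) k (sgn (c k)))" by simp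
  show ?case
  proof (cases "c k > 0")
    case True
    then have "multrow_mat (Suc p) k (sgn (c k)) = 1\<^sub>m (Suc p)"
      by (intro eq_matI) auto
    then show ?thesis using True deg col_replace by (simp add: linear_degree_one det_col_replace)
  next
    case False
    then have "sgn (c k) = - 1" using col_replace(2) by simp
    then show ?thesis
      using deg col_replace linear_degree_reflection[of k p] by (simp add: det_col_replace)
  qed
qed

section \<open>Determinants, spectra and compressions in orthonormal bases\<close>

definition orthonormal_list :: "'a::euclidean_space list \<Rightarrow> bool" where
  "orthonormal_list bs \<longleftrightarrow>
     (\<forall>i<length bs. \<forall>j<length bs. bs ! i \<bullet> bs ! j = (if i = j then 1 else 0))"

text \<open>For orthonormal \<open>bs\<close> this is the matrix of the compression of \<open>A\<close> to the span of \<open>bs\<close>, also if \<open>A\<close>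
  does not map the span into itself.\<close>

definition basis_matrix :: "'a::euclidean_space list \<Rightarrow> ('a \<Rightarrow> 'a) \<Rightarrow> real mat" where
  "basis_matrix bs A = mat (length bs) (length bs) (\<lambda>(i, j). A (bs ! j) \<bullet> bs ! i)"

lemma basis_matrix_carrier [simp]: "basis_matrix bs A \<in> carrier_mat (length bs) (length bs)"
  by (simp add: basis_matrix_def)

lemma orthonormal_list_expansion:
  fixes bs :: "'a::euclidean_space list"
  assumes on: "orthonormal_list bs" and x: "x \<in> span (set bs)"
  shows "x = (\<Sum>i<length bs. (x \<bullet> bs ! i) *\<^sub>R bs ! i)"
  using x
proof (induction rule: span_induct)
  case base
  show ?case
  proof (rule real_vector.subspaceI, unfold mem_Collect_eq)
    fix x y assume "x = (\<Sum>i<length bs. (x \<bullet> bs ! i) *\<^sub>R bs ! i)"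
      "y = (\<Sum>i<length bs. (y \<bullet> bs ! i) *\<^sub>R bs ! i)"
    then show "x + y = (\<Sum>i<length bs. ((x + y) \<bullet> bs ! i) *\<^sub>R bs ! i)"
      by (simp add: inner_add_left scaleR_left_distrib sum.distrib)
  next
    fix c x assume "x = (\<Sum>i<length bs. (x \<bullet> bs ! i) *\<^sub>R bs ! i)"
    then have "c *\<^sub>R x = c *\<^sub>R (\<Sum>i<length bs. (x \<bullet> bs ! i) *\<^sub>R bs ! i)" by simp
    also have "\<dots> = (\<Sum>i<length bs. ((c *\<^sub>R x) \<bullet> bs ! i) *\<^sub>R bs ! i)"
      by (simp add: scaleR_sum_right)
    finally show "c *\<^sub>R x = (\<Sum>i<length bs. ((c *\<^sub>R x) \<bullet> bs ! i) *\<^sub>R bs ! i)" .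
  qed simp
next
  case (step y)
  then obtain k where k: "k < length bs" "y = bs ! k" by (metis in_set_conv_nth)
  have "(\<Sum>i<length bs. (y \<bullet> bs ! i) *\<^sub>R bs ! i) = (\<Sum>i<length bs. if i = k then y else 0)"
    by (rule sum.cong) (use on k in \<open>auto simp: orthonormal_list_def\<close>)
  then show ?case using k by simp
qed

lemma orthonormal_list_distinct: "orthonormal_list bs \<Longrightarrow> distinct bs"
  unfolding orthonormal_list_def distinct_conv_nth by (metis zero_neq_one)

lemma orthonormal_list_length:
  fixes bs :: "'a::euclidean_space list"
  assumes on: "orthonormal_list bs"
  shows "length bs = dim (span (set bs))"
proof -
  have "pairwise real_inner_class.orthogonal (set bs)" "0 \<notin> set bs"
    using on by (auto simp: pairwise_def real_inner_class.orthogonal_def orthonormal_list_def in_set_conv_nth)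
      (metis inner_zero_left zero_neq_one)
  then have "independent (set bs)" by (rule pairwise_orthogonal_independent)
  then show ?thesis
    using distinct_card[OF orthonormal_list_distinct[OF on]] by (simp add: dim_eq_card_independent)
qed

lemma orthonormal_list_inner:
  fixes bs :: "'a::euclidean_space list"
  assumes "orthonormal_list bs" "x \<in> span (set bs)"
  shows "x \<bullet> y = (\<Sum>i<length bs. (x \<bullet> bs ! i) * (bs ! i \<bullet> y))"
  by (subst orthonormal_list_expansion[OF assms]) (simp add: inner_sum_left)

text \<open>The change of basis between two orthonormal lists is an orthogonal matrix.  This makes determinants
  and characteristic polynomials independent of the arbitrary bases and enumerations chosen in the
  definitions of the spectrum and of the degree.\<close>

lemma basis_matrix_similar:
  fixes bs cs :: "'a::euclidean_space list"
  assumes bs: "orthonormal_list bs" and cs: "orthonormal_list cs"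
    and span: "span (set bs) = span (set cs)" and A: "linear A"
  shows "similar_mat (basis_matrix bs A) (basis_matrix cs A)"
proof -
  interpret linear A by fact
  define n where "n = length bs"
  have n: "length bs = n" "length cs = n"
    using orthonormal_list_length[OF bs] orthonormal_list_length[OF cs] span by (auto simp: n_def)
  define P where "P = mat n n (\<lambda>(i, k). cs ! k \<bullet> bs ! i)"
  define Q where "Q = mat n n (\<lambda>(k, i). cs ! k \<bullet> bs ! i)"
  have bs': "bs ! i \<in> span (set cs)" "bs ! i \<in> span (set bs)" if "i < n" for i
    using that n span by (metis nth_mem span_base)+
  have cs': "cs ! i \<in> span (set bs)" if "i < n" for i
    using that n span by (metis nth_mem span_base)
  have "P * Q = 1\<^sub>m n"
  proof (rule eq_matI)
    fix i j assume "i < dim_row (1\<^sub>m n :: real mat)" "j < dim_col (1\<^sub>m n :: real mat)"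
    then have ij: "i < n" "j < n" by auto
    have "(P * Q) $$ (i, j) = bs ! i \<bullet> bs ! j"
      using ij orthonormal_list_inner[OF cs bs'(1)[OF ij(1)], of "bs ! j"] n
      by (simp add: P_def Q_def scalar_prod_def atLeast0LessThan inner_commute)
    then show "(P * Q) $$ (i, j) = 1\<^sub>m n $$ (i, j)" using bs ij n by (simp add: orthonormal_list_def)
  qed (auto simp: P_def Q_def)
  moreover have "Q * P = 1\<^sub>m n"
  proof (rule eq_matI)
    fix i j assume "i < dim_row (1\<^sub>m n :: real mat)" "j < dim_col (1\<^sub>m n :: real mat)"
    then have ij: "i < n" "j < n" by auto
    have "(Q * P) $$ (i, j) = cs ! i \<bullet> cs ! j"
      using ij orthonormal_list_inner[OF bs cs'[OF ij(1)], of "cs ! j"] n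
      by (simp add: P_def Q_def scalar_prod_def atLeast0LessThan inner_commute)
    then show "(Q * P) $$ (i, j) = 1\<^sub>m n $$ (i, j)" using cs ij n by (simp add: orthonormal_list_def)
  qed (auto simp: P_def Q_def)
  moreover have "basis_matrix bs A = P * basis_matrix cs A * Q"
  proof (rule eq_matI)
    fix i j assume "i < dim_row (P * basis_matrix cs A * Q)" "j < dim_col (P * basis_matrix cs A * Q)"
    then have ij: "i < n" "j < n" by (auto simp: P_def Q_def)
    have PA: "(P * basis_matrix cs A) $$ (i, l) = A (cs ! l) \<bullet> bs ! i" if l: "l < n" for l
      using ij l n orthonormal_list_inner[OF cs bs'(1)[OF ij(1)], of "A (cs ! l)"]
      by (simp add: P_def basis_matrix_def scalar_prod_def atLeast0LessThan inner_commute)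
    have "A (bs ! j) = (\<Sum>l<n. (bs ! j \<bullet> cs ! l) *\<^sub>R A (cs ! l))"
      by (subst orthonormal_list_expansion[OF cs bs'(1)[OF ij(2)]]) (simp add: sum scale n)
    then have "A (bs ! j) \<bullet> bs ! i = (\<Sum>l<n. (A (cs ! l) \<bullet> bs ! i) * (cs ! l \<bullet> bs ! j))"
      by (simp add: inner_sum_left) (simp add: inner_commute mult.commute)
    moreover have "(P * basis_matrix cs A * Q) $$ (i, j) =
        (\<Sum>l<n. (P * basis_matrix cs A) $$ (i, l) * Q $$ (l, j))"
      using ij n by (simp add: P_def Q_def scalar_prod_def atLeast0LessThan basis_matrix_def)
    ultimately show "basis_matrix bs A $$ (i, j) = (P * basis_matrix cs A * Q) $$ (i, j)"
      using ij n by (simp add: PA Q_def basis_matrix_def[of bs] del: index_mult_mat)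
  qed (auto simp: P_def Q_def n basis_matrix_def)
  ultimately have "similar_mat_wit (basis_matrix bs A) (basis_matrix cs A) P Q"
    using basis_matrix_carrier[of bs A] basis_matrix_carrier[of cs A]
    by (auto simp: similar_mat_wit_def Let_def n P_def Q_def)
  then show ?thesis unfolding similar_mat_def by blast
qed

lemma onb_list_orthonormal:
  fixes cs :: "'a::euclidean_space list"
  assumes cs: "orthonormal_list cs" and W: "span (set cs) = W"
  shows "orthonormal_list (onb_list W)" "span (set (onb_list W)) = W"
proof -
  let ?P = "\<lambda>bs. distinct bs \<and> span (set bs) = W \<and>
     (\<forall>b\<in>set bs. \<forall>b'\<in>set bs. b \<bullet> b' = (if b = b' then 1 else 0))"
  have "?P cs"
    using cs W orthonormal_list_distinct[OF cs]
    by (auto simp: orthonormal_list_def in_set_conv_nth)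
  then have "?P (onb_list W)" unfolding onb_list_def by (rule someI)
  then show "orthonormal_list (onb_list W)" "span (set (onb_list W)) = W"
    by (auto simp: orthonormal_list_def nth_eq_iff_index_eq)
qed

lemma compression_inner:
  fixes cs :: "'a::euclidean_space list"
  assumes cs: "orthonormal_list cs" and W: "span (set cs) = W" and \<omega>: "\<omega> \<in> W"
  shows "compression W A \<psi> \<bullet> \<omega> = A \<psi> \<bullet> \<omega>"
proof -
  define y where "y = (\<Sum>i<length cs. (A \<psi> \<bullet> cs ! i) *\<^sub>R cs ! i)"
  have "y \<in> W" unfolding y_def W[symmetric] by (intro span_sum span_scale span_base) simp
  have y: "y \<bullet> \<omega> = A \<psi> \<bullet> \<omega>" if "\<omega> \<in> W" for \<omega>
    using orthonormal_list_inner[OF cs, of \<omega> "A \<psi>"] that W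
    by (simp add: y_def inner_sum_left) (simp add: inner_commute mult.commute)
  have "compression W A \<psi> = y"
    unfolding compression_def
  proof (rule the_equality)
    fix z assume z: "z \<in> W \<and> (\<forall>\<omega>\<in>W. z \<bullet> \<omega> = A \<psi> \<bullet> \<omega>)"
    then have "z - y \<in> W" using \<open>y \<in> W\<close> W by (metis span_diff)
    then have "(z - y) \<bullet> (z - y) = 0" using z y by (simp add: inner_diff_left)
    then show "z = y" by simp
  qed (use \<open>y \<in> W\<close> y in auto)
  then show ?thesis using y[OF \<omega>] by simp
qed

text \<open>Splitting off one real root \<open>r\<close> multiplies the left-hand side by the sign of \<open>r - E\<close>, which is
  negative exactly for the roots that are counted.  A non-real root is split off together with its
  conjugate; their quadratic factor is positive everywhere.\<close>

lemma sgn_monic_poly_roots_below: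
  fixes p :: "real poly"
  assumes "monic p" "poly p E \<noteq> 0"
  shows "sgn ((- 1) ^ degree p * poly p E) =
    (- 1) ^ size {# z \<in># proots (map_poly complex_of_real p). z \<in> \<real> \<and> Re z < E #}"
  using assms
proof (induction "degree p" arbitrary: p rule: less_induct)
  case less
  define cp where "cp q = map_poly complex_of_real q" for q
  interpret of_real: map_poly_inj_idom_hom complex_of_real ..
  define s where "s q = sgn ((- 1) ^ degree q * poly q E)" for q
  define below where "below q = size {# z \<in># proots (cp q). z \<in> \<real> \<and> Re z < E #}" for q
  have s_mult: "s (q * r) = s q * s r" if "monic q" "monic r" for q r
  proof -
    have "degree (q * r) = degree q + degree r"
      using that by (intro degree_mult_eq) auto
    then show ?thesis by (simp add: s_def power_add sgn_mult mult_ac)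
  qed
  have below_mult: "below (q * r) = below q + below r" if "monic q" "monic r" for q r
  proof -
    have "cp q \<noteq> 0" "cp r \<noteq> 0" using that by (auto simp: cp_def)
    then show ?thesis by (simp add: below_def cp_def of_real.hom_mult proots_mult)
  qed
  have factor: "s p = (- 1) ^ below p"
    if p: "p = q * r" and q: "monic q" "degree q > 0" and sq: "s q = (- 1) ^ below q" for q r
  proof -
    have "lead_coeff p = lead_coeff q * lead_coeff r" using p by (simp add: lead_coeff_mult)
    then have r: "monic r" using less.prems q by simp
    then have "degree r < degree p" using q p by (subst p, subst degree_mult_eq) auto
    moreover have "poly r E \<noteq> 0" using p less.prems by auto
    ultimately have "s r = (- 1) ^ below r"
      using less.hyps[of r] r by (simp add: s_def below_def cp_def)
    then show ?thesis using q r sq by (simp add: p s_mult below_mult power_add)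
  qed
  have "s p = (- 1) ^ below p"
  proof (cases "degree p = 0")
    case True
    then have "p = 1" using less.prems by (metis monic_degree_0)
    then show ?thesis by (simp add: s_def below_def cp_def)
  next
    case False
    then have "degree (cp p) \<noteq> 0" by (simp add: cp_def)
    then obtain z where z: "poly (cp p) z = 0"
      using fundamental_theorem_of_algebra[of "cp p"] constant_degree[of "cp p"] by auto
    show ?thesis
    proof (cases "z \<in> \<real>")
      case True
      then obtain r where r: "z = of_real r" by (auto elim: Reals_cases)
      have "poly p r = 0" using z unfolding r cp_def by simp
      then obtain q where q: "p = [:- r, 1:] * q" by (metis dvdE poly_eq_0_iff_dvd)
      have "E \<noteq> r" using q less.prems by auto
      have "cp [:- r, 1:] = [:- of_real r, 1:]" by (simp add: cp_def)
      then have "s [:- r, 1:] = (- 1) ^ below [:- r, 1:]"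
        using \<open>E \<noteq> r\<close> by (simp add: s_def below_def)
      then show ?thesis by (intro factor[OF q]) auto
    next
      case nonreal: False
      define q where "q = [:(cmod z)\<^sup>2, - 2 * Re z, 1:]"
      have cq: "cp q = [:- z, 1:] * [:- cnj z, 1:]"
        by (simp add: q_def cp_def complex_eq_iff cmod_power2) (simp add: power2_eq_square)
      have "p mod q = 0"
      proof -
        have "poly (cp (p mod q)) z = 0"
        proof -
          have "cp p = cp (q * (p div q) + p mod q)" by simp
          also have "\<dots> = cp q * cp (p div q) + cp (p mod q)"
            unfolding cp_def by (simp only: of_real.hom_add of_real.hom_mult)
          finally have "cp p = cp q * cp (p div q) + cp (p mod q)" .
          from arg_cong[OF this, of "\<lambda>h. poly h z"] show ?thesis
            using z unfolding cq poly_add poly_mult by simp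
        qed
        moreover have "degree (p mod q) \<le> 1"
          using degree_mod_less[of q p] by (auto simp: q_def)
        then have "p mod q = [:poly.coeff (p mod q) 0, poly.coeff (p mod q) 1:]"
          by (intro poly_eqI) (auto simp: coeff_pCons coeff_eq_0 split: nat.splits)
        then obtain a b where ab: "p mod q = [:a, b:]" by blast
        ultimately have "complex_of_real a + z * of_real b = 0" by (simp add: cp_def ab of_real_hom.map_poly_pCons_hom)
        then have "a + Re z * b = 0" "Im z * b = 0" by (simp_all add: complex_eq_iff)
        moreover have "Im z \<noteq> 0" using nonreal by (simp add: complex_is_Real_iff)
        ultimately show ?thesis by (simp add: ab)
      qed
      then have p: "p = q * (p div q)" by (metis add.right_neutral mult_div_mod_eq)
      have "poly q E = (E - Re z)\<^sup>2 + (Im z)\<^sup>2"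
        unfolding q_def cmod_power2 by (simp add: power2_eq_square algebra_simps)
      moreover have "Im z \<noteq> 0" using nonreal by (simp add: complex_is_Real_iff)
      ultimately have "poly q E > 0" by (simp add: add_nonneg_pos)
      moreover have "proots (cp q) = {# z, cnj z #}"
        unfolding cq by (subst proots_mult) auto
      ultimately have "s q = (- 1) ^ below q"
        using nonreal by (simp add: s_def below_def q_def)
      then show ?thesis by (intro factor[OF p]) (auto simp: q_def)
    qed
  qed
  then show ?case by (simp add: s_def below_def cp_def)
qed

context
  fixes cs :: "'a::euclidean_space list" and W :: "'a set" and A :: "'a \<Rightarrow> 'a" and E :: real
  assumes cs: "orthonormal_list cs" and W: "span (set cs) = W" and A: "linear A"
begin

lemma operator_matrix_compression:
  "operator_matrix W (compression W A) = map_mat complex_of_real (basis_matrix (onb_list W) A)"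
proof -
  have "onb_list W ! i \<in> W" if "i < length (onb_list W)" for i
    using onb_list_orthonormal(2)[OF cs W] that by (metis nth_mem span_base)
  then show ?thesis
    by (intro eq_matI) (auto simp: operator_matrix_def basis_matrix_def Let_def compression_inner[OF cs W])
qed

lemma char_poly_compression:
  "char_poly (operator_matrix W (compression W A)) =
     map_poly complex_of_real (char_poly (basis_matrix cs A))"
proof -
  have "char_poly (basis_matrix (onb_list W) A) = char_poly (basis_matrix cs A)"
    by (intro char_poly_similar basis_matrix_similar onb_list_orthonormal[OF cs W] cs A)
       (simp add: W onb_list_orthonormal[OF cs W])
  then show ?thesis
    by (simp add: operator_matrix_compression of_real_hom.char_poly_hom[OF basis_matrix_carrier])
qed

lemma char_poly_basis_matrix:
  "poly (char_poly (basis_matrix cs A)) E = (- 1) ^ length cs * det (basis_matrix cs (\<lambda>\<psi>. A \<psi> - E *\<^sub>R \<psi>))"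
proof -
  have "char_matrix (basis_matrix cs A) E = basis_matrix cs (\<lambda>\<psi>. A \<psi> - E *\<^sub>R \<psi>)"
    by (rule eq_matI)
       (use cs in \<open>auto simp: basis_matrix_def char_matrix_def inner_diff_left orthonormal_list_def\<close>)
  moreover have "- basis_matrix cs B = (- 1) \<cdot>\<^sub>m basis_matrix cs B" for B
    by (rule eq_matI) (auto simp: basis_matrix_def)
  ultimately show ?thesis
    using char_poly_matrix[OF basis_matrix_carrier[of cs A], of E]
      carrier_matD(2)[OF basis_matrix_carrier[of cs]]
    by simp
qed

lemma spectrum_compression_iff:
  "complex_of_real E \<in> op_spectrum W (compression W A) \<longleftrightarrow>
     det (basis_matrix cs (\<lambda>\<psi>. A \<psi> - E *\<^sub>R \<psi>)) = 0"
proof -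
  have "operator_matrix W (compression W A) \<in> carrier_mat (length (onb_list W)) (length (onb_list W))"
    by (simp add: operator_matrix_def Let_def)
  then have "complex_of_real E \<in> op_spectrum W (compression W A) \<longleftrightarrow>
      poly (map_poly complex_of_real (char_poly (basis_matrix cs A))) (of_real E) = 0"
    by (simp add: op_spectrum_def Spectral_Radius.spectrum_def eigenvalue_root_char_poly char_poly_compression)
  also have "\<dots> \<longleftrightarrow> poly (char_poly (basis_matrix cs A)) E = 0" by simp
  finally show ?thesis by (simp add: char_poly_basis_matrix)
qed

lemma sgn_det_eigenvalues_below:
  assumes "det (basis_matrix cs (\<lambda>\<psi>. A \<psi> - E *\<^sub>R \<psi>)) \<noteq> 0"
  shows "sgn (det (basis_matrix cs (\<lambda>\<psi>. A \<psi> - E *\<^sub>R \<psi>))) =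
    (- 1) ^ eigenvalues_below W (compression W A) E"
proof -
  let ?p = "char_poly (basis_matrix cs A)"
  have deg: "degree ?p = length cs" and monic: "monic ?p"
    using degree_monic_char_poly[OF basis_matrix_carrier[of cs A]] by auto
  have "sgn ((- 1) ^ degree ?p * poly ?p E) = (- 1) ^ eigenvalues_below W (compression W A) E"
    unfolding eigenvalues_below_def op_eigenvalues_def char_poly_compression
    by (rule sgn_monic_poly_roots_below[OF monic]) (use assms char_poly_basis_matrix in simp)
  then show ?thesis
    by (simp add: deg char_poly_basis_matrix flip: mult.assoc power_mult_distrib)
qed

end

section \<open>Excitation operators\<close>

text \<open>The sign of moving an operator of the orbital \<open>p\<close> past the occupied orbitals below it.\<close>

definition parity :: "'k::{finite,linorder} set \<Rightarrow> 'k \<Rightarrow> real" where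
  "parity S p = (-1) ^ card {q\<in>S. q < p}"

lemma parity_insert: "q \<notin> S \<Longrightarrow> parity (insert q S) p = (if q < p then - parity S p else parity S p)"
proof -
  assume "q \<notin> S"
  moreover have "{r \<in> insert q S. r < p} = (if q < p then insert q {r\<in>S. r < p} else {r\<in>S. r < p})"
    by auto
  ultimately show ?thesis by (simp add: parity_def)
qed

lemma parity_remove: "q \<in> S \<Longrightarrow> parity (S - {q}) p = (if q < p then - parity S p else parity S p)"
  using parity_insert[of q "S - {q}" p] by (auto simp: insert_absorb)

lemma abs_parity [simp]: "\<bar>parity S p\<bar> = 1"
  by (simp add: parity_def power_abs)

lemma create_nth: "create p \<psi> $ S = (if p \<in> S then parity S p * \<psi> $ (S - {p}) else 0)"
  by (simp add: create_def parity_def)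

lemma annihilate_nth: "annihilate p \<psi> $ S = (if p \<notin> S then parity S p * \<psi> $ (insert p S) else 0)"
  by (simp add: annihilate_def parity_def)

lemma linear_create: "linear (create p)"
  by (rule linearI) (auto simp: Finite_Cartesian_Product.vec_eq_iff create_nth algebra_simps)

lemma linear_annihilate: "linear (annihilate p)"
  by (rule linearI) (auto simp: Finite_Cartesian_Product.vec_eq_iff annihilate_nth algebra_simps)

lemmas create_minus = linear_neg[OF linear_create] and annihilate_minus = linear_neg[OF linear_annihilate]

lemma create_anticommute: "create p (create q \<psi>) = - create q (create p \<psi>)"
proof -
  have "create p (create q \<psi>) $ S = - create q (create p \<psi>) $ S" for S
  proof (cases "p \<in> S \<and> q \<in> S \<and> p \<noteq> q")
    case True
    have "S - {q} - {p} = S - {p} - {q}" by auto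
    then have "\<psi> $ (S - {q} - {p}) = \<psi> $ (S - {p} - {q})" by (rule arg_cong)
    then show ?thesis using True
      by (cases p q rule: linorder_cases) (simp_all add: create_nth parity_remove less_not_sym)
  qed (auto simp: create_nth)
  then show ?thesis by (simp add: Finite_Cartesian_Product.vec_eq_iff)
qed

lemma annihilate_anticommute: "annihilate p (annihilate q \<psi>) = - annihilate q (annihilate p \<psi>)"
proof -
  have "annihilate p (annihilate q \<psi>) $ S = - annihilate q (annihilate p \<psi>) $ S" for S
  proof (cases "p \<notin> S \<and> q \<notin> S \<and> p \<noteq> q")
    case True
    then show ?thesis
      by (cases p q rule: linorder_cases) (auto simp: annihilate_nth parity_insert insert_commute)
  qed (auto simp: annihilate_nth)
  then show ?thesis by (simp add: Finite_Cartesian_Product.vec_eq_iff)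
qed

lemma create_annihilate_anticommute:
  assumes "p \<noteq> q"
  shows "create p (annihilate q \<psi>) = - annihilate q (create p \<psi>)"
proof -
  have "create p (annihilate q \<psi>) $ S = - annihilate q (create p \<psi>) $ S" for S
  proof (cases "p \<in> S \<and> q \<notin> S")
    case True
    moreover have "insert q (S - {p}) = insert q S - {p}" using assms by auto
    ultimately show ?thesis using assms
      by (cases p q rule: linorder_cases) (auto simp: create_nth annihilate_nth parity_insert parity_remove)
  qed (use assms in \<open>auto simp: create_nth annihilate_nth\<close>)
  then show ?thesis by (simp add: Finite_Cartesian_Product.vec_eq_iff)
qed

definition excitation_pairs :: "nat \<Rightarrow> ('k::{finite,linorder} \<times> 'k) list \<Rightarrow> bool" where
  "excitation_pairs N ps \<longleftrightarrow> (\<forall>(A, I)\<in>set ps. A \<notin> occupied N \<and> I \<in> occupied N)"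

definition pairs_op :: "('k::{finite,linorder} \<times> 'k) list \<Rightarrow> 'k fock \<Rightarrow> 'k fock" where
  "pairs_op ps = foldr (\<lambda>(A, I) X. create A \<circ> annihilate I \<circ> X) ps id"

lemma pairs_op_simps [simp]:
  "pairs_op [] \<psi> = \<psi>" "pairs_op ((A, I) # ps) \<psi> = create A (annihilate I (pairs_op ps \<psi>))"
  by (simp_all add: pairs_op_def)

lemma excitation_pairs_simps [simp]:
  "excitation_pairs N []"
  "excitation_pairs N ((A, I) # ps) \<longleftrightarrow> A \<notin> occupied N \<and> I \<in> occupied N \<and> excitation_pairs N ps"
  by (auto simp: excitation_pairs_def)

text \<open>Creators of virtual orbitals anticommute with annihilators of occupied orbitals because no orbital
  is both; moving a pair past a pair takes an even number of such exchanges.\<close>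

lemma pair_commute:
  assumes "A \<notin> occupied N" "B \<notin> occupied N" "I \<in> occupied N" "J \<in> occupied N"
  shows "create A (annihilate I (create B (annihilate J \<psi>))) =
    create B (annihilate J (create A (annihilate I \<psi>)))"
proof -
  have ne: "B \<noteq> I" "A \<noteq> J" using assms by auto
  have "create A (annihilate I (create B (annihilate J \<psi>))) =
      - create A (create B (annihilate I (annihilate J \<psi>)))"
    using create_annihilate_anticommute[OF ne(1), of "annihilate J \<psi>"]
    by (simp add: create_minus annihilate_minus)
  also have "\<dots> = create B (create A (annihilate I (annihilate J \<psi>)))"
    using create_anticommute[of A B "annihilate I (annihilate J \<psi>)"] by simp
  also have "\<dots> = - create B (create A (annihilate J (annihilate I \<psi>)))"
    using annihilate_anticommute[of I J \<psi>] by (simp add: create_minus)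
  also have "\<dots> = create B (annihilate J (create A (annihilate I \<psi>)))"
    using create_annihilate_anticommute[OF ne(2), of "annihilate I \<psi>"]
    by (simp add: create_minus annihilate_minus)
  finally show ?thesis .
qed

lemma pairs_op_commute:
  assumes "excitation_pairs N ps" "excitation_pairs N qs"
  shows "pairs_op ps (pairs_op qs \<psi>) = pairs_op qs (pairs_op ps \<psi>)"
proof -
  have single: "create A (annihilate I (pairs_op qs \<psi>)) = pairs_op qs (create A (annihilate I \<psi>))"
    if "A \<notin> occupied N" "I \<in> occupied N" "excitation_pairs N qs" for A I qs \<psi>
    using that(3)
  proof (induction qs)
    case (Cons q qs)
    obtain B J where q: "q = (B, J)" by fastforce
    then have BJ: "B \<notin> occupied N" "J \<in> occupied N" "excitation_pairs N qs" using Cons.prems by auto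
    then show ?case
      using pair_commute[OF that(1) BJ(1) that(2) BJ(2), of "pairs_op qs \<psi>"] Cons.IH
      by (simp add: q)
  qed simp
  show ?thesis
    using assms(1)
  proof (induction ps)
    case (Cons p ps)
    obtain A I where p: "p = (A, I)" by fastforce
    then have AI: "A \<notin> occupied N" "I \<in> occupied N" "excitation_pairs N ps" using Cons.prems by auto
    then show ?case
      using single[OF AI(1,2) assms(2), of "pairs_op ps \<psi>"] Cons.IH by (simp add: p)
  qed simp
qed

lemma excitation_op_pairs: "excitation_op N \<alpha> =
    pairs_op (zip (sorted_list_of_set (\<alpha> - occupied N)) (sorted_list_of_set (occupied N - \<alpha>)))"
  by (simp add: excitation_op_def pairs_op_def)

lemma excitation_pairs_zip:
  "excitation_pairs N (zip (sorted_list_of_set (\<alpha> - occupied N)) (sorted_list_of_set (occupied N - \<alpha>)))"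
  by (auto simp: excitation_pairs_def dest: set_zip_leftD set_zip_rightD)

lemma excitation_op_commute:
  "excitation_op N \<alpha> (excitation_op N \<beta> \<psi>) = excitation_op N \<beta> (excitation_op N \<alpha> \<psi>)"
  unfolding excitation_op_pairs by (rule pairs_op_commute[OF excitation_pairs_zip excitation_pairs_zip])

lemma linear_pairs_op: "linear (pairs_op ps)"
proof (induction ps)
  case Nil
  then show ?case by (simp add: linear_iff)
next
  case (Cons p ps)
  then show ?case
    by (cases p) (simp add: linear_iff linear_add[OF linear_create] linear_add[OF linear_annihilate]
        linear_scale[OF linear_create] linear_scale[OF linear_annihilate])
qed

lemma linear_excitation_op: "linear (excitation_op N \<alpha>)"
  unfolding excitation_op_pairs by (rule linear_pairs_op)

section \<open>Rank filtration and particle number\<close>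

text \<open>The span of the determinants with at least \<open>r\<close> virtual orbitals.  Each creator-annihilator pair
  moves one step up this filtration, which gives both nilpotency of cluster operators and
  the vanishing of matrix elements between different ranks.\<close>

definition rank_filtration :: "nat \<Rightarrow> nat \<Rightarrow> 'k::{finite,linorder} fock set" where
  "rank_filtration N r = {\<psi>. \<forall>S. card (S - occupied N) < r \<longrightarrow> \<psi> $ S = 0}"

definition particle_space :: "nat \<Rightarrow> 'k::{finite,linorder} fock set" where
  "particle_space N = {\<psi>. \<forall>S. card S \<noteq> N \<longrightarrow> \<psi> $ S = 0}"

lemma subspace_rank_filtration: "real_vector.subspace (rank_filtration N r)"
  by (auto simp: rank_filtration_def intro: real_vector.subspaceI)

lemma subspace_particle_space: "real_vector.subspace (particle_space N)"
  by (auto simp: particle_space_def intro: real_vector.subspaceI)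

lemma pairs_op_rank_filtration:
  assumes "excitation_pairs N ps" "\<psi> \<in> rank_filtration N r"
  shows "pairs_op ps \<psi> \<in> rank_filtration N (r + length ps)"
  using assms(1)
proof (induction ps)
  case (Cons p ps)
  obtain A I where p: "p = (A, I)" by fastforce
  have AI: "A \<notin> occupied N" "I \<in> occupied N" using Cons.prems p by auto
  have "create A (annihilate I (pairs_op ps \<psi>)) $ S = 0"
    if "card (S - occupied N) < Suc (r + length ps)" for S
  proof (cases "A \<in> S")
    case True
    have "insert I (S - {A}) - occupied N = (S - occupied N) - {A}" using AI by auto
    then have "card (insert I (S - {A}) - occupied N) = card (S - occupied N) - 1"
      using True AI by simp
    moreover have "card (S - occupied N) > 0" using True AI by (auto simp: card_gt_0_iff)
    ultimately have "card (insert I (S - {A}) - occupied N) < r + length ps"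
      using that by linarith
    then have "pairs_op ps \<psi> $ (insert I (S - {A})) = 0"
      using Cons p by (auto simp: rank_filtration_def)
    then show ?thesis by (simp add: create_nth annihilate_nth)
  qed (simp add: create_nth)
  then show ?case by (simp add: p rank_filtration_def)
qed (use assms in simp)

lemma pairs_op_particle_space:
  assumes "excitation_pairs N ps" "\<psi> \<in> particle_space M"
  shows "pairs_op ps \<psi> \<in> particle_space M"
  using assms(1)
proof (induction ps)
  case (Cons p ps)
  obtain A I where p: "p = (A, I)" by fastforce
  have "create A (annihilate I (pairs_op ps \<psi>)) $ S = 0" if "card S \<noteq> M" for S
  proof (cases "A \<in> S \<and> I \<notin> S - {A}")
    case True
    then have "card (insert I (S - {A})) = card S"
      by (metis card_Suc_Diff1 card_insert_disjoint finite)
    then have "pairs_op ps \<psi> $ (insert I (S - {A})) = 0"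
      using Cons p that by (auto simp: particle_space_def)
    then show ?thesis by (simp add: create_nth annihilate_nth)
  qed (auto simp: create_nth annihilate_nth)
  then show ?case by (simp add: p particle_space_def)
qed (use assms in simp)

lemma card_occupied:
  assumes "N \<le> CARD('k)"
  shows "card (occupied N :: 'k::{finite,linorder} set) = N"
proof -
  let ?pos = "\<lambda>p::'k. card {q. q < p}"
  have mono: "?pos p < ?pos q" if "p < q" for p q
    by (rule psubset_card_mono) (use that in \<open>auto dest: less_trans\<close>)
  have inj: "inj ?pos" by (rule linorder_injI) (use mono in fastforce)
  have "?pos p < CARD('k)" for p by (rule psubset_card_mono) auto
  then have "range ?pos = {..<CARD('k)}"
    by (intro card_subset_eq) (auto simp: card_image[OF inj])
  moreover have "?pos ` occupied N = range ?pos \<inter> {..<N}" by (auto simp: occupied_def)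
  ultimately have "?pos ` occupied N = {..<N}" using assms by auto
  moreover have "card (?pos ` occupied N) = card (occupied N :: 'k set)"
    by (rule card_image) (rule inj_on_subset[OF inj subset_UNIV])
  ultimately show ?thesis by simp
qed

lemma pair_axis:
  assumes "I \<in> S" "A \<notin> S"
  shows "\<exists>c::real. \<bar>c\<bar> = 1 \<and> create A (annihilate I (axis S 1)) = c *\<^sub>R axis (insert A (S - {I})) 1"
proof (intro exI conjI)
  let ?T = "insert A (S - {I})"
  let ?c = "parity ?T A * parity (?T - {A}) I"
  show "\<bar>?c\<bar> = 1" by (simp add: abs_mult)
  have ne: "A \<noteq> I" using assms by auto
  have "create A (annihilate I (axis S 1)) $ R = (?c *\<^sub>R axis ?T 1) $ R" for R
  proof (cases "R = ?T")
    case True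
    moreover have "insert I (?T - {A}) = S" using assms by auto
    ultimately show ?thesis using assms ne by (simp add: create_nth annihilate_nth)
  next
    case False
    then have "\<not> (A \<in> R \<and> I \<notin> R - {A} \<and> S = insert I (R - {A}))" using assms by auto
    then have "create A (annihilate I (axis S 1)) $ R = 0"
      by (auto simp: create_nth annihilate_nth axis_def)
    then show ?thesis using False by (simp add: axis_def)
  qed
  then show "create A (annihilate I (axis S 1)) = ?c *\<^sub>R axis ?T 1" by (simp add: Finite_Cartesian_Product.vec_eq_iff)
qed

lemma pairs_op_ref_state:
  assumes "excitation_pairs N ps" "distinct (map fst ps)" "distinct (map snd ps)"
  shows "\<exists>c::real. \<bar>c\<bar> = 1 \<and>
    pairs_op ps (ref_state N) = c *\<^sub>R axis ((occupied N - snd ` set ps) \<union> fst ` set ps) 1"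
  using assms
proof (induction ps)
  case Nil
  then show ?case by (intro exI[of _ 1]) (simp add: ref_state_def)
next
  case (Cons p ps)
  obtain A I where p: "p = (A, I)" by fastforce
  let ?S = "(occupied N - snd ` set ps) \<union> fst ` set ps"
  obtain c :: real where c: "\<bar>c\<bar> = 1" "pairs_op ps (ref_state N) = c *\<^sub>R axis ?S 1"
    using Cons p by auto
  have fst: "fst ` set ps \<inter> occupied N = {}"
    using Cons.prems by (auto simp: p excitation_pairs_def)
  have "I \<in> ?S" "A \<notin> ?S" using Cons.prems by (auto simp: p)
  from pair_axis[OF this] obtain d :: real
    where d: "\<bar>d\<bar> = 1" "create A (annihilate I (axis ?S 1)) = d *\<^sub>R axis (insert A (?S - {I})) 1" by blast
  have "pairs_op (p # ps) (ref_state N) = (c * d) *\<^sub>R axis (insert A (?S - {I})) 1"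
    using d(2) by (simp add: p c linear_scale[OF linear_create] linear_scale[OF linear_annihilate])
  moreover have "insert A (?S - {I}) = (occupied N - snd ` set (p # ps)) \<union> fst ` set (p # ps)"
    using fst Cons.prems by (auto simp: p)
  ultimately show ?case using c d by (intro exI[of _ "c * d"]) (simp add: abs_mult)
qed

lemma excitation_length:
  assumes "N \<le> CARD('k)" and "card (\<alpha> :: 'k::{finite,linorder} set) = N"
  shows "card (occupied N - \<alpha>) = card (\<alpha> - occupied N)"
  using assms(2) card_occupied[OF assms(1)] by (simp add: card_Diff_subset_Int Int_commute)

text \<open>The excitation operator empties the occupied orbitals missing from \<open>\<alpha>\<close> and fills its virtual
  ones; the only trace of the order of the operators is the sign \<open>c\<close>.\<close>

lemma excited_state_axis:
  assumes "N \<le> CARD('k)" and \<alpha>: "\<alpha> \<in> multiindices N"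
  shows "\<exists>c::real. \<bar>c\<bar> = 1 \<and> excited_state N (\<alpha> :: 'k::{finite,linorder} set) = c *\<^sub>R axis \<alpha> 1"
proof -
  let ?ps = "zip (sorted_list_of_set (\<alpha> - occupied N)) (sorted_list_of_set (occupied N - \<alpha>))"
  have len: "length (sorted_list_of_set (\<alpha> - occupied N)) = length (sorted_list_of_set (occupied N - \<alpha>))"
    using excitation_length[OF assms(1)] \<alpha> by (simp add: multiindices_def)
  have maps: "map fst ?ps = sorted_list_of_set (\<alpha> - occupied N)"
    "map snd ?ps = sorted_list_of_set (occupied N - \<alpha>)"
    using len by simp_all
  have "fst ` set ?ps = \<alpha> - occupied N" "snd ` set ?ps = occupied N - \<alpha>"
    using maps by (metis finite list.set_map set_sorted_list_of_set)+
  moreover have "(occupied N - (occupied N - \<alpha>)) \<union> (\<alpha> - occupied N) = \<alpha>" by auto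
  ultimately show ?thesis
    unfolding excited_state_def excitation_op_pairs
    using pairs_op_ref_state[OF excitation_pairs_zip, of \<alpha> N] maps by simp
qed

lemma excited_state_occupied: "excited_state N (occupied N) = ref_state N"
  by (simp add: excited_state_def excitation_op_pairs)

lemma excited_state_inner:
  assumes "N \<le> CARD('k)" "\<alpha> \<in> multiindices N" "\<beta> \<in> multiindices N"
  shows "excited_state N (\<alpha> :: 'k::{finite,linorder} set) \<bullet> excited_state N \<beta> = (if \<alpha> = \<beta> then 1 else 0)"
proof -
  obtain c d :: real where c: "\<bar>c\<bar> = 1" "excited_state N \<alpha> = c *\<^sub>R axis \<alpha> 1"
    and d: "\<bar>d\<bar> = 1" "excited_state N \<beta> = d *\<^sub>R axis \<beta> 1"
    using excited_state_axis assms by metis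
  show ?thesis
  proof (cases "\<alpha> = \<beta>")
    case True
    then have "excited_state N \<alpha> \<bullet> excited_state N \<beta> = c * c" using c by (simp add: inner_axis_axis)
    also have "\<dots> = 1" using c(1) by (metis abs_mult_self_eq mult_1)
    finally show ?thesis using True by simp
  qed (simp add: c d inner_axis_axis)
qed

lemma particle_space_expansion:
  assumes "N \<le> CARD('k)" and \<psi>: "\<psi> \<in> particle_space N"
  shows "\<psi> = (\<Sum>\<alpha>\<in>multiindices N. (\<psi> \<bullet> excited_state N \<alpha>) *\<^sub>R excited_state N (\<alpha> :: 'k::{finite,linorder} set))"
proof -
  have "(\<psi> \<bullet> excited_state N \<alpha>) *\<^sub>R excited_state N \<alpha> = \<psi> $ \<alpha> *\<^sub>R axis \<alpha> 1" if \<alpha>: "\<alpha> \<in> multiindices N" for \<alpha>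
  proof -
    obtain c :: real where c: "\<bar>c\<bar> = 1" "excited_state N \<alpha> = c *\<^sub>R axis \<alpha> 1"
      using excited_state_axis[OF assms(1) \<alpha>] by blast
    have "c * c = 1" using c(1) by (metis abs_mult_self_eq mult_1)
    have "(\<psi> \<bullet> excited_state N \<alpha>) *\<^sub>R excited_state N \<alpha> = ((c * c) * \<psi> $ \<alpha>) *\<^sub>R axis \<alpha> 1"
      unfolding c(2) by (simp add: inner_axis mult_ac)
    then show ?thesis unfolding \<open>c * c = 1\<close> by simp
  qed
  moreover have "\<psi> = (\<Sum>\<alpha>\<in>multiindices N. \<psi> $ \<alpha> *\<^sub>R axis \<alpha> 1)"
  proof -
    have "(\<Sum>\<alpha>\<in>multiindices N. \<psi> $ \<alpha> *\<^sub>R axis \<alpha> 1) $ S = \<psi> $ S" for S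
    proof -
      have "(\<Sum>\<alpha>\<in>multiindices N. \<psi> $ \<alpha> *\<^sub>R axis \<alpha> 1) $ S =
          (\<Sum>\<alpha>\<in>multiindices N. if \<alpha> = S then \<psi> $ S else 0)"
        unfolding sum_component by (rule sum.cong) (auto simp: axis_def)
      also have "\<dots> = \<psi> $ S"
        using \<psi> by (auto simp: particle_space_def multiindices_def)
      finally show ?thesis .
    qed
    then show ?thesis by (simp add: Finite_Cartesian_Product.vec_eq_iff)
  qed
  ultimately show ?thesis by simp
qed

lemma excitation_op_particle_space:
  "\<psi> \<in> particle_space M \<Longrightarrow> excitation_op N \<alpha> \<psi> \<in> particle_space M"
  unfolding excitation_op_pairs by (rule pairs_op_particle_space[OF excitation_pairs_zip])

lemma excitation_rank_pos:
  assumes "N \<le> CARD('k)" "\<alpha> \<in> excitations N"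
  shows "excitation_rank N (\<alpha> :: 'k::{finite,linorder} set) > 0"
proof -
  have "card \<alpha> = N" "\<alpha> \<noteq> occupied N" using assms by (auto simp: excitations_def multiindices_def)
  then have "\<not> \<alpha> \<subseteq> occupied N"
    using card_occupied[OF assms(1)] by (metis card_subset_eq finite)
  then show ?thesis by (auto simp: excitation_rank_def card_gt_0_iff)
qed

lemma excitation_op_rank_filtration:
  assumes "N \<le> CARD('k)" "\<alpha> \<in> excitations N" "(\<psi> :: 'k::{finite,linorder} fock) \<in> rank_filtration N r"
  shows "excitation_op N \<alpha> \<psi> \<in> rank_filtration N (r + excitation_rank N \<alpha>)"
proof -
  let ?ps = "zip (sorted_list_of_set (\<alpha> - occupied N)) (sorted_list_of_set (occupied N - \<alpha>))"
  have "length ?ps = excitation_rank N \<alpha>"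
    using excitation_length[OF assms(1), of \<alpha>] assms(2)
    by (simp add: excitations_def multiindices_def excitation_rank_def)
  then show ?thesis
    using pairs_op_rank_filtration[OF excitation_pairs_zip[of N \<alpha>] assms(3)]
    by (simp add: excitation_op_pairs)
qed

lemma rank_filtration_mono: "r \<le> s \<Longrightarrow> rank_filtration N s \<subseteq> rank_filtration N r"
  by (auto simp: rank_filtration_def)

lemma excited_state_rank:
  assumes "N \<le> CARD('k)" "\<alpha> \<in> multiindices N"
    and "\<psi> \<in> rank_filtration N r" "excitation_rank N \<alpha> < r"
  shows "\<psi> \<bullet> excited_state N (\<alpha> :: 'k::{finite,linorder} set) = 0"
proof -
  obtain c :: real where c: "excited_state N \<alpha> = c *\<^sub>R axis \<alpha> 1"
    using excited_state_axis[OF assms(1,2)] by blast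
  have "\<psi> $ \<alpha> = 0" using assms(3,4) by (simp add: rank_filtration_def excitation_rank_def)
  then show ?thesis by (simp add: c inner_axis)
qed

section \<open>Cluster operators\<close>

lemma linear_cluster_op: "linear (cluster_op N t)"
  by (rule linearI)
    (simp_all add: cluster_op_def linear_add[OF linear_excitation_op] linear_scale[OF linear_excitation_op]
      scaleR_add_right sum.distrib scaleR_sum_right mult.commute)

lemma bounded_bilinear_cluster_op: "bounded_bilinear (cluster_op N)"
proof -
  have "bilinear (cluster_op N)"
    unfolding bilinear_def
  proof (intro conjI allI linear_cluster_op)
    show "linear (\<lambda>t. cluster_op N t \<psi>)" for \<psi>
      by (rule linearI) (simp_all add: cluster_op_def scaleR_add_left sum.distrib scaleR_sum_right)
  qed
  then show ?thesis by (simp add: bilinear_conv_bounded_bilinear)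
qed

lemma cluster_op_minus: "cluster_op N (- t) \<psi> = - cluster_op N t \<psi>"
  by (rule bounded_bilinear.minus_left[OF bounded_bilinear_cluster_op])

lemma cluster_op_axis: "\<alpha> \<in> excitations N \<Longrightarrow> cluster_op N (axis \<alpha> 1) \<psi> = excitation_op N \<alpha> \<psi>"
proof -
  assume \<alpha>: "\<alpha> \<in> excitations N"
  have "cluster_op N (axis \<alpha> 1) \<psi> = (\<Sum>\<beta>\<in>excitations N. if \<beta> = \<alpha> then excitation_op N \<alpha> \<psi> else 0)"
    unfolding cluster_op_def by (intro sum.cong) (auto simp: axis_def)
  then show ?thesis using \<alpha> by simp
qed

lemma excitation_cluster_commute:
  "excitation_op N \<alpha> (cluster_op N t \<psi>) = cluster_op N t (excitation_op N \<alpha> \<psi>)"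
  by (simp add: cluster_op_def linear_sum[OF linear_excitation_op] linear_scale[OF linear_excitation_op]
      excitation_op_commute[of N \<alpha>])

lemma cluster_op_commute: "cluster_op N s (cluster_op N t \<psi>) = cluster_op N t (cluster_op N s \<psi>)"
  unfolding cluster_op_def[of N s]
  by (simp add: linear_sum[OF linear_cluster_op] linear_scale[OF linear_cluster_op] excitation_cluster_commute)

lemma cluster_op_particle_space:
  "\<psi> \<in> particle_space M \<Longrightarrow> cluster_op N t \<psi> \<in> particle_space M"
  unfolding cluster_op_def
  by (intro real_vector.subspace_sum[OF subspace_particle_space] real_vector.subspace_scale[OF subspace_particle_space]
      excitation_op_particle_space)

lemma cluster_op_rank_filtration:
  assumes "N \<le> CARD('k)" "(\<psi> :: 'k::{finite,linorder} fock) \<in> rank_filtration N r"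
  shows "cluster_op N t \<psi> \<in> rank_filtration N (Suc r)"
  unfolding cluster_op_def
proof (intro real_vector.subspace_sum[OF subspace_rank_filtration] real_vector.subspace_scale[OF subspace_rank_filtration])
  fix \<alpha> :: "'k set" assume \<alpha>: "\<alpha> \<in> excitations N"
  have "Suc r \<le> r + excitation_rank N \<alpha>" using excitation_rank_pos[OF assms(1) \<alpha>] by simp
  then show "excitation_op N \<alpha> \<psi> \<in> rank_filtration N (Suc r)"
    using excitation_op_rank_filtration[OF assms(1) \<alpha> assms(2)] rank_filtration_mono by blast
qed

lemma cluster_op_power_rank_filtration:
  assumes "N \<le> CARD('k)"
  shows "(cluster_op N t ^^ k) (\<psi> :: 'k::{finite,linorder} fock) \<in> rank_filtration N k"
  by (induction k) (simp_all add: cluster_op_rank_filtration[OF assms] rank_filtration_def[of N 0])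

text \<open>No determinant has more virtual orbitals than there are orbitals at all.\<close>

lemma rank_filtration_trivial:
  assumes "\<psi> \<in> rank_filtration N r" "r > CARD('k)"
  shows "(\<psi> :: 'k::{finite,linorder} fock) = 0"
proof -
  have "card (S - occupied N) < r" for S :: "'k set"
    using assms(2) card_mono[of UNIV "S - occupied N"] by simp
  then show ?thesis using assms(1) by (simp add: rank_filtration_def Finite_Cartesian_Product.vec_eq_iff)
qed

text \<open>By nilpotency the exponential series stops; the finite sum can be differentiated term by term.\<close>

definition cluster_exp :: "nat \<Rightarrow> 'k::{finite,linorder} amps \<Rightarrow> 'k fock \<Rightarrow> 'k fock" where
  "cluster_exp N t \<psi> = (\<Sum>k\<le>CARD('k). (cluster_op N t ^^ k) \<psi> /\<^sub>R fact k)"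

context
  fixes N :: nat
  assumes N: "N \<le> CARD('k::{finite,linorder})"
begin

lemma exp_cluster_op: "exp_op (cluster_op N t) (\<psi> :: 'k fock) = cluster_exp N t \<psi>"
  unfolding exp_op_def cluster_exp_def
proof (rule suminf_finite)
  fix k assume "k \<notin> {..CARD('k)}"
  then have "(cluster_op N t ^^ k) \<psi> = 0"
    by (intro rank_filtration_trivial[OF cluster_op_power_rank_filtration[OF N]]) simp
  then show "(cluster_op N t ^^ k) \<psi> /\<^sub>R fact k = 0" by simp
qed simp

lemma linear_cluster_op_power: "linear (cluster_op N t ^^ k)"
  by (induction k) (auto simp: linear_iff linear_add[OF linear_cluster_op] linear_scale[OF linear_cluster_op])

lemma linear_cluster_exp: "linear (cluster_exp N t)"
  by (rule linearI)
    (simp_all add: cluster_exp_def linear_add[OF linear_cluster_op_power] linear_scale[OF linear_cluster_op_power]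
      scaleR_add_right sum.distrib scaleR_sum_right mult.commute)

lemma cluster_op_power_commute:
  "cluster_op N s ((cluster_op N t ^^ k) \<psi>) = (cluster_op N t ^^ k) (cluster_op N s \<psi>)"
  by (induction k) (simp_all add: cluster_op_commute[of N s t])

lemma cluster_exp_commute: "cluster_op N s (cluster_exp N t \<psi>) = cluster_exp N t (cluster_op N s \<psi>)"
  by (simp add: cluster_exp_def linear_sum[OF linear_cluster_op] linear_scale[OF linear_cluster_op]
      cluster_op_power_commute)

lemma cluster_exp_particle_space:
  assumes "\<psi> \<in> particle_space M"
  shows "cluster_exp N t \<psi> \<in> particle_space M"
proof -
  have "(cluster_op N t ^^ k) \<psi> \<in> particle_space M" for k
    by (induction k) (use assms cluster_op_particle_space in auto)
  then show ?thesis
    unfolding cluster_exp_def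
    by (intro real_vector.subspace_sum[OF subspace_particle_space] real_vector.subspace_scale[OF subspace_particle_space])
qed

text \<open>The product rule; all the factors commute, so the \<open>k\<close> terms in which one factor is differentiated
  coincide.\<close>

lemma has_derivative_cluster_op_power:
  assumes \<tau>: "(\<tau> has_derivative \<tau>') (at x within X)" and g: "(g has_derivative g') (at x within X)"
  shows "((\<lambda>s. (cluster_op N (\<tau> s) ^^ k) (g s)) has_derivative
    (\<lambda>u. (cluster_op N (\<tau> x) ^^ k) (g' u) +
       real k *\<^sub>R cluster_op N (\<tau>' u) ((cluster_op N (\<tau> x) ^^ (k - 1)) (g x)))) (at x within X)"
proof (induction k)
  case 0
  then show ?case using g by simp
next
  case (Suc k)
  have "cluster_op N (\<tau> x) (real k *\<^sub>R cluster_op N (\<tau>' u) ((cluster_op N (\<tau> x) ^^ (k - 1)) (g x)))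
     = real k *\<^sub>R cluster_op N (\<tau>' u) ((cluster_op N (\<tau> x) ^^ k) (g x))" for u
    by (cases k) (simp_all add: linear_scale[OF linear_cluster_op] linear_0[OF linear_cluster_op]
        cluster_op_commute[of N "\<tau> x" "\<tau>' u"])
  then show ?case
    using bounded_bilinear.FDERIV[OF bounded_bilinear_cluster_op[of N] \<tau> Suc.IH]
    by (simp add: linear_add[OF linear_cluster_op] algebra_simps)
qed

lemma has_derivative_cluster_exp:
  fixes g :: "'a::real_normed_vector \<Rightarrow> 'k fock"
  assumes \<tau>: "(\<tau> has_derivative \<tau>') (at x within X)" and g: "(g has_derivative g') (at x within X)"
  shows "((\<lambda>s. cluster_exp N (\<tau> s) (g s)) has_derivative
    (\<lambda>u. cluster_exp N (\<tau> x) (g' u) + cluster_op N (\<tau>' u) (cluster_exp N (\<tau> x) (g x)))) (at x within X)"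
proof -
  let ?T = "cluster_op N (\<tau> x)" and ?M = "CARD('k)"
  have scale: "(real (Suc k) *\<^sub>R y) /\<^sub>R fact (Suc k) = y /\<^sub>R fact k" for k and y :: "'k fock"
  proof -
    have "inverse (fact (Suc k)) * real (Suc k) = inverse (fact k :: real)"
      by (simp add: field_simps del: of_nat_Suc)
    then show ?thesis by (simp only: scaleR_scaleR)
  qed
  have shift: "(\<Sum>k\<le>?M. (real k *\<^sub>R cluster_op N v ((?T ^^ (k - 1)) (g x))) /\<^sub>R fact k) =
      cluster_op N v (cluster_exp N (\<tau> x) (g x))" for v
  proof -
    have "(\<Sum>k\<le>?M. (real k *\<^sub>R cluster_op N v ((?T ^^ (k - 1)) (g x))) /\<^sub>R fact k) =
        (\<Sum>k<?M. cluster_op N v ((?T ^^ k) (g x)) /\<^sub>R fact k)"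
      unfolding lessThan_Suc_atMost[symmetric] sum.lessThan_Suc_shift scale by simp
    also have "\<dots> = (\<Sum>k\<le>?M. cluster_op N v ((?T ^^ k) (g x)) /\<^sub>R fact k)"
    proof -
      \<comment> \<open>the term missing on the left raises the rank beyond the number of orbitals\<close>
      have "cluster_op N v ((?T ^^ ?M) (g x)) \<in> rank_filtration N (Suc ?M)"
        by (intro cluster_op_rank_filtration[OF N] cluster_op_power_rank_filtration[OF N])
      then have "cluster_op N v ((?T ^^ ?M) (g x)) = 0"
        by (rule rank_filtration_trivial) simp
      then show ?thesis unfolding lessThan_Suc_atMost[symmetric] by simp
    qed
    finally show ?thesis
      by (simp add: cluster_exp_def linear_sum[OF linear_cluster_op] linear_scale[OF linear_cluster_op])
  qed
  have "((\<lambda>s. cluster_exp N (\<tau> s) (g s)) has_derivative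
    (\<lambda>u. \<Sum>k\<le>?M. ((?T ^^ k) (g' u) + real k *\<^sub>R cluster_op N (\<tau>' u) ((?T ^^ (k - 1)) (g x))) /\<^sub>R fact k))
    (at x within X)"
    unfolding cluster_exp_def
    by (intro has_derivative_sum has_derivative_scaleR_right has_derivative_cluster_op_power[OF \<tau> g])
  moreover have "(\<Sum>k\<le>?M. ((?T ^^ k) (g' u) + real k *\<^sub>R cluster_op N (\<tau>' u) ((?T ^^ (k - 1)) (g x))) /\<^sub>R fact k) =
      cluster_exp N (\<tau> x) (g' u) + cluster_op N (\<tau>' u) (cluster_exp N (\<tau> x) (g x))" for u
    unfolding scaleR_add_right sum.distrib shift by (simp only: cluster_exp_def)
  ultimately show ?thesis by simp
qed

lemma similarity_cluster_exp:
  "similarity N H t (\<psi> :: 'k fock) = cluster_exp N (- t) (H (cluster_exp N t \<psi>))"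
proof -
  have "(\<lambda>\<psi>. - cluster_op N t \<psi>) = cluster_op N (- t)" by (simp add: cluster_op_minus fun_eq_iff)
  then show ?thesis by (simp add: similarity_def exp_cluster_op)
qed

lemma linear_similarity:
  assumes "linear H"
  shows "linear (similarity N H (t :: 'k amps))"
  by (rule linearI)
    (simp_all add: similarity_cluster_exp linear_add[OF linear_cluster_exp] linear_scale[OF linear_cluster_exp]
      linear_add[OF assms] linear_scale[OF assms])

text \<open>The derivative is the commutator of the transformed operator with the cluster operator of the
  direction.\<close>

lemma has_derivative_similarity:
  fixes \<tau> :: "'a::real_normed_vector \<Rightarrow> 'k amps"
  assumes H: "linear H" and \<tau>: "(\<tau> has_derivative \<tau>') (at x within X)"
  shows "((\<lambda>s. similarity N H (\<tau> s) \<psi>) has_derivative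
    (\<lambda>u. similarity N H (\<tau> x) (cluster_op N (\<tau>' u) \<psi>) - cluster_op N (\<tau>' u) (similarity N H (\<tau> x) \<psi>)))
    (at x within X)"
proof -
  have "((\<lambda>s. cluster_exp N (\<tau> s) \<psi>) has_derivative
      (\<lambda>u. cluster_op N (\<tau>' u) (cluster_exp N (\<tau> x) \<psi>))) (at x within X)"
    using has_derivative_cluster_exp[OF \<tau> has_derivative_const[of \<psi>]]
    by (simp add: linear_0[OF linear_cluster_exp])
  from bounded_linear.has_derivative[OF linear_conv_bounded_linear[THEN iffD1, OF H] this]
  have "((\<lambda>s. H (cluster_exp N (\<tau> s) \<psi>)) has_derivative
      (\<lambda>u. H (cluster_op N (\<tau>' u) (cluster_exp N (\<tau> x) \<psi>)))) (at x within X)" .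
  from has_derivative_cluster_exp[OF has_derivative_minus[OF \<tau>] this]
  show ?thesis
    unfolding similarity_cluster_exp cluster_op_minus cluster_exp_commute[of _ "\<tau> x"] by simp
qed

end

section \<open>The index of a zero with invertible derivative\<close>

definition axis_list :: "'b list \<Rightarrow> (real^'b::finite) list" where
  "axis_list xs = map (\<lambda>\<alpha>. axis \<alpha> 1) xs"

lemma length_axis_list [simp]: "length (axis_list xs) = length xs"
  by (simp add: axis_list_def)

lemma axis_list_nth: "i < length xs \<Longrightarrow> axis_list xs ! i = axis (xs ! i) 1"
  by (simp add: axis_list_def)

lemma orthonormal_axis_list: "distinct xs \<Longrightarrow> orthonormal_list (axis_list xs)"
  by (auto simp: orthonormal_list_def axis_list_def inner_axis_axis nth_eq_iff_index_eq)

lemma amp_space_expansion: "t \<in> amp_space \<Xi> \<Longrightarrow> t = (\<Sum>\<alpha>\<in>\<Xi>. (t $ \<alpha>) *\<^sub>R axis \<alpha> 1)"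
proof -
  assume t: "t \<in> amp_space \<Xi>"
  have "(\<Sum>\<alpha>\<in>\<Xi>. (t $ \<alpha>) *\<^sub>R axis \<alpha> 1) $ \<beta> = t $ \<beta>" for \<beta>
  proof -
    have "(\<Sum>\<alpha>\<in>\<Xi>. (t $ \<alpha>) *\<^sub>R axis \<alpha> 1) $ \<beta> = (\<Sum>\<alpha>\<in>\<Xi>. if \<alpha> = \<beta> then t $ \<beta> else 0)"
      unfolding sum_component by (rule sum.cong) (auto simp: axis_def)
    also have "\<dots> = t $ \<beta>" using t by (auto simp: amp_space_def)
    finally show ?thesis .
  qed
  then show ?thesis by (simp add: Finite_Cartesian_Product.vec_eq_iff)
qed

lemma axis_in_amp_space: "\<alpha> \<in> \<Xi> \<Longrightarrow> axis \<alpha> c \<in> amp_space \<Xi>"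
  by (auto simp: amp_space_def axis_def)

lemma subspace_amp_space: "real_vector.subspace (amp_space \<Xi>)"
  by (auto simp: amp_space_def intro: real_vector.subspaceI)

lemma span_axis_list: "span (set (axis_list xs)) = amp_space (set xs)"
proof
  show "span (set (axis_list xs)) \<subseteq> amp_space (set xs)"
    by (intro span_minimal subspace_amp_space) (auto simp: axis_list_def axis_in_amp_space)
  show "amp_space (set xs) \<subseteq> span (set (axis_list xs))"
  proof
    fix t :: "'a amps" assume "t \<in> amp_space (set xs)"
    then have "t = (\<Sum>\<alpha>\<in>set xs. (t $ \<alpha>) *\<^sub>R axis \<alpha> 1)" by (rule amp_space_expansion)
    also have "\<dots> \<in> span (set (axis_list xs))"
      by (intro span_sum span_scale span_base) (auto simp: axis_list_def)
    finally show "t \<in> span (set (axis_list xs))" .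
  qed
qed

text \<open>Coordinates with respect to the basis identify the kernel of \<open>D\<close> on the span with the kernel of its
  matrix.\<close>

lemma basis_matrix_kernel:
  fixes bs :: "'a::euclidean_space list"
  assumes bs: "orthonormal_list bs" and D: "linear D" and range: "D ` span (set bs) \<subseteq> span (set bs)"
  shows "det (basis_matrix bs D) = 0 \<longleftrightarrow> (\<exists>x\<in>span (set bs). x \<noteq> 0 \<and> D x = 0)"
proof -
  let ?n = "length bs" and ?M = "basis_matrix bs D"
  have image: "vec_index (?M *\<^sub>v v) i = D (\<Sum>j<?n. vec_index v j *\<^sub>R bs ! j) \<bullet> bs ! i"
    if "v \<in> carrier_vec ?n" "i < ?n" for v i
    using that by (simp add: basis_matrix_def scalar_prod_def atLeast0LessThan inner_sum_left
        linear_sum[OF D] linear_scale[OF D] mult.commute)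
  have coords: "(\<Sum>j<?n. c j *\<^sub>R bs ! j) \<bullet> bs ! i = c i" if "i < ?n" for c i
  proof -
    have "(\<Sum>j<?n. c j *\<^sub>R bs ! j) \<bullet> bs ! i = (\<Sum>j<?n. if j = i then c i else 0)"
      unfolding inner_sum_left by (rule sum.cong) (use bs that in \<open>auto simp: orthonormal_list_def\<close>)
    then show ?thesis using that by simp
  qed
  show ?thesis
  proof
    assume "det ?M = 0"
    then obtain v where v: "v \<in> carrier_vec ?n" "v \<noteq> 0\<^sub>v ?n" "?M *\<^sub>v v = 0\<^sub>v ?n"
      using det_0_iff_vec_prod_zero[OF basis_matrix_carrier[of bs D]] by blast
    define x where "x = (\<Sum>j<?n. vec_index v j *\<^sub>R bs ! j)"
    have x: "x \<in> span (set bs)" unfolding x_def by (intro span_sum span_scale span_base) simp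
    have "D x \<in> span (set bs)" using range x by blast
    from orthonormal_list_expansion[OF bs this]
    have "D x = 0" using image[OF v(1)] v(3) by (simp add: x_def)
    moreover have "x \<noteq> 0"
    proof
      assume "x = 0"
      then have "vec_index v i = 0" if "i < ?n" for i
        using coords[OF that, of "vec_index v"] by (simp add: x_def)
      then have "v = 0\<^sub>v ?n" using v(1) by (intro eq_vecI) auto
      then show False using v(2) by simp
    qed
    ultimately show "\<exists>x\<in>span (set bs). x \<noteq> 0 \<and> D x = 0" using x by blast
  next
    assume "\<exists>x\<in>span (set bs). x \<noteq> 0 \<and> D x = 0"
    then obtain x where x: "x \<in> span (set bs)" "x \<noteq> 0" "D x = 0" by blast
    define v where "v = vec ?n (\<lambda>i. x \<bullet> bs ! i)"
    have xv: "x = (\<Sum>j<?n. vec_index v j *\<^sub>R bs ! j)"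
      by (subst orthonormal_list_expansion[OF bs x(1)]) (simp add: v_def)
    have v: "v \<in> carrier_vec ?n" by (simp add: v_def)
    have "?M *\<^sub>v v = 0\<^sub>v ?n"
    proof (rule eq_vecI)
      fix i assume "i < dim_vec (0\<^sub>v ?n :: real Matrix.vec)"
      then have "i < ?n" by simp
      then show "vec_index (?M *\<^sub>v v) i = vec_index (0\<^sub>v ?n) i"
        using image[OF v] x(3) by (simp add: xv[symmetric])
    qed (simp add: basis_matrix_def)
    moreover have "v \<noteq> 0\<^sub>v ?n"
    proof
      assume "v = 0\<^sub>v ?n"
      then have "x = 0" using xv by simp
      then show False using x(2) by simp
    qed
    ultimately show "det ?M = 0"
      using det_0_iff_vec_prod_zero[OF basis_matrix_carrier[of bs D]] v by blast
  qed
qed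

lemma bij_betw_iff_det:
  fixes bs :: "'a::euclidean_space list"
  assumes bs: "orthonormal_list bs" and W: "span (set bs) = W" and D: "linear D" and range: "D ` W \<subseteq> W"
  shows "bij_betw D W W \<longleftrightarrow> det (basis_matrix bs D) \<noteq> 0"
proof -
  have sub: "real_vector.subspace W" unfolding W[symmetric] by (rule subspace_span)
  have det: "det (basis_matrix bs D) \<noteq> 0 \<longleftrightarrow> (\<forall>x\<in>W. D x = 0 \<longrightarrow> x = 0)"
    using basis_matrix_kernel[OF bs D] range W by blast
  have inj: "inj_on D W \<longleftrightarrow> (\<forall>x\<in>W. D x = 0 \<longrightarrow> x = 0)"
    using linear_inj_on_iff_eq_0[OF D sub] .
  have "D ` W = W" if "inj_on D W"
  proof (rule subspace_dim_equal)
    show "real_vector.subspace (D ` W)" by (rule linear_subspace_image[OF D sub])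
    show "dim W \<le> dim (D ` W)"
      using dim_image_eq[OF D, of W] that span_eq_iff[THEN iffD2, OF sub] by simp
  qed (use sub range in auto)
  then show ?thesis unfolding bij_betw_def det using inj by blast
qed

text \<open>A derivative within a subspace is determined only along the subspace, by the directional
  derivatives; this suffices to decide bijectivity on the subspace with any one derivative.\<close>

lemma has_derivative_unique_on_subspace:
  fixes f :: "'a::real_normed_vector \<Rightarrow> 'b::real_normed_vector"
  assumes W: "real_vector.subspace W" "u \<in> W" "v \<in> W"
    and D: "(f has_derivative D) (at u within W)" and D': "(f has_derivative D') (at u within W)"
  shows "D v = D' v"
proof -
  let ?l = "\<lambda>h::real. u + h *\<^sub>R v"
  have l: "(?l has_derivative (\<lambda>h. h *\<^sub>R v)) (at 0)"
    by (auto intro!: derivative_eq_intros)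
  have im: "?l ` UNIV \<subseteq> W"
    using W by (auto intro: real_vector.subspace_add real_vector.subspace_scale)
  have chain: "((\<lambda>h. f (?l h)) has_derivative (\<lambda>h. E (h *\<^sub>R v))) (at 0)"
    if "(f has_derivative E) (at u within W)" for E
  proof -
    have "(f has_derivative E) (at (?l 0) within ?l ` UNIV)"
      using has_derivative_subset[OF that im] by simp
    from has_derivative_in_compose[OF l this] show ?thesis by simp
  qed
  have "(\<lambda>h::real. D (h *\<^sub>R v)) = (\<lambda>h. D' (h *\<^sub>R v))"
    by (rule has_derivative_unique[OF chain[OF D] chain[OF D']])
  from fun_cong[OF this, of 1] show ?thesis by simp
qed

lemma nondegenerate_iff_det:
  assumes xs: "distinct xs" "set xs = \<Xi>" and u: "u \<in> amp_space \<Xi>"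
    and D: "((\<lambda>t. dual_coords \<Xi> (F t)) has_derivative D) (at u within amp_space \<Xi>)"
    and range: "D ` amp_space \<Xi> \<subseteq> amp_space \<Xi>"
  shows "nondegenerate \<Xi> F u \<longleftrightarrow> det (basis_matrix (axis_list xs) D) \<noteq> 0"
proof -
  have "nondegenerate \<Xi> F u \<longleftrightarrow> bij_betw D (amp_space \<Xi>) (amp_space \<Xi>)"
  proof
    assume "nondegenerate \<Xi> F u"
    then obtain D' where D': "((\<lambda>t. dual_coords \<Xi> (F t)) has_derivative D') (at u within amp_space \<Xi>)"
      "bij_betw D' (amp_space \<Xi>) (amp_space \<Xi>)" unfolding nondegenerate_def by blast
    then show "bij_betw D (amp_space \<Xi>) (amp_space \<Xi>)"
      using has_derivative_unique_on_subspace[OF subspace_amp_space u _ D D'(1)]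
      by (metis bij_betw_cong)
  qed (use D in \<open>auto simp: nondegenerate_def\<close>)
  also have "\<dots> \<longleftrightarrow> det (basis_matrix (axis_list xs) D) \<noteq> 0"
    by (rule bij_betw_iff_det)
       (use xs range has_derivative_linear[OF D] in \<open>auto simp: orthonormal_axis_list span_axis_list\<close>)
  finally show ?thesis .
qed

lemma is_zero_on_dual_coords: "is_zero_on \<Xi> F x \<Longrightarrow> dual_coords \<Xi> (F x) = 0"
  by (simp add: is_zero_on_def dual_coords_def Finite_Cartesian_Product.vec_eq_iff axis_in_amp_space)

lemma dual_coords_amp_space: "dual_coords \<Xi> g \<in> amp_space \<Xi>"
  by (simp add: dual_coords_def amp_space_def)

lemma norm_amp_space:
  assumes "v \<in> amp_space \<Xi>" "bij_betw e {..<n} \<Xi>"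
  shows "norm v = sqrt (\<Sum>i<n. (v $ e i)\<^sup>2)"
proof -
  have "(norm v)\<^sup>2 = (\<Sum>\<alpha>\<in>UNIV. (v $ \<alpha>)\<^sup>2)"
    by (simp add: norm_vec_def L2_set_def sum_nonneg)
  also have "\<dots> = (\<Sum>\<alpha>\<in>\<Xi>. (v $ \<alpha>)\<^sup>2)"
    using assms(1) by (intro sum.mono_neutral_right) (auto simp: amp_space_def)
  also have "\<dots> = (\<Sum>i<n. (v $ e i)\<^sup>2)"
    using sum.reindex_bij_betw[OF assms(2), of "\<lambda>\<alpha>. (v $ \<alpha>)\<^sup>2"] by simp
  finally show ?thesis by (metis norm_ge_zero real_sqrt_unique)
qed

context
  fixes \<Xi> :: "'k::finite set set" and F :: "'k amps \<Rightarrow> 'k amps \<Rightarrow> real" and u :: "'k amps"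
    and D :: "'k amps \<Rightarrow> 'k amps" and xs :: "'k set list"
  assumes zero: "is_zero_on \<Xi> F u"
    and cont: "continuous_on (amp_space \<Xi>) (\<lambda>t. dual_coords \<Xi> (F t))"
    and D: "((\<lambda>t. dual_coords \<Xi> (F t)) has_derivative D) (at u within amp_space \<Xi>)"
    and range: "D ` amp_space \<Xi> \<subseteq> amp_space \<Xi>"
    and xs: "distinct xs" "set xs = \<Xi>"
    and det: "det (basis_matrix (axis_list xs) D) \<noteq> 0"
begin

private abbreviation "f \<equiv> \<lambda>t. dual_coords \<Xi> (F t)"

text \<open>\<open>D\<close> is injective and hence bounded below on the amplitude space; near \<open>u\<close> the remainder is at most
  half of that bound.  So neither \<open>F\<close> nor the segment from \<open>F\<close> to its linearization can vanish
  close to \<open>u\<close>.\<close>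

lemma linearization_lower_bound:
  obtains m \<delta> where "m > 0" "\<delta> > 0"
    "\<And>v. v \<in> amp_space \<Xi> \<Longrightarrow> m * norm v \<le> norm (D v)"
    "\<And>v. v \<in> amp_space \<Xi> \<Longrightarrow> norm v < \<delta> \<Longrightarrow> norm (f (u + v) - D v) \<le> m / 2 * norm v"
proof -
  have u: "u \<in> amp_space \<Xi>" using zero by (simp add: is_zero_on_def)
  have lin: "bounded_linear D" using D by (rule has_derivative_bounded_linear)
  have "inj_on D (amp_space \<Xi>)"
    using bij_betw_iff_det[OF orthonormal_axis_list[OF xs(1)] span_axis_list bounded_linear.linear[OF lin]]
      range det xs by (simp add: bij_betw_def)
  then have "\<forall>v\<in>amp_space \<Xi>. D v = 0 \<longrightarrow> v = 0"
    using linear_inj_on_iff_eq_0[OF bounded_linear.linear[OF lin] subspace_amp_space] by blast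
  from injective_imp_isometric[OF closed_subspace[OF subspace_amp_space] subspace_amp_space lin this]
  obtain m where m: "m > 0" "\<And>v. v \<in> amp_space \<Xi> \<Longrightarrow> m * norm v \<le> norm (D v)" by blast
  have "m / 2 > 0" using m by simp
  with D obtain \<delta> where \<delta>: "\<delta> > 0" "\<And>y. y \<in> amp_space \<Xi> \<Longrightarrow> norm (y - u) < \<delta> \<Longrightarrow>
      norm (f y - f u - D (y - u)) \<le> m / 2 * norm (y - u)"
    unfolding has_derivative_within_alt by blast
  have "norm (f (u + v) - D v) \<le> m / 2 * norm v" if "v \<in> amp_space \<Xi>" "norm v < \<delta>" for v
    using \<delta>(2)[of "u + v"] that real_vector.subspace_add[OF subspace_amp_space u that(1)]
      is_zero_on_dual_coords[OF zero] by simp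
  with m \<delta>(1) that show ?thesis by blast
qed

lemma isolated_zero_of_det: "isolated_zero \<Xi> F u"
proof -
  have u: "u \<in> amp_space \<Xi>" using zero by (simp add: is_zero_on_def)
  obtain m \<delta> where m: "m > 0" "\<delta> > 0"
    "\<And>v. v \<in> amp_space \<Xi> \<Longrightarrow> m * norm v \<le> norm (D v)"
    "\<And>v. v \<in> amp_space \<Xi> \<Longrightarrow> norm v < \<delta> \<Longrightarrow> norm (f (u + v) - D v) \<le> m / 2 * norm v"
    by (rule linearization_lower_bound) blast
  have "\<not> is_zero_on \<Xi> F x" if x: "x \<in> amp_space \<Xi>" "0 < dist x u" "dist x u < \<delta>" for x
  proof
    assume "is_zero_on \<Xi> F x"
    then have "f x = 0" by (rule is_zero_on_dual_coords)
    define v where "v = x - u"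
    have v: "v \<in> amp_space \<Xi>" unfolding v_def by (rule real_vector.subspace_diff[OF subspace_amp_space x(1) u])
    have nv: "norm v > 0" "norm v < \<delta>" using x by (auto simp: v_def dist_norm)
    have "norm (D v) \<le> m / 2 * norm v" using m(4)[OF v nv(2)] \<open>f x = 0\<close> by (simp add: v_def)
    moreover have "m * norm v > m / 2 * norm v" using m(1) nv(1) by simp
    ultimately show False using m(3)[OF v] by linarith
  qed
  then show ?thesis using zero m(2) unfolding isolated_zero_def by blast
qed

text \<open>The straight-line homotopy from \<open>F\<close> on the sphere of radius \<open>r\<close> to \<open>r D\<close> does not meet 0, and the
  positive factor \<open>r\<close> disappears in the radial projection.\<close>

lemma ball_degree_eventually:
  "\<forall>\<^sub>F r in at_right 0. real_of_int (ball_degree \<Xi> F u r) = sgn (det (basis_matrix (axis_list xs) D))"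
proof (cases "\<Xi> = {}")
  case True
  then have "det (basis_matrix (axis_list xs) D) = 1"
    using xs \<comment> \<open>the empty determinant matches the degree 1 at an isolated point\<close>
    by (intro det_dim_zero) (simp add: basis_matrix_def axis_list_def)
  then show ?thesis using True zero by (simp add: ball_degree_def)
next
  case nonempty: False
  define n where "n = card \<Xi>"
  define p where "p = n - 1"
  have n: "n = Suc p" using nonempty by (simp add: p_def n_def card_gt_0_iff)
  define e where "e = (SOME e. bij_betw e {..<n} \<Xi>)"
  have e: "bij_betw e {..<n} \<Xi>"
  proof -
    have "\<exists>e. bij_betw e {..<n} \<Xi>"
      using ex_bij_betw_nat_finite[of \<Xi>] by (simp add: n_def atLeast0LessThan)
    then show ?thesis unfolding e_def by (rule someI_ex)
  qed
  define L where "L x = (\<Sum>i<n. x i *\<^sub>R axis (e i) (1::real))" for x :: "nat \<Rightarrow> real"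
  have eX: "e i \<in> \<Xi>" if "i < n" for i using e that by (auto simp: bij_betw_def)
  have L: "L x \<in> amp_space \<Xi>" for x
    unfolding L_def
    by (intro real_vector.subspace_sum[OF subspace_amp_space] real_vector.subspace_scale[OF subspace_amp_space])
       (auto intro: axis_in_amp_space eX)
  have L_nth: "L x $ e i = x i" if "i < n" for x i
  proof -
    have "L x $ e i = (\<Sum>j<n. if j = i then x i else 0)"
      unfolding L_def sum_component
      using e that by (intro sum.cong) (auto simp: axis_def bij_betw_def inj_on_def)
    then show ?thesis using that by simp
  qed
  have normL: "norm (L x) = 1" if "x \<in> topspace (nsphere p)" for x
  proof -
    have "norm (L x) = sqrt (\<Sum>i<n. (L x $ e i)\<^sup>2)" by (rule norm_amp_space[OF L e])
    also have "(\<Sum>i<n. (L x $ e i)\<^sup>2) = (\<Sum>i<n. (x i)\<^sup>2)" by (rule sum.cong) (simp_all add: L_nth)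
    also have "\<dots> = 1" using that by (simp add: topspace_nsphere_iff n lessThan_Suc_atMost del: sum.lessThan_Suc)
    finally show ?thesis by simp
  qed
  define es where "es = map e [0..<n]"
  have es: "distinct es" "set es = \<Xi>" "length es = n"
    using e by (auto simp: es_def distinct_map bij_betw_def atLeast0LessThan)
  have lin: "linear D" using D by (rule has_derivative_linear)
  let ?J = "basis_matrix (axis_list es) D"
  have J: "?J \<in> carrier_mat (Suc p) (Suc p)" using basis_matrix_carrier[of "axis_list es" D] es n by simp
  have detJ: "det ?J = det (basis_matrix (axis_list xs) D)"
    by (intro det_similar basis_matrix_similar orthonormal_axis_list es xs lin)
       (simp add: span_axis_list es xs)
  have matJ: "matrix_map ?J x i = D (L x) $ e i" if "i < n" for x i
  proof -
    have "D (L x) = (\<Sum>j<n. x j *\<^sub>R D (axis (e j) 1))"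
      by (simp add: L_def linear_sum[OF lin] linear_scale[OF lin])
    then have "D (L x) $ e i = (\<Sum>j<n. x j * (D (axis (e j) 1) $ e i))" by simp
    also have "\<dots> = matrix_map ?J x i"
      unfolding matrix_map_def
      using that es by (intro sum.cong) (auto simp: basis_matrix_def axis_list_nth es_def inner_axis)
    finally show ?thesis by simp
  qed
  obtain m \<delta> where m: "m > 0" "\<delta> > 0"
    "\<And>v. v \<in> amp_space \<Xi> \<Longrightarrow> m * norm v \<le> norm (D v)"
    "\<And>v. v \<in> amp_space \<Xi> \<Longrightarrow> norm v < \<delta> \<Longrightarrow> norm (f (u + v) - D v) \<le> m / 2 * norm v"
    by (rule linearization_lower_bound) blast
  have u: "u \<in> amp_space \<Xi>" using zero by (simp add: is_zero_on_def)
  have "real_of_int (ball_degree \<Xi> F u r) = sgn (det (basis_matrix (axis_list xs) D))"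
    if r: "0 < r" "r < \<delta>" for r
  proof -
    define g where "g x = f (u + r *\<^sub>R L x)" for x
    have rL: "r *\<^sub>R L x \<in> amp_space \<Xi>" for x
      by (rule real_vector.subspace_scale[OF subspace_amp_space L])
    define G where "G s x i = (1 - s) * (g x $ e i) + s * (r * (D (L x) $ e i))" for s :: real and x i
    have "ball_degree \<Xi> F u r = Brouwer_degree2 p (\<lambda>x i. if i < n then g x $ e i / norm (g x) else 0)"
      unfolding ball_degree_def Let_def g_def L_def e_def p_def n_def using nonempty by simp
    also have "(\<lambda>x i. if i < n then g x $ e i / norm (g x) else 0) = (\<lambda>x. sphere_normalize p (\<lambda>i. g x $ e i))"
      unfolding sphere_normalize_def g_def norm_amp_space[OF dual_coords_amp_space e]
      by (simp add: n less_Suc_eq_le lessThan_Suc_atMost del: sum.lessThan_Suc cong: if_cong)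
    also have "\<dots> = (\<lambda>x. sphere_normalize p (G 0 x))" by (simp add: G_def[abs_def])
    also have "Brouwer_degree2 p \<dots> = Brouwer_degree2 p (\<lambda>x. sphere_normalize p (G 1 x))"
    proof (rule Brouwer_degree2_homotopic, rule sphere_normalize_homotopic)
      let ?X = "prod_topology (top_of_set {0..1::real}) (nsphere p)"
      fix i assume "i \<le> p"
      have Lcont: "continuous_map (nsphere p) euclidean L"
        unfolding L_def
      proof (rule continuous_map_sum)
        fix i
        have "continuous_map euclideanreal euclidean (\<lambda>a::real. a *\<^sub>R axis (e i) (1::real))"
          by (auto intro!: continuous_on_const continuous_on_scaleR continuous_on_id)
        from continuous_map_compose[OF continuous_map_nsphere_projection this]
        show "continuous_map (nsphere p) euclidean (\<lambda>x. x i *\<^sub>R axis (e i) (1::real))" by (simp add: o_def)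
      qed simp
      have "continuous_map euclidean euclidean (\<lambda>v. u + r *\<^sub>R v)"
        by (auto intro!: continuous_on_add continuous_on_const continuous_on_scaleR continuous_on_id)
      from continuous_map_compose[OF Lcont this]
      have shift: "continuous_map (nsphere p) (top_of_set (amp_space \<Xi>)) (\<lambda>x. u + r *\<^sub>R L x)"
        using real_vector.subspace_add[OF subspace_amp_space u rL]
        by (auto simp: continuous_map_in_subtopology o_def)
      have "continuous_map (top_of_set (amp_space \<Xi>)) euclideanreal (\<lambda>y. f y $ e i)"
        using cont by (auto intro: continuous_on_component)
      from continuous_map_compose[OF shift this]
      have gc: "continuous_map (nsphere p) euclideanreal (\<lambda>x. g x $ e i)"
        by (simp add: g_def o_def)
      have "continuous_map euclidean euclideanreal (\<lambda>v. D v $ e i)"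
        using linear_continuous_on[OF linear_conv_bounded_linear[THEN iffD1, OF lin]]
        by (auto intro: continuous_on_component)
      from continuous_map_compose[OF Lcont this]
      have Dc: "continuous_map (nsphere p) euclideanreal (\<lambda>x. D (L x) $ e i)" by (simp add: o_def)
      have fst: "continuous_map ?X euclideanreal fst"
        using continuous_map_fst continuous_map_into_fulltopology by blast
      have snd: "continuous_map ?X euclideanreal (\<lambda>z. h (snd z))"
        if "continuous_map (nsphere p) euclideanreal h" for h
        using continuous_map_compose[OF continuous_map_snd that] by (simp add: o_def)
      show "continuous_map ?X euclideanreal (\<lambda>(s, x). G s x i)"
        unfolding G_def case_prod_beta'
        by (intro continuous_map_add continuous_map_real_mult continuous_map_diff fst snd[OF gc] snd[OF Dc])
           simp_all
    next
      fix s x assume s: "s \<in> {0..1::real}" and x: "x \<in> topspace (nsphere p)"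
      let ?v = "r *\<^sub>R L x"
      have nv: "norm ?v = r" using normL[OF x] r by simp
      have Dv: "D ?v = r *\<^sub>R D (L x)" by (rule linear_scale[OF lin])
      define y where "y = (1 - s) *\<^sub>R g x + s *\<^sub>R D ?v"
      have y: "y \<in> amp_space \<Xi>"
        unfolding y_def g_def using range rL
        by (intro real_vector.subspace_add[OF subspace_amp_space] real_vector.subspace_scale[OF subspace_amp_space]
            dual_coords_amp_space) blast
      have "norm (y - D ?v) = norm ((1 - s) *\<^sub>R (g x - D ?v))"
        by (simp add: y_def algebra_simps)
      also have "\<dots> \<le> norm (g x - D ?v)"
        using s by (simp add: mult_left_le_one_le)
      also have "\<dots> \<le> m / 2 * r" using m(4)[OF rL, of x] nv r by (simp add: g_def)
      finally have "norm (y - D ?v) < m * r" using m(1) r(1) by (smt (verit) field_sum_of_halves mult_pos_pos mult_less_cancel_right)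
      then have "y \<noteq> 0" using m(3)[OF rL, of x] nv by auto
      then have "norm y \<noteq> 0" by simp
      then have "(\<Sum>i<n. (y $ e i)\<^sup>2) \<noteq> 0"
        unfolding norm_amp_space[OF y e] by simp
      then obtain i where "i < n" "y $ e i \<noteq> 0" by (metis (mono_tags, lifting) lessThan_iff sum.neutral zero_power2)
      then show "\<exists>i\<le>p. G s x i \<noteq> 0"
        by (intro exI[of _ i]) (simp add: y_def G_def Dv n)
    qed
    also have "(\<lambda>x. sphere_normalize p (G 1 x)) = (\<lambda>x. sphere_normalize p (matrix_map ?J x))"
    proof
      fix x
      have "sphere_normalize p (G 1 x) = sphere_normalize p (\<lambda>i. matrix_map ?J x i / (1 / r))"
        by (rule sphere_normalize_cong) (simp add: G_def matJ n mult.commute)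
      then show "sphere_normalize p (G 1 x) = sphere_normalize p (matrix_map ?J x)"
        using r by (simp add: sphere_normalize_scale del: divide_divide_eq_right)
    qed
    finally have "ball_degree \<Xi> F u r = linear_degree p ?J" by (simp add: linear_degree_def)
    then show ?thesis
      using linear_degree_eq_sgn_det[OF J] det detJ by simp
  qed
  then show ?thesis
    unfolding eventually_at_right_field using m(2) by blast
qed

theorem topological_index_eq_sgn_det:
  "real_of_int (topological_index \<Xi> F u) = sgn (det (basis_matrix (axis_list xs) D))"
proof -
  let ?d = "topological_index \<Xi> F u"
  obtain d :: int where d: "real_of_int d = sgn (det (basis_matrix (axis_list xs) D))"
    by (metis of_int_0 of_int_1 of_int_minus sgn_real_def)
  have ev: "\<forall>\<^sub>F r in at_right 0. ball_degree \<Xi> F u r = d"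
    using ball_degree_eventually by eventually_elim (use d in simp)
  have "?d = d"
    unfolding topological_index_def
  proof (rule the_equality)
    show "\<forall>\<^sub>F r in at_right 0. ball_degree \<Xi> F u r = d" by (rule ev)
  next
    fix d' assume "\<forall>\<^sub>F r in at_right 0. ball_degree \<Xi> F u r = d'"
    with ev have "\<forall>\<^sub>F r::real in at_right 0. d' = d" by eventually_elim simp
    then show "d' = d" by (simp add: trivial_limit_at_right_real)
  qed
  then show ?thesis using d by simp
qed

end

section \<open>The derivative at a zero is block triangular\<close>

lemma linear_hamiltonian: "linear (hamiltonian TYPE('n::{finite,linorder}) \<phi> V w)"
  by (rule linearI)
    (simp_all add: hamiltonian_def distrib_right scaleR_add_left sum.distrib scaleR_sum_right mult.assoc)

lemma hamiltonian_particle_space: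
  "hamiltonian TYPE('n::{finite,linorder}) \<phi> V w \<psi> \<in> particle_space CARD('n)"
  unfolding hamiltonian_def
  by (intro real_vector.subspace_sum[OF subspace_particle_space]
      real_vector.subspace_scale[OF subspace_particle_space])
     (auto simp: particle_space_def multiindices_def axis_def)

lemma cluster_op_ref_state:
  "cluster_op N t (ref_state N) = (\<Sum>\<alpha>\<in>excitations N. (t $ \<alpha>) *\<^sub>R excited_state N \<alpha>)"
  by (simp add: cluster_op_def excited_state_def)

lemma cluster_states_eq_span:
  assumes "\<Xi> \<subseteq> excitations N"
  shows "cluster_states N \<Xi> = span (excited_state N ` \<Xi>)"
proof -
  have lin: "linear (\<lambda>t. cluster_op N t (ref_state N))"
    using bounded_bilinear.bounded_linear_left[OF bounded_bilinear_cluster_op]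
    by (rule bounded_linear.linear)
  obtain xs where xs: "set xs = \<Xi>" using finite_list[of \<Xi>] by auto
  have "cluster_states N \<Xi> = (\<lambda>t. cluster_op N t (ref_state N)) ` amp_space \<Xi>"
    by (auto simp: cluster_states_def)
  also have "\<dots> = (\<lambda>t. cluster_op N t (ref_state N)) ` span ((\<lambda>\<alpha>. axis \<alpha> 1) ` \<Xi>)"
    using span_axis_list[of xs] xs by (simp add: axis_list_def)
  also have "\<dots> = span ((\<lambda>t. cluster_op N t (ref_state N)) ` (\<lambda>\<alpha>. axis \<alpha> 1) ` \<Xi>)"
    by (rule linear_span_image[OF lin, symmetric])
  also have "(\<lambda>t. cluster_op N t (ref_state N)) ` (\<lambda>\<alpha>. axis \<alpha> 1) ` \<Xi> = excited_state N ` \<Xi>"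
    unfolding image_image
    by (rule image_cong) (use assms in \<open>auto simp: cluster_op_axis excited_state_def\<close>)
  finally show ?thesis .
qed

lemma orthonormal_excited_states:
  assumes "N \<le> CARD('k)" "set xs \<subseteq> excitations N" "distinct (xs :: 'k::{finite,linorder} set list)"
  shows "orthonormal_list (map (excited_state N) xs)"
proof -
  have "xs ! i \<in> multiindices N" if "i < length xs" for i
    using assms(2) nth_mem[OF that] by (auto simp: excitations_def)
  then show ?thesis
    using assms by (simp add: orthonormal_list_def excited_state_inner nth_eq_iff_index_eq)
qed

text \<open>The expansion of \<open>G\<close> in determinants, with \<open>U\<close> moved past the excitation operators.  A determinant
  \<open>\<Phi>\<^sub>\<beta>\<close> outside the truncation contributes matrix elements of \<open>X\<^sub>\<beta>\<close> between retained determinants,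
  and those are what rank regularity sets to 0.\<close>

lemma cluster_op_inner_excited_state:
  fixes \<Xi> :: "'k::{finite,linorder} set set"
  assumes N: "N \<le> CARD('k)" and \<Xi>: "\<Xi> \<subseteq> excitations N" and regular: "rank_regular N \<Xi>"
    and G: "G \<in> particle_space N" and u: "u \<in> amp_space \<Xi>" and \<alpha>: "\<alpha> \<in> \<Xi>"
  shows "cluster_op N u G \<bullet> excited_state N \<alpha> =
     (G \<bullet> ref_state N) * (cluster_op N u (ref_state N) \<bullet> excited_state N \<alpha>) +
     (\<Sum>\<beta>\<in>\<Xi>. (G \<bullet> excited_state N \<beta>) *
        (excitation_op N \<beta> (cluster_op N u (ref_state N)) \<bullet> excited_state N \<alpha>))"
proof -
  let ?U = "cluster_op N u" and ?\<Phi> = "excited_state N"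
  let ?X = "\<lambda>\<beta>. excitation_op N \<beta> (?U (ref_state N)) \<bullet> ?\<Phi> \<alpha>"
  have excited: "?U (?\<Phi> \<beta>) = excitation_op N \<beta> (?U (ref_state N))" for \<beta>
    by (simp add: excited_state_def excitation_cluster_commute)
  have multi: "multiindices N = insert (occupied N) (excitations N :: 'k set set)"
    using card_occupied[OF N] by (auto simp: excitations_def multiindices_def)
  have not_exc: "occupied N \<notin> (excitations N :: 'k set set)" by (simp add: excitations_def)
  have vanish: "?X \<beta> = 0" if \<beta>: "\<beta> \<in> excitations N - \<Xi>" for \<beta>
  proof -
    have "(u $ \<gamma>) * (excitation_op N \<beta> (?\<Phi> \<gamma>) \<bullet> ?\<Phi> \<alpha>) = 0" for \<gamma>
      using regular \<beta> \<alpha> u by (cases "\<gamma> \<in> \<Xi>") (auto simp: rank_regular_def amp_space_def)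
    then show ?thesis
      by (simp add: cluster_op_ref_state linear_sum[OF linear_excitation_op]
          linear_scale[OF linear_excitation_op] inner_sum_left)
  qed
  have "?U G = (\<Sum>\<beta>\<in>multiindices N. (G \<bullet> ?\<Phi> \<beta>) *\<^sub>R ?U (?\<Phi> \<beta>))"
    by (subst particle_space_expansion[OF N G])
       (simp add: linear_sum[OF linear_cluster_op] linear_scale[OF linear_cluster_op])
  then have "?U G \<bullet> ?\<Phi> \<alpha> = (\<Sum>\<beta>\<in>multiindices N. (G \<bullet> ?\<Phi> \<beta>) * (?U (?\<Phi> \<beta>) \<bullet> ?\<Phi> \<alpha>))"
    by (simp add: inner_sum_left)
  also have "\<dots> = (G \<bullet> ref_state N) * (?U (ref_state N) \<bullet> ?\<Phi> \<alpha>) +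
      (\<Sum>\<beta>\<in>excitations N. (G \<bullet> ?\<Phi> \<beta>) * ?X \<beta>)"
    unfolding multi using not_exc by (simp add: excited_state_occupied) (simp add: excited)
  also have "(\<Sum>\<beta>\<in>excitations N. (G \<bullet> ?\<Phi> \<beta>) * ?X \<beta>) = (\<Sum>\<beta>\<in>\<Xi>. (G \<bullet> ?\<Phi> \<beta>) * ?X \<beta>)"
    by (rule sum.mono_neutral_right) (use \<Xi> vanish in auto)
  finally show ?thesis .
qed

text \<open>The commutators of the derivative in coordinates; a low-rank equation sees the low-rank
  parts of the point and of the direction only, which makes the Jacobian block triangular.\<close>

definition kp0_derivative ::
  "nat \<Rightarrow> ('k fock \<Rightarrow> 'k fock) \<Rightarrow> 'k::{finite,linorder} set set \<Rightarrow> nat \<Rightarrow> 'k amps \<Rightarrow> 'k amps \<Rightarrow> 'k amps" where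
  "kp0_derivative N H \<Xi> \<rho> t u = (\<Sum>\<alpha>\<in>\<Xi>.
     ((let t' = (if \<alpha> \<in> low_rank N \<Xi> \<rho> then amp_part (low_rank N \<Xi> \<rho>) t else t);
           u' = (if \<alpha> \<in> low_rank N \<Xi> \<rho> then amp_part (low_rank N \<Xi> \<rho>) u else u)
       in similarity N H t' (cluster_op N u' (ref_state N)) -
          cluster_op N u' (similarity N H t' (ref_state N))) \<bullet> excited_state N \<alpha>) *\<^sub>R axis \<alpha> 1)"

lemma amp_part_axis: "amp_part \<Xi> (axis \<alpha> c) = (if \<alpha> \<in> \<Xi> then axis \<alpha> c else 0)"
  by (auto simp: amp_part_def axis_def Finite_Cartesian_Product.vec_eq_iff)

lemma bounded_linear_amp_part: "bounded_linear (amp_part \<Xi>)"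
  unfolding linear_conv_bounded_linear[symmetric]
  by (rule linearI) (auto simp: amp_part_def Finite_Cartesian_Product.vec_eq_iff)

lemma dual_coords_kp0:
  fixes \<Xi> :: "'k::{finite,linorder} set set"
  assumes "\<Xi> \<subseteq> excitations N"
  shows "dual_coords \<Xi> (kp_homotopy N H \<Xi> \<rho> t 0) = (\<Sum>\<alpha>\<in>\<Xi>.
     (similarity N H (if \<alpha> \<in> low_rank N \<Xi> \<rho> then amp_part (low_rank N \<Xi> \<rho>) t else t) (ref_state N)
        \<bullet> excited_state N \<alpha>) *\<^sub>R axis \<alpha> 1)"
proof -
  have zero: "cluster_op N 0 \<psi> = 0" for \<psi> :: "'k fock"
    by (rule bounded_bilinear.zero_left[OF bounded_bilinear_cluster_op])
  have high: "\<alpha> \<in> high_rank N \<Xi> \<rho> \<longleftrightarrow> \<alpha> \<in> \<Xi> \<and> \<alpha> \<notin> low_rank N \<Xi> \<rho>" for \<alpha>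
    by (auto simp: low_rank_def high_rank_def)
  have "kp_homotopy N H \<Xi> \<rho> t 0 (axis \<alpha> 1) =
     similarity N H (if \<alpha> \<in> low_rank N \<Xi> \<rho> then amp_part (low_rank N \<Xi> \<rho>) t else t) (ref_state N)
        \<bullet> excited_state N \<alpha>" if "\<alpha> \<in> \<Xi>" for \<alpha>
    using that assms
    by (auto simp: kp_homotopy_def Let_def amp_part_axis high cluster_op_axis excited_state_def zero)
  then have "(\<Sum>\<alpha>\<in>\<Xi>. (dual_coords \<Xi> (kp_homotopy N H \<Xi> \<rho> t 0) $ \<alpha>) *\<^sub>R axis \<alpha> 1) = (\<Sum>\<alpha>\<in>\<Xi>.
     (similarity N H (if \<alpha> \<in> low_rank N \<Xi> \<rho> then amp_part (low_rank N \<Xi> \<rho>) t else t) (ref_state N)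
        \<bullet> excited_state N \<alpha>) *\<^sub>R (axis \<alpha> 1 :: 'k amps))"
    by (intro sum.cong) (simp_all add: dual_coords_def)
  then show ?thesis
    using amp_space_expansion[OF dual_coords_amp_space[of \<Xi> "kp_homotopy N H \<Xi> \<rho> t 0"]] by simp
qed

lemma has_derivative_kp0:
  fixes \<Xi> :: "'k::{finite,linorder} set set"
  assumes N: "N \<le> CARD('k)" and \<Xi>: "\<Xi> \<subseteq> excitations N" and H: "linear H"
  shows "((\<lambda>t. dual_coords \<Xi> (kp_homotopy N H \<Xi> \<rho> t 0)) has_derivative kp0_derivative N H \<Xi> \<rho> t)
    (at t within X)"
  unfolding dual_coords_kp0[OF \<Xi>] kp0_derivative_def[abs_def]
proof (intro has_derivative_sum has_derivative_scaleR_left has_derivative_inner_left)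
  fix \<alpha> :: "'k set"
  let ?part = "\<lambda>t. if \<alpha> \<in> low_rank N \<Xi> \<rho> then amp_part (low_rank N \<Xi> \<rho>) t else t"
  have "(?part has_derivative ?part) (at t within X)"
    by (cases "\<alpha> \<in> low_rank N \<Xi> \<rho>")
       (auto intro: bounded_linear_imp_has_derivative bounded_linear_amp_part)
  from has_derivative_similarity[OF N H this]
  show "((\<lambda>t. similarity N H (?part t) (ref_state N)) has_derivative
      (\<lambda>u. let t' = ?part t; u' = ?part u
        in similarity N H t' (cluster_op N u' (ref_state N)) -
          cluster_op N u' (similarity N H t' (ref_state N)))) (at t within X)"
    by (simp add: Let_def)
qed

lemma linear_similarity_hat:
  assumes N: "N \<le> CARD('k)" and H: "linear H"
  shows "linear (similarity_hat N H (\<Xi> :: 'k::{finite,linorder} set set) \<rho> t)"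
  by (rule linearI)
    (simp_all add: similarity_hat_def linear_add[OF linear_similarity[OF N H]]
      linear_scale[OF linear_similarity[OF N H]] linear_add[OF linear_excitation_op]
      linear_scale[OF linear_excitation_op] scaleR_add_right sum.distrib scaleR_diff_right
      scaleR_sum_right mult.commute)

text \<open>Listing the low-rank excitations first makes the Jacobian matrix lower block triangular.  In both
  diagonal blocks the second half of the commutator is evaluated with
  \<open>cluster_op_inner_excited_state\<close>.\<close>

lemma det_kp0_derivative:
  fixes \<Xi> :: "'k::{finite,linorder} set set" and \<rho> :: nat and t :: "'k amps"
  assumes N: "N \<le> CARD('k)" and \<Xi>: "\<Xi> \<subseteq> excitations N" and regular: "rank_regular N \<Xi>"
    and H: "linear H" "\<And>\<psi>. H \<psi> \<in> particle_space N"
    and zero: "is_zero_on \<Xi> (\<lambda>t. kp_homotopy N H \<Xi> \<rho> t 0) t"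
    and as: "set as = low_rank N \<Xi> \<rho>" "distinct as" and bs: "set bs = high_rank N \<Xi> \<rho>" "distinct bs"
  defines "t0 \<equiv> amp_part (low_rank N \<Xi> \<rho>) t"
  shows "det (basis_matrix (axis_list (as @ bs)) (kp0_derivative N H \<Xi> \<rho> t)) =
     det (basis_matrix (map (excited_state N) as) (\<lambda>\<psi>. similarity N H t0 \<psi> - cc_energy N H t0 *\<^sub>R \<psi>)) *
     det (basis_matrix (map (excited_state N) bs)
       (\<lambda>\<psi>. similarity_hat N H \<Xi> \<rho> t \<psi> - cc_energy N H t *\<^sub>R \<psi>))"
proof -
  let ?\<Phi> = "excited_state N" and ?D = "kp0_derivative N H \<Xi> \<rho> t" and ?ref = "ref_state N :: 'k fock"
  let ?low = "low_rank N \<Xi> \<rho>" and ?high = "high_rank N \<Xi> \<rho>"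
  let ?A = "basis_matrix (map ?\<Phi> as) (\<lambda>\<psi>. similarity N H t0 \<psi> - cc_energy N H t0 *\<^sub>R \<psi>)"
  let ?B = "basis_matrix (map ?\<Phi> bs) (\<lambda>\<psi>. similarity_hat N H \<Xi> \<rho> t \<psi> - cc_energy N H t *\<^sub>R \<psi>)"
  let ?M = "basis_matrix (axis_list (as @ bs)) ?D"
  define p where "p = length as"
  define q where "q = length bs"
  have low_high: "?low \<subseteq> \<Xi>" "?high \<subseteq> \<Xi>" "?low \<inter> ?high = {}" "\<Xi> = ?low \<union> ?high"
    by (auto simp: low_rank_def high_rank_def)
  have ps: "similarity N H s \<psi> \<in> particle_space N" for s \<psi>
    unfolding similarity_cluster_exp[OF N] by (intro cluster_exp_particle_space[OF N] H(2))
  have coord: "?D (axis \<beta> 1) \<bullet> axis \<alpha> 1 =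
      (if \<alpha> \<in> ?low then (if \<beta> \<in> ?low then (similarity N H t0 (?\<Phi> \<beta>) -
           cluster_op N (axis \<beta> 1) (similarity N H t0 ?ref)) \<bullet> ?\<Phi> \<alpha> else 0)
       else (similarity N H t (?\<Phi> \<beta>) - cluster_op N (axis \<beta> 1) (similarity N H t ?ref)) \<bullet> ?\<Phi> \<alpha>)"
    if "\<alpha> \<in> \<Xi>" "\<beta> \<in> \<Xi>" for \<alpha> \<beta>
  proof -
    have zero: "cluster_op N 0 \<psi> = 0" for \<psi> :: "'k fock"
      by (rule bounded_bilinear.zero_left[OF bounded_bilinear_cluster_op])
    have ax: "cluster_op N (axis \<beta> 1) ?ref = ?\<Phi> \<beta>"
      using that \<Xi> by (auto simp: cluster_op_axis excited_state_def)
    have "(\<Sum>\<gamma>\<in>\<Xi>. c \<gamma> *\<^sub>R axis \<gamma> (1::real)) \<bullet> axis \<alpha> 1 = c \<alpha>" for c :: "'k set \<Rightarrow> real"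
    proof -
      have "(\<Sum>\<gamma>\<in>\<Xi>. c \<gamma> *\<^sub>R axis \<gamma> (1::real)) \<bullet> axis \<alpha> 1 = (\<Sum>\<gamma>\<in>\<Xi>. if \<gamma> = \<alpha> then c \<alpha> else 0)"
        unfolding inner_sum_left by (rule sum.cong) (auto simp: inner_axis_axis)
      then show ?thesis using that by simp
    qed
    then show ?thesis
      by (simp add: kp0_derivative_def Let_def amp_part_axis ax t0_def zero
          linear_0[OF linear_similarity[OF N H(1)]])
  qed
  have amplitude_zero: "similarity N H (if \<alpha> \<in> ?low then t0 else t) ?ref \<bullet> ?\<Phi> \<alpha> = 0" if "\<alpha> \<in> \<Xi>" for \<alpha>
  proof -
    have "dual_coords \<Xi> (kp_homotopy N H \<Xi> \<rho> t 0) $ \<alpha> = 0"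
      using is_zero_on_dual_coords[OF zero] by simp
    moreover have "(\<Sum>\<gamma>\<in>\<Xi>. c \<gamma> *\<^sub>R (axis \<gamma> 1 :: 'k amps)) $ \<alpha> = c \<alpha>" for c :: "'k set \<Rightarrow> real"
    proof -
      have "(\<Sum>\<gamma>\<in>\<Xi>. c \<gamma> *\<^sub>R (axis \<gamma> 1 :: 'k amps)) $ \<alpha> = (\<Sum>\<gamma>\<in>\<Xi>. if \<gamma> = \<alpha> then c \<alpha> else 0)"
        unfolding sum_component by (rule sum.cong) (auto simp: axis_def)
      then show ?thesis using that by simp
    qed
    ultimately show ?thesis unfolding dual_coords_kp0[OF \<Xi>] t0_def by simp
  qed
  \<comment> \<open>low-rank block: the low-rank components of \<open>H(t0) \<Phi>\<^sub>0\<close> vanish at the zero, the others raise the rank too far\<close>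
  have A: "?D (axis \<beta> 1) \<bullet> axis \<alpha> 1 = (similarity N H t0 (?\<Phi> \<beta>) - cc_energy N H t0 *\<^sub>R ?\<Phi> \<beta>) \<bullet> ?\<Phi> \<alpha>"
    if \<alpha>: "\<alpha> \<in> ?low" and \<beta>: "\<beta> \<in> ?low" for \<alpha> \<beta>
  proof -
    let ?G = "similarity N H t0 ?ref"
    have \<alpha>\<beta>: "\<alpha> \<in> \<Xi>" "\<beta> \<in> \<Xi>" using that low_high by auto
    have ax: "cluster_op N (axis \<beta> 1) ?ref = ?\<Phi> \<beta>"
      using \<alpha>\<beta> \<Xi> by (auto simp: cluster_op_axis excited_state_def)
    have "(?G \<bullet> ?\<Phi> \<gamma>) * (excitation_op N \<gamma> (?\<Phi> \<beta>) \<bullet> ?\<Phi> \<alpha>) = 0" if \<gamma>: "\<gamma> \<in> \<Xi>" for \<gamma>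
    proof (cases "\<gamma> \<in> ?low")
      case True
      then show ?thesis using amplitude_zero[OF \<gamma>] by simp
    next
      case False
      have "?\<Phi> \<beta> \<in> rank_filtration N 0" by (simp add: rank_filtration_def)
      from excitation_op_rank_filtration[OF N _ this, of \<gamma>]
      have "excitation_op N \<gamma> (?\<Phi> \<beta>) \<in> rank_filtration N (0 + excitation_rank N \<gamma>)"
        using \<gamma> \<Xi> by blast
      moreover have "excitation_rank N \<alpha> < 0 + excitation_rank N \<gamma>"
        using False \<gamma> \<alpha> by (simp add: low_rank_def)
      ultimately have "excitation_op N \<gamma> (?\<Phi> \<beta>) \<bullet> ?\<Phi> \<alpha> = 0"
        using \<alpha>\<beta> \<Xi> by (intro excited_state_rank[OF N]) (auto simp: excitations_def)
      then show ?thesis by simp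
    qed
    then have "cluster_op N (axis \<beta> 1) ?G \<bullet> ?\<Phi> \<alpha> = cc_energy N H t0 * (?\<Phi> \<beta> \<bullet> ?\<Phi> \<alpha>)"
      using cluster_op_inner_excited_state[OF N \<Xi> regular ps[of t0 ?ref]
        axis_in_amp_space[OF \<alpha>\<beta>(2)] \<alpha>\<beta>(1), of 1] ax
      by (simp add: cc_energy_def)
    then show ?thesis using coord[OF \<alpha>\<beta>] \<alpha> \<beta> by (simp add: inner_diff_left)
  qed
  \<comment> \<open>high-rank block: the low-rank components of \<open>H(t) \<Phi>\<^sub>0\<close> survive, as the low-rank equations hold for \<open>t0\<close>, not for \<open>t\<close>\<close>
  have B: "?D (axis \<beta> 1) \<bullet> axis \<alpha> 1 = (similarity_hat N H \<Xi> \<rho> t (?\<Phi> \<beta>) - cc_energy N H t *\<^sub>R ?\<Phi> \<beta>) \<bullet> ?\<Phi> \<alpha>"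
    if \<alpha>: "\<alpha> \<in> ?high" and \<beta>: "\<beta> \<in> ?high" for \<alpha> \<beta>
  proof -
    let ?G = "similarity N H t ?ref"
    let ?f = "\<lambda>\<gamma>. (?G \<bullet> ?\<Phi> \<gamma>) * (excitation_op N \<gamma> (?\<Phi> \<beta>) \<bullet> ?\<Phi> \<alpha>)"
    have \<alpha>\<beta>: "\<alpha> \<in> \<Xi>" "\<beta> \<in> \<Xi>" "\<alpha> \<notin> ?low" using that low_high by auto
    have ax: "cluster_op N (axis \<beta> 1) ?ref = ?\<Phi> \<beta>"
      using \<alpha>\<beta> \<Xi> by (auto simp: cluster_op_axis excited_state_def)
    have "sum ?f \<Xi> = sum ?f ?low"
    proof (rule sum.mono_neutral_right)
      show "\<forall>\<gamma>\<in>\<Xi> - ?low. ?f \<gamma> = 0"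
      proof
        fix \<gamma> assume "\<gamma> \<in> \<Xi> - ?low"
        then show "?f \<gamma> = 0" using amplitude_zero[of \<gamma>] by simp
      qed
    qed (use low_high in auto)
    then have "cluster_op N (axis \<beta> 1) ?G \<bullet> ?\<Phi> \<alpha> = cc_energy N H t * (?\<Phi> \<beta> \<bullet> ?\<Phi> \<alpha>) + sum ?f ?low"
      using cluster_op_inner_excited_state[OF N \<Xi> regular ps[of t ?ref]
        axis_in_amp_space[OF \<alpha>\<beta>(2)] \<alpha>\<beta>(1), of 1] ax
      by (simp add: cc_energy_def)
    then show ?thesis
      using coord[OF \<alpha>\<beta>(1,2)] \<alpha>\<beta>(3) by (simp add: similarity_hat_def inner_diff_left inner_sum_left)
  qed
  define C where "C = mat q p (\<lambda>(i, j). ?M $$ (i + p, j))"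
  have nth: "as ! i \<in> ?low" if "i < p" for i using that as by (metis nth_mem p_def)
  have nth': "bs ! i \<in> ?high" if "i < q" for i using that bs by (metis nth_mem q_def)
  have nth\<Xi>: "as ! i \<in> \<Xi>" if "i < p" for i using nth[OF that] low_high by blast
  have nth\<Xi>': "bs ! i \<in> \<Xi>" "bs ! i \<notin> ?low" if "i < q" for i using nth'[OF that] low_high by auto
  have "?M = four_block_mat ?A (0\<^sub>m p q) C ?B"
  proof (rule eq_matI)
    fix i j assume "i < dim_row (four_block_mat ?A (0\<^sub>m p q) C ?B)"
      "j < dim_col (four_block_mat ?A (0\<^sub>m p q) C ?B)"
    then have ij: "i < p + q" "j < p + q" by (auto simp: basis_matrix_def p_def q_def)
    have M: "?M $$ (i, j) = ?D (axis ((as @ bs) ! j) 1) \<bullet> axis ((as @ bs) ! i) 1"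
      using ij by (simp add: basis_matrix_def axis_list_nth p_def q_def)
    consider "i < p" "j < p" | "i < p" "\<not> j < p" | "\<not> i < p" "j < p" | "\<not> i < p" "\<not> j < p" by blast
    then show "?M $$ (i, j) = four_block_mat ?A (0\<^sub>m p q) C ?B $$ (i, j)"
    proof cases
      case 1
      then show ?thesis
        unfolding M using A[OF nth nth, of i j] by (simp add: nth_append basis_matrix_def p_def)
    next
      case 2
      then have "j - p < q" using ij by simp
      then show ?thesis
        unfolding M using 2 ij coord[OF nth\<Xi>[of i] nth\<Xi>'(1)[of "j - p"]] nth[of i] nth\<Xi>'(2)[of "j - p"]
        by (simp add: nth_append basis_matrix_def p_def q_def)
    next
      case 3
      then show ?thesis using ij by (simp add: C_def basis_matrix_def p_def q_def)
    next
      case 4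
      then have "i - p < q" "j - p < q" using ij by auto
      then show ?thesis
        unfolding M using 4 ij B[OF nth' nth', of "i - p" "j - p"]
        by (simp add: nth_append basis_matrix_def p_def q_def)
    qed
  qed (simp_all add: basis_matrix_def p_def q_def)
  then show ?thesis
    using det_four_block_mat_upper_right_zero[of ?A p "0\<^sub>m p q" q C ?B]
      basis_matrix_carrier[of "map ?\<Phi> as"] basis_matrix_carrier[of "map ?\<Phi> bs"]
    by (simp add: C_def p_def q_def)
qed

section \<open>Non-degeneracy and index of the zeros\<close>

theorem theorem4p39:
  fixes \<phi> :: "'k::{finite,linorder} \<Rightarrow> real^3 \<Rightarrow> real"
    and V w :: "real^3 \<Rightarrow> real"
    and \<Xi> :: "'k set set"
    and \<rho> N :: nat
    and t :: "'k amps"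
    and H :: "'k fock \<Rightarrow> 'k fock"
  assumes N: "N = CARD('n::{finite,linorder})" "N \<le> CARD('k)"
    and orbitals: "\<And>p. \<phi> p \<in> H1" "orthonormal_orbitals \<phi>"
    and potentials: "V \<in> L32_plus_Linf_eps" "w \<in> L32_plus_Linf_eps"
      "AE x in lborel. w (- x) = w x"
    and H: "H = hamiltonian TYPE('n) \<phi> V w"
    and truncation: "\<Xi> \<subseteq> excitations N" "rank_regular N \<Xi>"
    and "\<rho> \<ge> 1"
    and zero: "is_zero_on \<Xi> (\<lambda>t. kp_homotopy N H \<Xi> \<rho> t 0) t"
  defines "KP0 \<equiv> \<lambda>t. kp_homotopy N H \<Xi> \<rho> t 0"
    and "t0 \<equiv> amp_part (low_rank N \<Xi> \<rho>) t"
    and "W0 \<equiv> cluster_states N (low_rank N \<Xi> \<rho>)"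
    and "W' \<equiv> cluster_states N (high_rank N \<Xi> \<rho>)"
  defines "A0 \<equiv> compression W0 (similarity N H t0)"
    and "A' \<equiv> compression W' (similarity_hat N H \<Xi> \<rho> t)"
  shows "(nondegenerate \<Xi> KP0 t \<longleftrightarrow>
            complex_of_real (cc_energy N H t0) \<notin> op_spectrum W0 A0 \<and>
            complex_of_real (cc_energy N H t) \<notin> op_spectrum W' A')
       \<and> (nondegenerate \<Xi> KP0 t \<longrightarrow>
            isolated_zero \<Xi> KP0 t \<and>
            topological_index \<Xi> KP0 t =
              (-1) ^ (eigenvalues_below W0 A0 (cc_energy N H t0) +
                      eigenvalues_below W' A' (cc_energy N H t)))"
proof -
  define low where "low = low_rank N \<Xi> \<rho>"
  define high where "high = high_rank N \<Xi> \<rho>"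
  have NK: "N \<le> CARD('k)" by (rule N(2))
  have linH: "linear H" unfolding H by (rule linear_hamiltonian)
  have Hps: "H \<psi> \<in> particle_space N" for \<psi> unfolding H N(1) by (rule hamiltonian_particle_space)
  have sub: "low \<subseteq> excitations N" "high \<subseteq> excitations N" "\<Xi> = low \<union> high" "low \<inter> high = {}"
    using truncation(1) by (auto simp: low_def high_def low_rank_def high_rank_def)
  obtain as where as: "set as = low" "distinct as" using finite_distinct_list[of low] by auto
  obtain bs where bs: "set bs = high" "distinct bs" using finite_distinct_list[of high] by auto
  let ?D = "kp0_derivative N H \<Xi> \<rho> t"
  let ?J = "basis_matrix (axis_list (as @ bs)) ?D"
  let ?A = "basis_matrix (map (excited_state N) as) (\<lambda>\<psi>. similarity N H t0 \<psi> - cc_energy N H t0 *\<^sub>R \<psi>)"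
  let ?B = "basis_matrix (map (excited_state N) bs)
     (\<lambda>\<psi>. similarity_hat N H \<Xi> \<rho> t \<psi> - cc_energy N H t *\<^sub>R \<psi>)"
  have dist: "distinct (as @ bs)" "set (as @ bs) = \<Xi>" using as bs sub by auto
  have t: "t \<in> amp_space \<Xi>" using zero by (simp add: is_zero_on_def)
  have der: "((\<lambda>t. dual_coords \<Xi> (KP0 t)) has_derivative kp0_derivative N H \<Xi> \<rho> s) (at s within amp_space \<Xi>)" for s
    unfolding KP0_def by (rule has_derivative_kp0[OF NK truncation(1) linH])
  have range: "?D ` amp_space \<Xi> \<subseteq> amp_space \<Xi>"
    unfolding kp0_derivative_def
    by (auto intro!: real_vector.subspace_sum[OF subspace_amp_space]
        real_vector.subspace_scale[OF subspace_amp_space] axis_in_amp_space)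
  have cont: "continuous_on (amp_space \<Xi>) (\<lambda>t. dual_coords \<Xi> (KP0 t))"
    by (rule has_derivative_continuous_on[OF der])
  have detJ: "det ?J = det ?A * det ?B"
    unfolding t0_def
    by (rule det_kp0_derivative[OF NK truncation linH Hps zero])
       (use as bs in \<open>auto simp: low_def high_def\<close>)
  have onA: "orthonormal_list (map (excited_state N) as)" and onB: "orthonormal_list (map (excited_state N) bs)"
    by (rule orthonormal_excited_states[OF NK]; use as bs sub in auto)+
  have spanA: "span (set (map (excited_state N) as)) = W0"
    using cluster_states_eq_span[OF sub(1)] as by (simp add: W0_def low_def)
  have spanB: "span (set (map (excited_state N) bs)) = W'"
    using cluster_states_eq_span[OF sub(2)] bs by (simp add: W'_def high_def)
  note A = onA spanA linear_similarity[OF NK linH, of t0]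
  note B = onB spanB linear_similarity_hat[OF NK linH, of \<Xi> \<rho> t]
  have nondeg: "nondegenerate \<Xi> KP0 t \<longleftrightarrow> det ?J \<noteq> 0"
    by (rule nondegenerate_iff_det[OF dist t der range])
  have "nondegenerate \<Xi> KP0 t \<longleftrightarrow>
            complex_of_real (cc_energy N H t0) \<notin> op_spectrum W0 A0 \<and>
            complex_of_real (cc_energy N H t) \<notin> op_spectrum W' A'"
    unfolding nondeg detJ A0_def A'_def spectrum_compression_iff[OF A] spectrum_compression_iff[OF B] by simp
  moreover have "isolated_zero \<Xi> KP0 t \<and> topological_index \<Xi> KP0 t =
              (-1) ^ (eigenvalues_below W0 A0 (cc_energy N H t0) +
                      eigenvalues_below W' A' (cc_energy N H t))"
    if "nondegenerate \<Xi> KP0 t"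
  proof
    have J: "det ?J \<noteq> 0" using that nondeg by simp
    have zero': "is_zero_on \<Xi> KP0 t" using zero by (simp add: KP0_def)
    show "isolated_zero \<Xi> KP0 t" by (rule isolated_zero_of_det[OF zero' cont der range dist J])
    have "det ?A \<noteq> 0" "det ?B \<noteq> 0" using J detJ by auto
    then have "sgn (det ?J) = (-1) ^ (eigenvalues_below W0 A0 (cc_energy N H t0) +
                      eigenvalues_below W' A' (cc_energy N H t))"
      unfolding detJ sgn_mult power_add A0_def A'_def
      using sgn_det_eigenvalues_below[OF A] sgn_det_eigenvalues_below[OF B] by simp
    then have "real_of_int (topological_index \<Xi> KP0 t) = real_of_int ((-1) ^ (eigenvalues_below W0 A0 (cc_energy N H t0) +
                      eigenvalues_below W' A' (cc_energy N H t)))"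
      using topological_index_eq_sgn_det[OF zero' cont der range dist J] by simp
    then show "topological_index \<Xi> KP0 t = (-1) ^ (eigenvalues_below W0 A0 (cc_energy N H t0) +
                      eigenvalues_below W' A' (cc_energy N H t))"
      by (simp only: of_int_eq_iff)
  qed
  ultimately show ?thesis by blast
qed

end
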